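(* Let $\Bbbk$ be an algebraically closed field of characteristic zero, $q\in\Bbbk$ nonzero and not a root of unity, $R=\Bbbk\langle x,y : yx=qxy+1\rangle$, $\mu\in\Bbbk^*$, and let $\sigma$ be the automorphism of $R$ with $\sigma(x)=\mu^{-1}x$, $\sigma(y)=\mu y$. Let $\mathrm{Der}_\sigma(R)$, $\mathrm{Inn}_\sigma(R)$, $I_w$, $\mathcal H_\mu$ and $\mathcal P_\mu$ be as defined in the context. Then every $\sigma$-derivation $\delta$ of $R$ can be written uniquely in the form $$\delta=I_w+\eta+\xi,$$ where $I_w\in\mathrm{Inn}_\sigma(R)$, $\eta\in\mathcal H_\mu$ and $\xi\in\mathcal P_\mu$. Equivalently, $$\mathrm{Der}_\sigma(R)=\mathrm{Inn}_\sigma(R)\oplus\mathcal H_\mu\oplus\mathcal P_\mu .$$ Moreover, each summand is stable under the conjugation action $\delta\mapsto\rho\delta\rho^{-1}$ of $\rho\in\mathrm{Aut}(R)$.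
   Context: A $\sigma$-derivation of $R$ is a $\Bbbk$-linear map $\delta:R\to R$ with $\delta(ab)=\delta(a)b+\sigma(a)\delta(b)$ for all $a,b\in R$; $\mathrm{Der}_\sigma(R)$ is the vector space of all of them. Since $q$ is not a root of unity, every automorphism of $R$ is of the form $\rho_\beta$ with $\rho_\beta(x)=\beta^{-1}x$, $\rho_\beta(y)=\beta y$, $\beta\in\Bbbk^*$; these all commute with $\sigma$. For $w\in R$, $I_w(a)=wa-\sigma(a)w$ for $a\in R$; this is a $\sigma$-derivation (the inner $\sigma$-derivation induced by $w$), and $\mathrm{Inn}_\sigma(R)=\{I_w: w\in R\}$. Let $h=1-yx\in R$. For an integer $r\ge 0$, $H_r$ denotes the $\sigma$-derivation of $R$ given on generators by $H_r(x)=h^r x$ and $H_r(y)=\mu^{-1}(q^{-1}h)^r y$. Define $\mathcal H_\mu=\Bbbk H_r$ if $\mu=q^{-r}$ for some $r\ge0$, and $\mathcal H_\mu=0$ otherwise. If $\mu=q$, then for integers $i,j\ge0$ let $X_i,Y_j$ be the $\sigma$-derivations of $R$ with $X_i(x)=y^i$, $X_i(y)=0$, and $Y_j(x)=0$, $Y_j(y)=x^j$, and define $\mathcal P_\mu=\big(\bigoplus_{i\ge0}\Bbbk X_i\big)\oplus\big(\bigoplus_{j\ge0}\Bbbk Y_j\big)$. If $\mu\ne q$, define $\mathcal P_\mu=0$.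
   Formalization: As printed, H_r is not a σ-derivation (e.g. r=0, μ=1: x↦x, y↦y violates yx=qxy+1). Proved instead with h=1−(1−q)yx and H_r(y)=−μ^{-1}(q^{-1}h)^r y; the rest is unchanged. *)

theory Defs
  imports
    "HOL-Algebra.QuotRing"
    "HOL-Algebra.Module"
    "HOL-Library.Poly_Mapping"
    "HOL-Computational_Algebra.Polynomial"
begin

section \<open>The free algebra on two generators\<close>

datatype gen = X_gen | Y_gen

text \<open>Words in the generators, with concatenation written additively: \<^typ>\<open>'a \<Rightarrow>\<^sub>0 'b\<close> has
  the convolution product with respect to addition on the index type.\<close>

datatype gword = Word (letters: "gen list")

instantiation gword :: monoid_add
begin

definition zero_gword :: gword where "0 = Word []"

definition plus_gword :: "gword \<Rightarrow> gword \<Rightarrow> gword"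
  where "u + v = Word (letters u @ letters v)"

instance by standard (auto simp: zero_gword_def plus_gword_def)

end

type_synonym 'k free_alg = "gword \<Rightarrow>\<^sub>0 'k"

definition free_gen :: "gen \<Rightarrow> 'k::field free_alg"
  where "free_gen g = Poly_Mapping.single (Word [g]) 1"

definition free_scalar :: "'k::field \<Rightarrow> 'k free_alg"
  where "free_scalar c = Poly_Mapping.single 0 c"

definition type_ring :: "'a::ring_1 ring"
  where "type_ring = \<lparr>carrier = UNIV, monoid.mult = (*), one = 1, ring.zero = 0, add = (+)\<rparr>"


section \<open>The algebra generated by x and y subject to yx = qxy + 1\<close>

definition qweyl_ideal :: "'k::field \<Rightarrow> 'k free_alg set"
  where "qweyl_ideal q =
    Idl\<^bsub>type_ring\<^esub> {free_gen Y_gen * free_gen X_gen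
                  - (free_scalar q * free_gen X_gen * free_gen Y_gen + 1)}"

definition qweyl_cls :: "'k::field \<Rightarrow> 'k free_alg \<Rightarrow> 'k free_alg set"
  where "qweyl_cls q f = qweyl_ideal q +>\<^bsub>type_ring\<^esub> f"

text \<open>The record type \<^typ>\<open>('k, 'r) module\<close> is used for (noncommutative) algebras: a ring
  together with a scalar multiplication.\<close>

definition qweyl :: "'k::field \<Rightarrow> ('k, 'k free_alg set) module"
  where "qweyl q = ring.extend (type_ring Quot qweyl_ideal q)
    (module.fields (\<lambda>c a. qweyl_cls q (free_scalar c) \<otimes>\<^bsub>type_ring Quot qweyl_ideal q\<^esub> a))"

definition qweyl_x :: "'k::field \<Rightarrow> 'k free_alg set"
  where "qweyl_x q = qweyl_cls q (free_gen X_gen)"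

definition qweyl_y :: "'k::field \<Rightarrow> 'k free_alg set"
  where "qweyl_y q = qweyl_cls q (free_gen Y_gen)"


section \<open>Automorphisms and skew derivations of an algebra\<close>

text \<open>Maps from an algebra to itself are represented by functions that are \<^const>\<open>undefined\<close>
  outside the carrier, so that equality of maps is equality of functions.\<close>

definition alg_aut :: "('k, 'r) module \<Rightarrow> ('r \<Rightarrow> 'r) set"
  where "alg_aut A = {\<rho> \<in> ring_iso A A. \<rho> \<in> extensional (carrier A) \<and>
    (\<forall>c. \<forall>a \<in> carrier A. \<rho> (c \<odot>\<^bsub>A\<^esub> a) = c \<odot>\<^bsub>A\<^esub> \<rho> a)}"

definition skew_der :: "('k, 'r) module \<Rightarrow> ('r \<Rightarrow> 'r) \<Rightarrow> ('r \<Rightarrow> 'r) set"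
  where "skew_der A \<sigma> = {\<delta> \<in> carrier A \<rightarrow>\<^sub>E carrier A.
    (\<forall>a \<in> carrier A. \<forall>b \<in> carrier A. \<delta> (a \<oplus>\<^bsub>A\<^esub> b) = \<delta> a \<oplus>\<^bsub>A\<^esub> \<delta> b) \<and>
    (\<forall>c. \<forall>a \<in> carrier A. \<delta> (c \<odot>\<^bsub>A\<^esub> a) = c \<odot>\<^bsub>A\<^esub> \<delta> a) \<and>
    (\<forall>a \<in> carrier A. \<forall>b \<in> carrier A.
      \<delta> (a \<otimes>\<^bsub>A\<^esub> b) = \<delta> a \<otimes>\<^bsub>A\<^esub> b \<oplus>\<^bsub>A\<^esub> \<sigma> a \<otimes>\<^bsub>A\<^esub> \<delta> b)}"

text \<open>The vector space of skew derivations. The fields \<^const>\<open>monoid.mult\<close> and \<^const>\<open>one\<close> play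
  no role in a module.\<close>

definition Der :: "('k, 'r) module \<Rightarrow> ('r \<Rightarrow> 'r) \<Rightarrow> ('k, 'r \<Rightarrow> 'r) module"
  where "Der A \<sigma> = \<lparr>carrier = skew_der A \<sigma>, monoid.mult = undefined, one = undefined,
    ring.zero = (\<lambda>a \<in> carrier A. \<zero>\<^bsub>A\<^esub>),
    add = (\<lambda>\<delta> \<epsilon>. \<lambda>a \<in> carrier A. \<delta> a \<oplus>\<^bsub>A\<^esub> \<epsilon> a),
    module.smult = (\<lambda>c \<delta>. \<lambda>a \<in> carrier A. c \<odot>\<^bsub>A\<^esub> \<delta> a)\<rparr>"

definition inner_der :: "('k, 'r) module \<Rightarrow> ('r \<Rightarrow> 'r) \<Rightarrow> 'r \<Rightarrow> 'r \<Rightarrow> 'r"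
  where "inner_der A \<sigma> w = (\<lambda>a \<in> carrier A. w \<otimes>\<^bsub>A\<^esub> a \<ominus>\<^bsub>A\<^esub> \<sigma> a \<otimes>\<^bsub>A\<^esub> w)"

definition Inn :: "('k, 'r) module \<Rightarrow> ('r \<Rightarrow> 'r) \<Rightarrow> ('r \<Rightarrow> 'r) set"
  where "Inn A \<sigma> = inner_der A \<sigma> ` carrier A"

definition conj_map :: "('k, 'r) module \<Rightarrow> ('r \<Rightarrow> 'r) \<Rightarrow> ('r \<Rightarrow> 'r) \<Rightarrow> 'r \<Rightarrow> 'r"
  where "conj_map A \<rho> \<delta> = (\<lambda>a \<in> carrier A. \<rho> (\<delta> (inv_into (carrier A) \<rho> a)))"

definition conj_stable :: "('k, 'r) module \<Rightarrow> ('r \<Rightarrow> 'r) set \<Rightarrow> bool"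
  where "conj_stable A S \<longleftrightarrow> (\<forall>\<rho> \<in> alg_aut A. \<forall>\<delta> \<in> S. conj_map A \<rho> \<delta> \<in> S)"

definition internal_direct_sum3 ::
  "('k::field, 'm) module \<Rightarrow> 'm set \<Rightarrow> 'm set \<Rightarrow> 'm set \<Rightarrow> bool"
  where "internal_direct_sum3 M A B C \<longleftrightarrow>
    submodule A type_ring M \<and> submodule B type_ring M \<and> submodule C type_ring M \<and>
    carrier M = A <+>\<^bsub>M\<^esub> B <+>\<^bsub>M\<^esub> C \<and>
    (\<forall>a \<in> A. \<forall>b \<in> B. \<forall>c \<in> C.
      a \<oplus>\<^bsub>M\<^esub> b \<oplus>\<^bsub>M\<^esub> c = \<zero>\<^bsub>M\<^esub> \<longrightarrow> a = \<zero>\<^bsub>M\<^esub> \<and> b = \<zero>\<^bsub>M\<^esub> \<and> c = \<zero>\<^bsub>M\<^esub>)"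


section \<open>Special skew derivations of the algebra\<close>

definition der_on_gens ::
  "'k::field \<Rightarrow> ('k free_alg set \<Rightarrow> 'k free_alg set) \<Rightarrow> 'k free_alg set \<Rightarrow> 'k free_alg set
    \<Rightarrow> 'k free_alg set \<Rightarrow> 'k free_alg set"
  where "der_on_gens q \<sigma> u v =
    (THE \<delta>. \<delta> \<in> skew_der (qweyl q) \<sigma> \<and> \<delta> (qweyl_x q) = u \<and> \<delta> (qweyl_y q) = v)"

text \<open>The element \<open>h = 1 - (1 - q)yx = q(yx - xy)\<close> is the one that satisfies \<open>hx = qxh\<close> and
  \<open>yh = qhy\<close>. For the presentation of the same algebra by \<open>y'x = qxy' + (1 - q)\<close>, where
  \<open>y' = (1 - q)y\<close>, it reads \<open>1 - y'x\<close>; without the factor \<open>1 - q\<close> the element \<open>1 - yx = - qxy\<close>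
  would not be normal here.\<close>

definition qweyl_h :: "'k::field \<Rightarrow> 'k free_alg set"
  where "qweyl_h q =
    \<one>\<^bsub>qweyl q\<^esub> \<ominus>\<^bsub>qweyl q\<^esub> (1 - q) \<odot>\<^bsub>qweyl q\<^esub> (qweyl_y q \<otimes>\<^bsub>qweyl q\<^esub> qweyl_x q)"

text \<open>The value at \<open>y\<close> carries a minus sign: for \<open>\<mu> = 1\<close> and \<open>r = 0\<close> this is the derivation
  \<open>x \<mapsto> x\<close>, \<open>y \<mapsto> - y\<close>, whereas \<open>x \<mapsto> x\<close>, \<open>y \<mapsto> y\<close> does not respect \<open>yx = qxy + 1\<close>. See
  \<open>no_skew_der_unsigned_H\<close> below.\<close>

definition H_der ::
  "'k::field \<Rightarrow> 'k \<Rightarrow> ('k free_alg set \<Rightarrow> 'k free_alg set) \<Rightarrow> nat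
    \<Rightarrow> 'k free_alg set \<Rightarrow> 'k free_alg set"
  where "H_der q \<mu> \<sigma> r = der_on_gens q \<sigma>
    (qweyl_h q [^]\<^bsub>qweyl q\<^esub> r \<otimes>\<^bsub>qweyl q\<^esub> qweyl_x q)
    (\<ominus>\<^bsub>qweyl q\<^esub> (inverse \<mu> \<odot>\<^bsub>qweyl q\<^esub>
      ((inverse q \<odot>\<^bsub>qweyl q\<^esub> qweyl_h q) [^]\<^bsub>qweyl q\<^esub> r \<otimes>\<^bsub>qweyl q\<^esub> qweyl_y q)))"

definition H_space ::
  "'k::field \<Rightarrow> 'k \<Rightarrow> ('k free_alg set \<Rightarrow> 'k free_alg set)
    \<Rightarrow> ('k free_alg set \<Rightarrow> 'k free_alg set) set"
  where "H_space q \<mu> \<sigma> =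
    (if \<exists>r. \<mu> = inverse q ^ r
     then {c \<odot>\<^bsub>Der (qweyl q) \<sigma>\<^esub> H_der q \<mu> \<sigma> r | c r. \<mu> = inverse q ^ r}
     else {\<zero>\<^bsub>Der (qweyl q) \<sigma>\<^esub>})"

definition X_der ::
  "'k::field \<Rightarrow> ('k free_alg set \<Rightarrow> 'k free_alg set) \<Rightarrow> nat
    \<Rightarrow> 'k free_alg set \<Rightarrow> 'k free_alg set"
  where "X_der q \<sigma> i = der_on_gens q \<sigma> (qweyl_y q [^]\<^bsub>qweyl q\<^esub> i) \<zero>\<^bsub>qweyl q\<^esub>"

definition Y_der ::
  "'k::field \<Rightarrow> ('k free_alg set \<Rightarrow> 'k free_alg set) \<Rightarrow> nat
    \<Rightarrow> 'k free_alg set \<Rightarrow> 'k free_alg set"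
  where "Y_der q \<sigma> j = der_on_gens q \<sigma> \<zero>\<^bsub>qweyl q\<^esub> (qweyl_x q [^]\<^bsub>qweyl q\<^esub> j)"

definition P_space ::
  "'k::field \<Rightarrow> 'k \<Rightarrow> ('k free_alg set \<Rightarrow> 'k free_alg set)
    \<Rightarrow> ('k free_alg set \<Rightarrow> 'k free_alg set) set"
  where "P_space q \<mu> \<sigma> =
    (let D = Der (qweyl q) \<sigma> in
     if \<mu> = q
     then {(\<Oplus>\<^bsub>D\<^esub>i \<in> S. a i \<odot>\<^bsub>D\<^esub> X_der q \<sigma> i) \<oplus>\<^bsub>D\<^esub> (\<Oplus>\<^bsub>D\<^esub>j \<in> T. b j \<odot>\<^bsub>D\<^esub> Y_der q \<sigma> j)
           | a b S T. finite S \<and> finite T}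
     else {\<zero>\<^bsub>D\<^esub>})"


section \<open>Basic facts\<close>

lemma ring_type_ring: "ring (type_ring :: 'a::ring_1 ring)"
proof (rule ringI)
  show "abelian_group (type_ring :: 'a ring)"
    by (rule abelian_groupI)
      (auto simp: type_ring_def algebra_simps intro: exI[of _ "- _"] add.left_inverse)
  show "monoid (type_ring :: 'a ring)"
    by unfold_locales (auto simp: type_ring_def algebra_simps)
qed (auto simp: type_ring_def algebra_simps)

lemma ideal_qweyl_ideal: "ideal (qweyl_ideal q) type_ring"
  unfolding qweyl_ideal_def
  by (rule ring.genideal_ideal[OF ring_type_ring]) (simp add: type_ring_def)

lemma qweyl_simps:
  "carrier (qweyl q) = range (qweyl_cls q)"
  "\<one>\<^bsub>qweyl q\<^esub> = qweyl_cls q 1"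
  "\<zero>\<^bsub>qweyl q\<^esub> = qweyl_cls q 0"
  "qweyl_cls q f \<oplus>\<^bsub>qweyl q\<^esub> qweyl_cls q g = qweyl_cls q (f + g)"
  "qweyl_cls q f \<otimes>\<^bsub>qweyl q\<^esub> qweyl_cls q g = qweyl_cls q (f * g)"
  "c \<odot>\<^bsub>qweyl q\<^esub> qweyl_cls q f = qweyl_cls q (free_scalar c * f)"
proof -
  interpret I: ideal "qweyl_ideal q" type_ring by (rule ideal_qweyl_ideal)
  have h: "(+>\<^bsub>type_ring\<^esub>) (qweyl_ideal q) \<in> ring_hom type_ring (type_ring Quot qweyl_ideal q)"
    by (rule I.rcos_ring_hom)
  note R = ring.defs module.defs ring.simps module.simps monoid.simps partial_object.simps
  show "carrier (qweyl q) = range (qweyl_cls q)"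
    by (auto simp: qweyl_def qweyl_cls_def FactRing_def A_RCOSETS_def RCOSETS_def a_r_coset_def
      type_ring_def R)
  show "\<one>\<^bsub>qweyl q\<^esub> = qweyl_cls q 1"
    by (auto simp: qweyl_def qweyl_cls_def FactRing_simps type_ring_def R)
  have "qweyl_cls q 0 = qweyl_ideal q"
    using I.a_rcos_const[OF additive_subgroup.zero_closed[OF I.additive_subgroup_axioms]]
    by (simp add: qweyl_cls_def type_ring_def)
  then show "\<zero>\<^bsub>qweyl q\<^esub> = qweyl_cls q 0"
    by (auto simp: qweyl_def FactRing_def R)
  show "qweyl_cls q f \<oplus>\<^bsub>qweyl q\<^esub> qweyl_cls q g = qweyl_cls q (f + g)"
    using ring_hom_add[OF h, of f g] by (simp add: qweyl_def qweyl_cls_def R type_ring_def)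
  show m: "qweyl_cls q f \<otimes>\<^bsub>qweyl q\<^esub> qweyl_cls q g = qweyl_cls q (f * g)" for f g
    using ring_hom_mult[OF h, of f g] by (simp add: qweyl_def qweyl_cls_def R type_ring_def)
  show "c \<odot>\<^bsub>qweyl q\<^esub> qweyl_cls q f = qweyl_cls q (free_scalar c * f)"
    using m[of "free_scalar c" f] by (simp add: qweyl_def R)
qed

lemma ring_qweyl: "ring (qweyl q)"
proof (rule ringI)
  show "abelian_group (qweyl q)"
  proof (rule abelian_groupI)
    fix a assume "a \<in> carrier (qweyl q)"
    then obtain f where "a = qweyl_cls q f" by (auto simp: qweyl_simps(1))
    then have "qweyl_cls q (- f) \<oplus>\<^bsub>qweyl q\<^esub> a = \<zero>\<^bsub>qweyl q\<^esub>" by (simp add: qweyl_simps)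
    then show "\<exists>b \<in> carrier (qweyl q). b \<oplus>\<^bsub>qweyl q\<^esub> a = \<zero>\<^bsub>qweyl q\<^esub>"
      by (rule bexI) (simp add: qweyl_simps(1))
  qed (auto simp: qweyl_simps algebra_simps)
  show "monoid (qweyl q)"
    by (rule monoidI) (auto simp: qweyl_simps algebra_simps)
qed (auto simp: qweyl_simps algebra_simps)

lemma qweyl_uminus: "\<ominus>\<^bsub>qweyl q\<^esub> qweyl_cls q f = qweyl_cls q (- f)"
proof -
  interpret Q: ring "qweyl q" by (rule ring_qweyl)
  show ?thesis
    by (rule Q.minus_equality) (auto simp: qweyl_simps)
qed

lemma qweyl_pow: "qweyl_cls q f [^]\<^bsub>qweyl q\<^esub> (n::nat) = qweyl_cls q (f ^ n)"
proof -
  interpret Q: ring "qweyl q" by (rule ring_qweyl)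
  show ?thesis
    by (induction n) (auto simp: qweyl_simps power_commutes)
qed

lemma qweyl_relation:
  "qweyl_y q \<otimes>\<^bsub>qweyl q\<^esub> qweyl_x q = q \<odot>\<^bsub>qweyl q\<^esub> (qweyl_x q \<otimes>\<^bsub>qweyl q\<^esub> qweyl_y q) \<oplus>\<^bsub>qweyl q\<^esub> \<one>\<^bsub>qweyl q\<^esub>"
proof -
  let ?a = "free_gen Y_gen * free_gen X_gen"
  let ?b = "free_scalar q * free_gen X_gen * free_gen Y_gen + 1"
  interpret I: ideal "qweyl_ideal q" type_ring by (rule ideal_qweyl_ideal)
  have "?a - ?b \<in> qweyl_ideal q"
    unfolding qweyl_ideal_def
    by (rule ring.genideal_self'[OF ring_type_ring]) (simp add: type_ring_def)
  then have "?a \<in> qweyl_ideal q +>\<^bsub>type_ring\<^esub> ?b"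
    by (force simp: a_r_coset_def' type_ring_def)
  then have "qweyl_cls q ?a = qweyl_cls q ?b"
    unfolding qweyl_cls_def using I.a_repr_independence'[of ?a ?b] by (simp add: type_ring_def)
  then show ?thesis
    by (simp add: qweyl_x_def qweyl_y_def qweyl_simps mult.assoc)
qed

text \<open>The character \<open>x \<mapsto> 1\<close>, \<open>y \<mapsto> 1/(1 - q)\<close> of the algebra, on representatives.\<close>

definition "chi_gen q g = (case g of X_gen \<Rightarrow> 1 | Y_gen \<Rightarrow> inverse (1 - q :: 'k::field))"
definition "chi_word q w = prod_list (map (chi_gen q) (letters w))"
definition "chi q f = (\<Sum>w \<in> Poly_Mapping.keys f. Poly_Mapping.lookup f w * chi_word q w)"

lemma letters_zero: "letters 0 = []"
  by (simp add: zero_gword_def)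

lemma chi_superset:
  "finite S \<Longrightarrow> Poly_Mapping.keys f \<subseteq> S \<Longrightarrow>
    chi q f = (\<Sum>w\<in>S. Poly_Mapping.lookup f w * chi_word q w)"
  unfolding chi_def by (rule sum.mono_neutral_left) (auto simp: in_keys_iff)

lemma chi_add: "chi q (f + g) = chi q f + chi q g"
proof -
  let ?S = "Poly_Mapping.keys f \<union> Poly_Mapping.keys g"
  have "Poly_Mapping.keys (f + g) \<subseteq> ?S" by (rule Poly_Mapping.keys_add)
  then show ?thesis
    by (subst (1 2 3) chi_superset[of ?S])
       (auto simp: lookup_add algebra_simps sum.distrib)
qed

lemma chi_single: "chi q (Poly_Mapping.single w c) = c * chi_word q w"
  by (subst chi_superset[of "{w}"]) auto

lemma chi_0: "chi q 0 = 0" by (simp add: chi_def)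

lemma chi_sum: "chi q (sum F S) = (\<Sum>s\<in>S. chi q (F s))"
  by (induction S rule: infinite_finite_induct) (auto simp: chi_0 chi_add)

lemma expand: "f = (\<Sum>w\<in>Poly_Mapping.keys f. Poly_Mapping.single w (Poly_Mapping.lookup f w))"
  by (rule poly_mapping_eqI)
     (auto simp: lookup_sum lookup_single when_def in_keys_iff)

lemma chi_mult: "chi q (f * g) = chi q f * chi q g"
proof -
  have "f * g = (\<Sum>w\<in>Poly_Mapping.keys f. \<Sum>v\<in>Poly_Mapping.keys g.
      Poly_Mapping.single (w + v) (Poly_Mapping.lookup f w * Poly_Mapping.lookup g v))"
    by (subst expand[of f], subst expand[of g]) (simp add: sum_product mult_single)
  then have "chi q (f * g) = (\<Sum>w\<in>Poly_Mapping.keys f. \<Sum>v\<in>Poly_Mapping.keys g.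
      Poly_Mapping.lookup f w * Poly_Mapping.lookup g v * chi_word q (w + v))"
    by (simp only: chi_sum chi_single)
  then show ?thesis
    by (simp add: sum_product chi_def chi_word_def plus_gword_def mult_ac)
qed

lemma chi_1: "chi q 1 = 1"
  using chi_single[of q 0 1] by (simp add: chi_word_def letters_zero)

lemma chi_uminus: "chi q (- f) = - chi q f"
  using chi_add[of q f "- f"] by (simp add: chi_0 eq_neg_iff_add_eq_0 add.commute)

lemma chi_diff: "chi q (f - g) = chi q f - chi q g"
  using chi_add[of q f "- g"] by (simp add: chi_uminus)

lemma chi_pow: "chi q (f ^ n) = chi q f ^ n"
  by (induction n) (auto simp: chi_1 chi_mult)

lemma chi_scalar: "chi q (free_scalar c) = c"
  by (simp add: free_scalar_def chi_single chi_word_def letters_zero)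

lemma chi_free_gen: "chi q (free_gen g) = chi_gen q g"
  by (simp add: free_gen_def chi_single chi_word_def)

lemmas chi_simps = chi_add chi_mult chi_0 chi_1 chi_uminus chi_diff chi_pow chi_scalar
  chi_free_gen chi_gen_def

lemma chi_cong:
  assumes "q \<noteq> (1::'k::field)" "qweyl_cls q f = qweyl_cls q g"
  shows "chi q f = chi q g"
proof -
  have ker: "a_kernel type_ring type_ring (chi q) = {f. chi q f = 0}"
    by (auto simp: a_kernel_def' type_ring_def)
  have "ring_hom_ring type_ring type_ring (chi q)"
    by (rule ring_hom_ringI[OF ring_type_ring ring_type_ring])
      (auto simp: type_ring_def chi_add chi_mult chi_1)
  then have K: "ideal {f. chi q f = 0} type_ring"
    using ring_hom_ring.kernel_is_ideal ker by metis
  have "1 - q \<noteq> 0" using assms(1) by simp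
  then have "inverse (1 - q) - (q * inverse (1 - q) + 1) = 0" by (simp add: field_simps)
  then have "qweyl_ideal q \<subseteq> {f. chi q f = 0}"
    unfolding qweyl_ideal_def
    by (intro ring.genideal_minimal[OF ring_type_ring K])
       (simp add: chi_simps)
  moreover have "f \<in> qweyl_cls q f"
    using abelian_subgroup.a_rcos_self[OF ideal.axioms(1)[OF ideal_qweyl_ideal,
        THEN abelian_subgroupI3, OF ring.is_abelian_group[OF ring_type_ring]]]
    by (simp add: qweyl_cls_def type_ring_def)
  then obtain k where "k \<in> qweyl_ideal q" "f = k + g"
    unfolding assms(2) by (auto simp: qweyl_cls_def a_r_coset_def' type_ring_def)
  ultimately show ?thesis
    by (auto simp: chi_add)
qed

text \<open>For every \<open>r\<close>, the values \<open>x \<mapsto> h\<^sup>rx\<close>, \<open>y \<mapsto> \<mu>\<^sup>-\<^sup>1(q\<^sup>-\<^sup>1h)\<^sup>ry\<close> with \<open>h = 1 - yx\<close> are not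
  those of a skew derivation.\<close>

lemma no_skew_der_unsigned_H:
  fixes q :: "'k::field_char_0"
  defines "h \<equiv> \<one>\<^bsub>qweyl q\<^esub> \<ominus>\<^bsub>qweyl q\<^esub> qweyl_y q \<otimes>\<^bsub>qweyl q\<^esub> qweyl_x q"
  assumes q: "q \<noteq> 0" "\<forall>n::nat. n > 0 \<longrightarrow> q ^ n \<noteq> 1"
    and mu: "\<mu> = inverse q ^ r"
    and s: "\<sigma> \<in> alg_aut (qweyl q)"
    "\<sigma> (qweyl_x q) = inverse \<mu> \<odot>\<^bsub>qweyl q\<^esub> qweyl_x q"
    "\<sigma> (qweyl_y q) = \<mu> \<odot>\<^bsub>qweyl q\<^esub> qweyl_y q"
    and d: "\<delta> \<in> skew_der (qweyl q) \<sigma>"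
    "\<delta> (qweyl_x q) = h [^]\<^bsub>qweyl q\<^esub> r \<otimes>\<^bsub>qweyl q\<^esub> qweyl_x q"
    "\<delta> (qweyl_y q) = inverse \<mu> \<odot>\<^bsub>qweyl q\<^esub>
      ((inverse q \<odot>\<^bsub>qweyl q\<^esub> h) [^]\<^bsub>qweyl q\<^esub> r \<otimes>\<^bsub>qweyl q\<^esub> qweyl_y q)"
  shows False
proof -
  interpret Q: ring "qweyl q" by (rule ring_qweyl)
  let ?X = "free_gen X_gen :: 'k free_alg" and ?Y = "free_gen Y_gen :: 'k free_alg"
  let ?C = "qweyl_cls q"
  let ?S = "\<lambda>c. free_scalar c :: 'k free_alg"
  have q1: "q \<noteq> 1" using q(2)[rule_format, of 1] by auto
  have h: "h = ?C (1 - ?Y * ?X)"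
    by (simp add: h_def a_minus_def qweyl_simps qweyl_uminus qweyl_x_def qweyl_y_def)
  define u where "u = (1 - ?Y * ?X) ^ r * ?X"
  define v where "v = ?S (inverse \<mu>) * ((?S (inverse q) * (1 - ?Y * ?X)) ^ r * ?Y)"
  have dx: "\<delta> (?C ?X) = ?C u"
    using d(2) by (simp add: h qweyl_simps qweyl_pow qweyl_x_def qweyl_y_def u_def)
  have dy: "\<delta> (?C ?Y) = ?C v"
    using d(3) by (simp add: h qweyl_simps qweyl_pow qweyl_x_def qweyl_y_def v_def)
  have sx: "\<sigma> (?C ?X) = ?C (?S (inverse \<mu>) * ?X)" and sy: "\<sigma> (?C ?Y) = ?C (?S \<mu> * ?Y)"
    using s by (simp_all add: qweyl_simps qweyl_x_def qweyl_y_def)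
  have s1: "\<sigma> (?C 1) = ?C 1"
    using s(1) by (auto simp: alg_aut_def ring_iso_def ring_hom_def qweyl_simps)
  have add: "\<delta> (?C (a + b)) = \<delta> (?C a) \<oplus>\<^bsub>qweyl q\<^esub> \<delta> (?C b)" for a b
    using d(1) by (auto simp: skew_der_def qweyl_simps simp flip: qweyl_simps(4))
  have smul: "\<delta> (?C (?S c * b)) = c \<odot>\<^bsub>qweyl q\<^esub> \<delta> (?C b)" for c b
    using d(1) by (auto simp: skew_der_def qweyl_simps simp flip: qweyl_simps(6))
  have mul: "\<delta> (?C (a * b)) = \<delta> (?C a) \<otimes>\<^bsub>qweyl q\<^esub> ?C b \<oplus>\<^bsub>qweyl q\<^esub> \<sigma> (?C a) \<otimes>\<^bsub>qweyl q\<^esub> \<delta> (?C b)" for a b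
    using d(1) by (auto simp: skew_der_def qweyl_simps simp flip: qweyl_simps(5))
  obtain e where e: "\<delta> (?C 1) = ?C e"
  proof -
    have "?C 1 \<in> carrier (qweyl q)" by (simp add: qweyl_simps(1))
    then have "\<delta> (?C 1) \<in> carrier (qweyl q)" using d(1) unfolding skew_der_def by blast
    then show thesis using that by (auto simp: qweyl_simps(1))
  qed
  have "?C e = ?C (e + e)"
    using mul[of 1 1] by (simp add: e s1 qweyl_simps)
  then have e0: "chi q e = 0"
    using chi_cong[OF q1, of e "e + e"] by (simp add: chi_simps)
  have rel: "?C (?Y * ?X) = ?C (?S q * (?X * ?Y) + 1)"
    using qweyl_relation[of q] by (simp add: qweyl_simps qweyl_x_def qweyl_y_def)
  have "?C (v * ?X + ?S \<mu> * ?Y * u)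
      = ?C (?S q * (u * ?Y + ?S (inverse \<mu>) * ?X * v) + e)"
    using arg_cong[OF rel, of \<delta>]
    by (simp add: add smul mul[of ?Y ?X] mul[of ?X ?Y] dx dy sx sy e qweyl_simps)
  then have "chi q (v * ?X + ?S \<mu> * ?Y * u)
      = chi q (?S q * (u * ?Y + ?S (inverse \<mu>) * ?X * v) + e)"
    by (rule chi_cong[OF q1])
  moreover define i where "i = inverse (1 - q)"
  have i0: "i \<noteq> 0" using q1 by (simp add: i_def)
  have c0: "1 - i \<noteq> 0" using q(1) q1 by (simp add: i_def field_simps)
  have mu0: "\<mu> \<noteq> 0" using q(1) by (simp add: mu)
  have chi_u: "chi q u = (1 - i) ^ r"
    by (simp add: u_def chi_simps i_def)
  have "chi q v = inverse \<mu> * (inverse q ^ r * (1 - i) ^ r * i)"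
    by (simp add: v_def chi_simps i_def power_mult_distrib)
  then have chi_v: "chi q v = (1 - i) ^ r * i"
    using mu0 unfolding mu[symmetric] by simp
  ultimately have "(1 - i) ^ r * i + \<mu> * i * (1 - i) ^ r
      = q * ((1 - i) ^ r * i + inverse \<mu> * ((1 - i) ^ r * i))"
    by (simp add: chi_add chi_mult chi_scalar chi_free_gen chi_gen_def chi_u chi_v e0
        flip: i_def)
  then have "((1 - i) ^ r * i) * (1 + \<mu>) = ((1 - i) ^ r * i) * (q * (1 + inverse \<mu>))"
    by (simp add: algebra_simps)
  then have "1 + \<mu> = q * (1 + inverse \<mu>)"
    using c0 i0 by simp
  then have "1 + q ^ r = q * q ^ r + q * (q ^ r * q ^ r)"
    using q(1) by (simp add: mu field_simps)
  moreover have "(1 + q ^ r) * (q ^ Suc r - 1) = q * q ^ r + q * (q ^ r * q ^ r) - (1 + q ^ r)"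
    by (simp add: algebra_simps)
  ultimately have "(1 + q ^ r) * (q ^ Suc r - 1) = 0"
    by simp
  moreover have "q ^ Suc r - 1 \<noteq> 0" using q(2)[rule_format, of "Suc r"] by simp
  moreover have "1 + q ^ r \<noteq> 0"
  proof (cases "r = 0")
    case False
    show ?thesis
    proof
      assume "1 + q ^ r = 0"
      then have "q ^ r = - 1" by (simp add: eq_neg_iff_add_eq_0 add.commute)
      then have "q ^ (r * 2) = 1" by (simp add: power_mult)
      then show False using q(2)[rule_format, of "r * 2"] False by simp
    qed
  qed simp
  ultimately show False by simp
qed

end

theory Submission
  imports Defs "HOL-Library.Product_Plus"
begin

text \<open>
  The algebra acts faithfully on \<open>k[z]\<close>: \<open>x\<close> is multiplication by \<open>z\<close> and \<open>y\<close> is the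
  \<open>q\<close>-derivative, so that \<open>h z\<^sup>m = q\<^sup>m\<^sup>+\<^sup>1 z\<^sup>m\<close>. It is graded with \<open>x\<close> in degree 1 and \<open>y\<close> in
  degree -1, and its component of degree \<open>n\<close> is \<open>k[h]x\<^sup>n\<close> or \<open>k[h]y\<^sup>-\<^sup>n\<close>. A skew derivation is a pair
  \<open>(u, v)\<close> of values at \<open>x\<close> and \<open>y\<close> that is compatible with the relation, and compatibility is a
  condition in each degree separately. In one degree, subtracting inner skew derivations amounts to
  solving \<open>p(h) - \<mu>\<^sup>-\<^sup>1 p(q\<^sup>-\<^sup>1h) = f(h)\<close>, which is diagonal in the powers of \<open>h\<close>; what remains are
  exactly the values of \<open>H\<^sub>r\<close>, \<open>X\<^sub>i\<close> and \<open>Y\<^sub>j\<close>.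

  An automorphism preserves the ideal generated by \<open>yx - xy\<close>, which is generated by the normal
  element \<open>h\<close>. Hence it multiplies \<open>h\<close> by a unit, that is, by a scalar. The images of \<open>x\<close> and \<open>y\<close>
  are therefore homogeneous of degree 1 and -1, and comparing degrees in \<open>h\<close> in the image of the
  relation shows that they are scalar multiples of \<open>x\<close> and \<open>y\<close>.
\<close>

section \<open>Linear operators on polynomials\<close>

text \<open>Operators do more than model the algebra. Among all operators on k[z], the automorphism
  \<open>\<rho>_\<beta>\<close> is conjugation by z^m -> \<beta>^m z^m, so any operator W, inside
  the algebra or not, induces t -> W t - \<sigma>(t) W. Every exceptional skew derivation arises
  this way, which settles existence without extending values at x and y to the quotient by hand. In
  degree n >= 0 the inner part acts on the coefficient of h^k at x by the factor 1 - \<mu>^-1 q^-k,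
  which vanishes exactly when \<mu> = q^-k; the term left over then survives only for n = 0 and
  gives H_k. If there is no such k, the value at x can be removed, and the value at y solves a
  homogeneous equation that has nonzero solutions only for \<mu> = q. As q is not a root of unity,
  the two conditions exclude each other. Exchanging x and y while inverting q and \<mu> reverses the
  sign of the degree, so \<open>homogeneous_pair\<close> serves both signs. For n >= 0 it treats v x
  instead of v; in degree 0 one must add that v x is a multiple of yx.\<close>

typedef (overloaded) 'k lop =
  "{f :: 'k::field poly \<Rightarrow> 'k poly. (\<forall>p r. f (p + r) = f p + f r) \<and> (\<forall>c p. f (smult c p) = smult c (f p))}"
  morphisms app Abs_lop
  by (rule exI[of _ "\<lambda>p. 0"]) simp

setup_lifting type_definition_lop

lemma app_add: "app a (p + r) = app a p + app a r"
  and app_smult: "app a (smult c p) = smult c (app a p)"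
  using app[of a] by auto

lemma app_0: "app a 0 = 0"
  using app_smult[of a 0 0] by simp

lemma app_sum: "app a (sum f S) = (\<Sum>i\<in>S. app a (f i))"
  by (induction S rule: infinite_finite_induct) (auto simp: app_0 app_add)

instantiation lop :: (field) ring_1
begin

lift_definition zero_lop :: "'a lop" is "\<lambda>p. 0" by simp
lift_definition one_lop :: "'a lop" is "\<lambda>p. p" by simp
lift_definition plus_lop :: "'a lop \<Rightarrow> 'a lop \<Rightarrow> 'a lop" is "\<lambda>f g p. f p + g p"
  by (auto simp: smult_add_right)
lift_definition minus_lop :: "'a lop \<Rightarrow> 'a lop \<Rightarrow> 'a lop" is "\<lambda>f g p. f p - g p"
  by (auto simp: smult_diff_right)
lift_definition uminus_lop :: "'a lop \<Rightarrow> 'a lop" is "\<lambda>f p. - f p"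
  by auto
lift_definition times_lop :: "'a lop \<Rightarrow> 'a lop \<Rightarrow> 'a lop" is "\<lambda>f g p. f (g p)"
  by auto

instance
proof
  show "(0 :: 'a lop) \<noteq> 1"
    by transfer (auto simp: fun_eq_iff intro!: exI[of _ 1])
  show "a - b = a + - b" for a b :: "'a lop" by transfer auto
  show "(a + b) * c = a * c + b * c" for a b c :: "'a lop" by transfer auto
  show "a * (b + c) = a * b + a * c" for a b c :: "'a lop" by transfer auto
qed (transfer; auto simp: algebra_simps)+

end

lift_definition sc :: "'k::field \<Rightarrow> 'k lop" is "\<lambda>c p. smult c p"
  by (auto simp: smult_add_right mult.commute)

lemma app_arith [simp]:
  "app (a + b) p = app a p + app b p" "app (a - b) p = app a p - app b p"
  "app (- a) p = - app a p" "app 0 p = 0" "app 1 p = p" "app (a * b) p = app a (app b p)"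
  "app (sc c) p = smult c p"
  by (transfer; simp)+

lemma app_monom: "app a (monom c m) = smult c (app a (monom 1 m))"
  by (simp add: smult_monom flip: app_smult)

lemma app_expand: "app a p = (\<Sum>i\<le>degree p. smult (coeff p i) (app a (monom 1 i)))"
  by (subst (1) poly_as_sum_of_monoms[symmetric]) (simp add: app_sum app_monom[of a "coeff p _"])

lemma lop_eqI:
  assumes "\<And>m. app a (monom 1 m) = app b (monom 1 m)" shows "a = b"
proof -
  have "app a p = app b p" for p by (simp add: app_expand[of _ p] assms)
  then show ?thesis by (simp add: app_inject[symmetric] fun_eq_iff)
qed

lemma sc_simps [simp]: "sc 0 = 0" "sc 1 = 1"
  by (rule lop_eqI; simp)+

lemma sc_arith: "sc (c + d) = sc c + sc d" "sc (c * d) = sc c * sc d" "sc (- c) = - sc c"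
  "sc (c - d) = sc c - sc d"
  by (rule lop_eqI; simp add: smult_add_left smult_diff_left)+

lemma sc_comm: "a * sc c = sc c * a"
  by (rule lop_eqI) (simp add: app_smult)

lemma sc_left_comm: "a * (sc c * b) = sc c * (a * b)"
  by (metis sc_comm mult.assoc)

lemma sc_sc: "sc c * (sc d * a) = sc (c * d) * a"
  by (simp add: sc_arith mult.assoc)

lemma sc_eq_iff [simp]: "sc c = sc d \<longleftrightarrow> c = d"
proof
  assume "sc c = sc d"
  then have "app (sc c) 1 = app (sc d) 1" by simp
  then show "c = d" by (simp add: smult_1_left[symmetric] del: smult_1_left)
qed simp

text \<open>Linear extension from the monomial basis, with \<open>\<phi> m\<close> as the image of
  z^m. Summing over the support of p lets additivity be checked on a common finite superset.\<close>

lift_definition mk :: "(nat \<Rightarrow> 'k::field poly) \<Rightarrow> 'k lop"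
  is "\<lambda>\<phi> p. \<Sum>i | coeff p i \<noteq> 0. smult (coeff p i) (\<phi> i)"
proof (intro CollectI conjI allI)
  fix \<phi> :: "nat \<Rightarrow> 'k poly" and p r :: "'k poly" and c :: 'k
  have fin: "finite {i. coeff p i \<noteq> 0}" for p :: "'k poly"
    by (rule finite_subset[of _ "{..degree p}"]) (auto simp: le_degree)
  have sup: "(\<Sum>i | coeff s i \<noteq> 0. smult (coeff s i) (\<phi> i)) = (\<Sum>i\<in>S. smult (coeff s i) (\<phi> i))"
    if "finite S" "{i. coeff s i \<noteq> 0} \<subseteq> S" for s S
    using that by (intro sum.mono_neutral_left) auto
  show "(\<Sum>i | coeff (p + r) i \<noteq> 0. smult (coeff (p + r) i) (\<phi> i)) =
    (\<Sum>i | coeff p i \<noteq> 0. smult (coeff p i) (\<phi> i)) + (\<Sum>i | coeff r i \<noteq> 0. smult (coeff r i) (\<phi> i))"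
    by (subst (1 2 3) sup[of "{i. coeff p i \<noteq> 0} \<union> {i. coeff r i \<noteq> 0}"])
       (auto simp: fin smult_add_left sum.distrib)
  show "(\<Sum>i | coeff (smult c p) i \<noteq> 0. smult (coeff (smult c p) i) (\<phi> i)) =
    smult c (\<Sum>i | coeff p i \<noteq> 0. smult (coeff p i) (\<phi> i))"
    by (subst (1 2) sup[of "{i. coeff p i \<noteq> 0}"])
       (auto simp: fin poly_eq_iff coeff_sum sum_distrib_left mult.assoc)
qed

lemma app_mk_1: "app (mk \<phi>) (monom 1 m) = \<phi> m"
proof -
  have "{i. coeff (monom (1::'a) m) i \<noteq> 0} = {m}" by auto
  then show ?thesis by (simp add: mk.rep_eq)
qed

lemma app_mk [simp]: "app (mk \<phi>) (monom c m) = smult c (\<phi> m)" "app (mk \<phi>) 1 = \<phi> 0"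
  using app_mk_1[of \<phi> 0] by (simp_all add: app_monom[of _ c] app_mk_1)

section \<open>The operators x and y and the diagonal operators\<close>

definition X_op :: "'k::field lop" where "X_op = mk (\<lambda>m. monom 1 (Suc m))"

definition qnum :: "'k::field \<Rightarrow> nat \<Rightarrow> 'k" where "qnum q m = (1 - q ^ m) / (1 - q)"

text \<open>For q \<noteq> 1, \<open>qnum q m\<close> is the q-integer 1 + q + ... + q^(m-1). It
  vanishes at m = 0, which makes the truncated exponent m - 1 harmless there.\<close>

definition Y_op :: "'k::field \<Rightarrow> 'k lop" where "Y_op q = mk (\<lambda>m. monom (qnum q m) (m - 1))"

definition diag :: "(nat \<Rightarrow> 'k::field) \<Rightarrow> 'k lop" where "diag \<phi> = mk (\<lambda>m. monom (\<phi> m) m)"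

text \<open>The operator p(h), given by its eigenvalues rather than as a sum of powers, so that
  identities between polynomials in h can be tested on monomials.\<close>

definition hpoly :: "'k::field \<Rightarrow> 'k poly \<Rightarrow> 'k lop"
  where "hpoly q p = diag (\<lambda>m. poly p (q ^ Suc m))"

abbreviation h_op :: "'k::field \<Rightarrow> 'k lop" where "h_op q \<equiv> hpoly q [:0, 1:]"

lemma qnum_0 [simp]: "qnum q 0 = 0"
  by (simp add: qnum_def)

lemma app_ops [simp]:
  "app X_op (monom c m) = monom c (Suc m)"
  "app (Y_op q) (monom c m) = monom (c * qnum q m) (m - 1)"
  "app (diag \<phi>) (monom c m) = monom (c * \<phi> m) m"
  "app (hpoly q p) (monom c m) = monom (c * poly p (q ^ Suc m)) m"
  "app X_op 1 = monom 1 1" "app (Y_op q) 1 = 0"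
  "app (diag \<phi>) 1 = [:\<phi> 0:]" "app (hpoly q p) 1 = [:poly p q:]"
  by (simp_all add: X_op_def Y_op_def diag_def hpoly_def smult_monom monom_0)

lemma app_X_pow [simp]: "app (X_op ^ n) (monom c m) = monom c (m + n)"
  by (induction n arbitrary: m) (simp_all add: power_Suc2 del: power_Suc)

lemma app_Y_pow [simp]:
  "app (Y_op q ^ n) (monom c m) = monom (c * (\<Prod>i<n. qnum q (m - i))) (m - n)"
  by (induction n) (simp_all add: ac_simps)

lemma coeff_app_X: "coeff (app X_op p) k = (if k = 0 then 0 else coeff p (k - 1))"
proof -
  have e: "coeff (smult (coeff p i) (app X_op (monom 1 i))) k =
    (if i = k - 1 then if k = 0 then 0 else coeff p (k - 1) else 0)" for i
    by auto
  show ?thesis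
    unfolding app_expand[of _ p] coeff_sum e by (auto simp: not_le coeff_eq_0)
qed

lemma coeff_app_Y: "coeff (app (Y_op q) p) k = qnum q (Suc k) * coeff p (Suc k)"
proof -
  have e: "coeff (smult (coeff p i) (app (Y_op q) (monom 1 i))) k =
    (if i = Suc k then qnum q (Suc k) * coeff p (Suc k) else 0)" for i
    by (cases i) auto
  show ?thesis
    unfolding app_expand[of _ p] coeff_sum e by (auto simp: not_le coeff_eq_0)
qed

lemma coeff_app_diag: "coeff (app (diag \<phi>) p) k = \<phi> k * coeff p k"
proof -
  have e: "coeff (smult (coeff p i) (app (diag \<phi>) (monom 1 i))) k =
    (if i = k then \<phi> k * coeff p k else 0)" for i
    by auto
  show ?thesis
    unfolding app_expand[of _ p] coeff_sum e by (auto simp: not_le coeff_eq_0)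
qed

lemma coeff_app_hpoly: "coeff (app (hpoly q p) r) k = poly p (q ^ Suc k) * coeff r k"
  by (simp add: hpoly_def coeff_app_diag)

section \<open>Homogeneous components\<close>

text \<open>The n-th diagonal of the matrix of \<open>a\<close>: only the z^(m+n) term of the image
  of z^m is kept. The guard is there because \<open>nat\<close> would turn a negative exponent into
  0.\<close>

definition proj :: "int \<Rightarrow> 'k::field lop \<Rightarrow> 'k lop"
  where "proj n a = mk (\<lambda>m. if int m + n \<ge> 0
    then monom (coeff (app a (monom 1 m)) (nat (int m + n))) (nat (int m + n)) else 0)"

lemma proj_add: "proj n (a + b) = proj n a + proj n b"
  and proj_diff: "proj n (a - b) = proj n a - proj n b"
  and proj_0 [simp]: "proj n 0 = 0"
  by (rule lop_eqI; simp add: proj_def add_monom diff_monom)+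

lemma proj_sc: "proj n (sc c * a) = sc c * proj n a"
  by (rule lop_eqI) (simp add: proj_def smult_monom)

lemma proj_sum: "proj n (sum f S) = (\<Sum>i\<in>S. proj n (f i))"
  by (induction S rule: infinite_finite_induct) (auto simp: proj_add)

lemma proj_X_left: "proj n (X_op * a) = X_op * proj (n - 1) a"
proof (rule lop_eqI)
  fix m
  consider "int m + n \<ge> 1" | "int m + n = 0" | "int m + n < 0" by linarith
  then show "app (proj n (X_op * a)) (monom 1 m) = app (X_op * proj (n - 1) a) (monom 1 m)"
  proof cases
    case 1
    then have "nat (int m + n) = Suc (nat (int m + (n - 1)))" by linarith
    then show ?thesis using 1 by (simp add: proj_def coeff_app_X)
  qed (auto simp: proj_def app_0 coeff_app_X)
qed

lemma proj_Y_left: "proj n (Y_op q * a) = Y_op q * proj (n + 1) a"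
proof (rule lop_eqI)
  fix m
  consider "int m + n \<ge> 0" | "int m + n = -1" | "int m + n < -1" by linarith
  then show "app (proj n (Y_op q * a)) (monom 1 m) = app (Y_op q * proj (n + 1) a) (monom 1 m)"
  proof cases
    case 1
    then have "nat (int m + (n + 1)) = Suc (nat (int m + n))" by linarith
    then show ?thesis using 1 by (simp add: proj_def coeff_app_Y mult.commute)
  qed (auto simp: proj_def app_0)
qed

lemma proj_hpoly_left: "proj n (hpoly q p * a) = hpoly q p * proj n a"
  by (rule lop_eqI) (auto simp: proj_def coeff_app_hpoly app_0 mult.commute)

lemma proj_X_right: "proj n (a * X_op) = proj (n - 1) a * X_op"
  by (rule lop_eqI) (auto simp: proj_def algebra_simps)

lemma proj_Y_right: "proj n (a * Y_op q) = proj (n + 1) a * Y_op q"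
proof (rule lop_eqI)
  fix m
  show "app (proj n (a * Y_op q)) (monom 1 m) = app (proj (n + 1) a * Y_op q) (monom 1 m)"
    by (cases m) (auto simp: proj_def app_monom[of a "qnum q _"] app_0 smult_monom algebra_simps)
qed

text \<open>Each matrix entry lies on exactly one diagonal. This is true of arbitrary operators;
  membership in the algebra matters only for finding a finite S.\<close>

lemma sum_proj:
  assumes "finite S" "\<And>n. n \<notin> S \<Longrightarrow> proj n a = 0"
  shows "(\<Sum>n\<in>S. proj n a) = a"
proof (rule lop_eqI, rule poly_eqI)
  fix m k
  have z: "coeff (app (proj n a) (monom 1 m)) k =
    (if n = int k - int m then coeff (app a (monom 1 m)) k else 0)" for n
    by (auto simp: proj_def)
  have s: "app (sum f S) p = (\<Sum>n\<in>S. app (f n) p)" for p and f :: "int \<Rightarrow> 'a lop"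
    by (induction S rule: infinite_finite_induct) auto
  show "coeff (app (\<Sum>n\<in>S. proj n a) (monom 1 m)) k = coeff (app a (monom 1 m)) k"
  proof (cases "int k - int m \<in> S")
    case True
    then show ?thesis using assms(1) unfolding s coeff_sum z by simp
  next
    case False
    have "coeff (app a (monom 1 m)) k = 0"
      using z[of "int k - int m"] assms(2)[OF False] by simp
    then show ?thesis using assms(1) False unfolding s coeff_sum z by simp
  qed
qed

section \<open>The quantum Weyl algebra as an algebra of operators\<close>

lemma app_const [simp]: "app a [:c:] = smult c (app a 1)"
  using app_monom[of a c 0] by (simp add: monom_0 flip: one_pCons)

declare app_0 [simp]

text \<open>The rescaling h -> s h, which is what moving p(h) past x or y amounts to
  (\<open>X_hpoly\<close>, \<open>Y_hpoly\<close>).\<close>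

definition sub :: "'k::field \<Rightarrow> 'k poly \<Rightarrow> 'k poly" where "sub s p = pcompose p [:0, s:]"

lemma poly_sub [simp]: "poly (sub s p) z = poly p (s * z)"
  by (simp add: sub_def poly_pcompose mult.commute)

lemma coeff_sub [simp]: "coeff (sub s p) k = s ^ k * coeff p k"
  by (simp add: sub_def coeff_pcompose_linear)

lemma hpoly_simps [simp]: "hpoly q 0 = 0" "hpoly q 1 = 1" "hpoly q [:c:] = sc c"
  by (rule lop_eqI; simp add: smult_monom)+

lemma hpoly_arith:
  "hpoly q (p + r) = hpoly q p + hpoly q r" "hpoly q (p - r) = hpoly q p - hpoly q r"
  "hpoly q (- p) = - hpoly q p" "hpoly q (smult c p) = sc c * hpoly q p"
  "hpoly q (p * r) = hpoly q p * hpoly q r"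
  by (rule lop_eqI; simp add: algebra_simps add_monom diff_monom minus_monom smult_monom)+

lemma hpoly_pow: "hpoly q (p ^ n) = hpoly q p ^ n"
  by (induction n) (auto simp: hpoly_arith)

definition G :: "'k::field \<Rightarrow> int \<Rightarrow> 'k lop"
  where "G q n = (if n \<ge> 0 then X_op ^ nat n else Y_op q ^ nat (- n))"

lemma G_0 [simp]: "G q 0 = 1" by (simp add: G_def)

lemma G_nat [simp]: "G q (int n) = X_op ^ n" "G q (- int n) = Y_op q ^ n"
  by (auto simp: G_def)

text \<open>The image of the algebra among the operators, identified with the quotient by
  \<open>cls_eq_iff\<close>. Outside it lie operators such as the inverse of h, which are used
  later.\<close>

inductive_set QW :: "'k::field \<Rightarrow> 'k lop set" for q where
  QW_sc: "sc c \<in> QW q"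
| QW_X: "X_op \<in> QW q"
| QW_Y: "Y_op q \<in> QW q"
| QW_add: "a \<in> QW q \<Longrightarrow> b \<in> QW q \<Longrightarrow> a + b \<in> QW q"
| QW_mult: "a \<in> QW q \<Longrightarrow> b \<in> QW q \<Longrightarrow> a * b \<in> QW q"

lemma QW_0: "0 \<in> QW q" and QW_1: "1 \<in> QW q"
  using QW_sc[of 0 q] QW_sc[of 1 q] by auto

lemma QW_uminus: "a \<in> QW q \<Longrightarrow> - a \<in> QW q"
  using QW_mult[OF QW_sc[of "- 1" q], of a] by (simp add: sc_arith)

lemma QW_diff: "a \<in> QW q \<Longrightarrow> b \<in> QW q \<Longrightarrow> a - b \<in> QW q"
  using QW_add[of a q "- b"] QW_uminus[of b q] by simp

lemma QW_sum: "(\<And>i. i \<in> S \<Longrightarrow> f i \<in> QW q) \<Longrightarrow> sum f S \<in> QW q"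
  by (induction S rule: infinite_finite_induct) (auto intro: QW_0 QW_add)

lemma QW_pow: "a \<in> QW q \<Longrightarrow> a ^ n \<in> QW q"
  by (induction n) (auto intro: QW_1 QW_mult)

lemma QW_G: "G q n \<in> QW q"
  by (simp add: G_def QW_pow QW_X QW_Y)

lemmas QW_closed = QW_sc QW_X QW_Y QW_add QW_mult QW_0 QW_1 QW_uminus QW_diff QW_sum QW_pow QW_G

text \<open>The common shape of yx and xy as polynomials in h: a = 1/(1 - q), with s = 1 for yx and
  s = 1/q for xy. Rescaling h only changes s.\<close>

definition kap :: "'k::field \<Rightarrow> 'k \<Rightarrow> 'k poly" where "kap a s = smult a [:1, - s:]"

lemma sub_kap [simp]: "sub s (kap a t) = kap a (s * t)"
  by (auto simp: poly_eq_iff kap_def coeff_pCons split: nat.split)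

lemma sub_arith: "sub s (p + r) = sub s p + sub s r" "sub s (p - r) = sub s p - sub s r"
  "sub s (p * r) = sub s p * sub s r" "sub s (smult c p) = smult c (sub s p)" "sub s (- p) = - sub s p"
  "sub s 0 = 0"
  by (simp_all add: sub_def pcompose_add pcompose_diff pcompose_mult pcompose_smult pcompose_uminus)

lemma sub_sub [simp]: "sub s (sub t p) = sub (s * t) p"
  by (auto simp: poly_eq_iff power_mult_distrib)

lemma sub_1 [simp]: "sub 1 p = p"
  by (auto simp: poly_eq_iff)

section \<open>Relations between x, y and h, and the graded components\<close>

locale qparam =
  fixes q :: "'k::field"
  assumes q0: "q \<noteq> 0" and q_root: "\<And>n::nat. n > 0 \<Longrightarrow> q ^ n \<noteq> 1"
begin

lemma q1: "q \<noteq> 1" using q_root[of 1] by auto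

lemma q1': "1 - q \<noteq> 0" using q1 by simp

lemma q_pow_le: "q ^ m = q ^ n \<Longrightarrow> m \<le> n \<Longrightarrow> m = n"
proof -
  assume e: "q ^ m = q ^ n" and l: "m \<le> n"
  then have "q ^ m * q ^ (n - m) = q ^ m * 1"
    by (metis power_add le_add_diff_inverse mult_1_right)
  then have "q ^ (n - m) = 1" using q0 by simp
  then show "m = n" using q_root[of "n - m"] l by (cases "m = n") auto
qed

lemma q_pow_inj: "q ^ m = q ^ n \<longleftrightarrow> m = n"
  using q_pow_le[of m n] q_pow_le[of n m] by (metis nle_le)

lemma qnum_nz: "qnum q m \<noteq> 0 \<longleftrightarrow> m > 0"
  using q_root[of m] q1 by (cases m) (auto simp: qnum_def)

text \<open>The points q^(m+n) are infinitely many, since q is not a root of unity.\<close>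

lemma poly_q_eq_0:
  assumes "\<And>m. poly p (q ^ (m + n)) = 0" shows "p = 0"
proof (rule ccontr)
  assume "p \<noteq> 0"
  then have "finite {z. poly p z = 0}" by (rule poly_roots_finite)
  moreover have "range (\<lambda>m. q ^ (m + n)) \<subseteq> {z. poly p z = 0}" using assms by auto
  ultimately have "finite (range (\<lambda>m. q ^ (m + n)))" by (rule rev_finite_subset)
  moreover have "inj (\<lambda>m. q ^ (m + n))" by (auto simp: inj_def q_pow_inj)
  ultimately show False using range_inj_infinite by blast
qed

text \<open>Each graded component is free of rank one over k[h]: monomials give the values of p at
  infinitely many powers of q. For negative n the test monomials start at z^(-n), which the power of
  y does not annihilate.\<close>

lemma hpoly_G_eq_0: "hpoly q p * G q n = 0 \<longleftrightarrow> p = 0"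
proof
  assume e: "hpoly q p * G q n = 0"
  show "p = 0"
  proof (cases "n \<ge> 0")
    case True
    have "poly p (q ^ (m + Suc (nat n))) = 0" for m
      using arg_cong[OF e, of "\<lambda>a. app a (monom 1 m)"] True by (simp add: G_def)
    then show ?thesis by (rule poly_q_eq_0)
  next
    case False
    have "poly p (q ^ (m + 1)) = 0" for m
    proof -
      have "(\<Prod>i<nat (- n). qnum q (m + nat (- n) - i)) \<noteq> 0"
        by (auto simp: qnum_nz)
      then show ?thesis
        using arg_cong[OF e, of "\<lambda>a. app a (monom 1 (m + nat (- n)))"] False by (simp add: G_def)
    qed
    then show ?thesis by (rule poly_q_eq_0)
  qed
qed simp

lemma hpoly_G_inj: "hpoly q p * G q n = hpoly q r * G q n \<longleftrightarrow> p = r"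
  using hpoly_G_eq_0[of "p - r" n] by (simp add: hpoly_arith algebra_simps)

lemma X_hpoly: "X_op * hpoly q p = hpoly q (sub (inverse q) p) * X_op"
  by (rule lop_eqI) (simp add: q0 field_simps)

lemma Y_hpoly: "Y_op q * hpoly q p = hpoly q (sub q p) * Y_op q"
proof (rule lop_eqI)
  fix m show "app (Y_op q * hpoly q p) (monom 1 m) = app (hpoly q (sub q p) * Y_op q) (monom 1 m)"
    by (cases m) (simp_all add: mult_ac)
qed

abbreviation "k1 \<equiv> kap (inverse (1 - q))"

lemma Y_X: "Y_op q * X_op = hpoly q (k1 1)"
  by (rule lop_eqI) (simp add: qnum_def kap_def divide_inverse algebra_simps)

lemma X_Y: "X_op * Y_op q = hpoly q (k1 (inverse q))"
proof (rule lop_eqI)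
  fix m show "app (X_op * Y_op q) (monom 1 m) = app (hpoly q (k1 (inverse q))) (monom 1 m)"
    by (cases m) (simp_all add: qnum_def kap_def divide_inverse algebra_simps q0)
qed

lemma YX_rel: "Y_op q * X_op = sc q * X_op * Y_op q + 1"
proof -
  have "k1 1 = smult q (k1 (inverse q)) + 1"
    using q0 q1' by (auto simp: kap_def field_simps one_pCons)
  then show ?thesis by (simp add: Y_X X_Y mult.assoc hpoly_arith)
qed

lemma h_eq: "h_op q = 1 - sc (1 - q) * (Y_op q * X_op)"
proof -
  have "[:0, 1:] = 1 - smult (1 - q) (k1 1)"
    using q1' by (auto simp: kap_def field_simps one_pCons)
  then show ?thesis unfolding Y_X by (metis hpoly_arith(2,4) hpoly_simps(2))
qed

lemma QW_h: "h_op q \<in> QW q"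
  unfolding h_eq by (intro QW_closed)

lemma QW_hpoly: "hpoly q p \<in> QW q"
proof (induction p)
  case 0
  show ?case by (simp add: QW_0)
next
  case (pCons a p)
  have "pCons a p = [:a:] + [:0, 1:] * p" by simp
  then have "hpoly q (pCons a p) = sc a + h_op q * hpoly q p" by (metis hpoly_arith(1,5) hpoly_simps(3))
  then show ?case by (simp add: QW_closed QW_h pCons.IH)
qed

lemma X_pow_hpoly: "X_op ^ n * hpoly q p = hpoly q (sub (inverse q ^ n) p) * X_op ^ n"
proof (induction n)
  case (Suc n)
  have "X_op ^ Suc n * hpoly q p = X_op * (X_op ^ n * hpoly q p)" by (simp add: mult.assoc)
  also have "\<dots> = (X_op * hpoly q (sub (inverse q ^ n) p)) * X_op ^ n" by (simp add: Suc mult.assoc)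
  finally show ?case by (simp add: X_hpoly mult.assoc)
qed simp

lemma Y_pow_hpoly: "Y_op q ^ n * hpoly q p = hpoly q (sub (q ^ n) p) * Y_op q ^ n"
proof (induction n)
  case (Suc n)
  have "Y_op q ^ Suc n * hpoly q p = Y_op q * (Y_op q ^ n * hpoly q p)" by (simp add: mult.assoc)
  also have "\<dots> = (Y_op q * hpoly q (sub (q ^ n) p)) * Y_op q ^ n" by (simp add: Suc mult.assoc)
  finally show ?case by (simp add: Y_hpoly mult.assoc)
qed simp

text \<open>For n < 0 the factor x meets a power of y; one y is absorbed by xy, which lies in
  k[h].\<close>

lemma X_G: "\<exists>r. X_op * (hpoly q p * G q n) = hpoly q r * G q (n + 1)"
proof (cases "n \<ge> 0")
  case True
  then have "nat (n + 1) = Suc (nat n)" by linarith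
  then show ?thesis using True
    by (auto simp: G_def X_hpoly mult.assoc simp flip: mult.assoc[of X_op])
next
  case False
  then have "nat (- n) = Suc (nat (- (n + 1)))" by linarith
  then have "G q n = Y_op q * G q (n + 1)" using False by (auto simp: G_def)
  then have "X_op * (hpoly q p * G q n) = (X_op * hpoly q p) * Y_op q * G q (n + 1)"
    by (simp add: mult.assoc)
  also have "\<dots> = hpoly q (sub (inverse q) p) * (X_op * Y_op q) * G q (n + 1)"
    by (simp add: X_hpoly mult.assoc)
  finally show ?thesis by (auto simp: X_Y simp flip: hpoly_arith(5))
qed

lemma Y_G: "\<exists>r. Y_op q * (hpoly q p * G q n) = hpoly q r * G q (n - 1)"
proof (cases "n \<ge> 1")
  case False
  then have "nat (- (n - 1)) = Suc (nat (- n))" by linarith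
  then have "G q (n - 1) = Y_op q * G q n" using False by (auto simp: G_def)
  then show ?thesis
    by (auto simp: Y_hpoly mult.assoc simp flip: mult.assoc[of "Y_op q"])
next
  case True
  then have "nat n = Suc (nat (n - 1))" by linarith
  then have "G q n = X_op * G q (n - 1)" using True by (auto simp: G_def)
  then have "Y_op q * (hpoly q p * G q n) = (Y_op q * hpoly q p) * X_op * G q (n - 1)"
    by (simp add: mult.assoc)
  also have "\<dots> = hpoly q (sub q p) * (Y_op q * X_op) * G q (n - 1)"
    by (simp add: Y_hpoly mult.assoc)
  finally show ?thesis by (auto simp: Y_X simp flip: hpoly_arith(5))
qed

lemma proj_1: "proj n (1 :: 'k lop) = (if n = 0 then 1 else 0)"
proof (rule lop_eqI)
  fix m show "app (proj n 1) (monom 1 m) = app (if n = 0 then 1 else 0) (monom 1 m :: 'k poly)"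
    by (auto simp: proj_def nat_eq_iff)
qed

lemma proj_X_pow: "proj n (X_op ^ k :: 'k lop) = (if n = int k then X_op ^ k else 0)"
  by (induction k arbitrary: n) (auto simp: proj_1 proj_X_left)

lemma proj_Y_pow: "proj n (Y_op q ^ k) = (if n = - int k then Y_op q ^ k else 0)"
  by (induction k arbitrary: n) (auto simp: proj_1 proj_Y_left)

lemma proj_G: "proj n (G q k) = (if n = k then G q k else 0)"
  by (auto simp: G_def proj_X_pow proj_Y_pow)

lemma proj_hpoly_G: "proj n (hpoly q p * G q k) = (if n = k then hpoly q p * G q k else 0)"
  by (simp add: proj_hpoly_left proj_G)

definition homogeneous_finite :: "'k lop \<Rightarrow> bool" where
  "homogeneous_finite a \<longleftrightarrow> (\<forall>n. \<exists>p. proj n a = hpoly q p * G q n) \<and> (\<exists>N. \<forall>n. \<bar>n\<bar> > N \<longrightarrow> proj n a = 0)"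

lemma homogeneous_finite_1: "homogeneous_finite 1"
  unfolding homogeneous_finite_def proj_1
  by (auto intro: exI[of _ 0] exI[of _ 1])

text \<open>The right factor \<open>b\<close> carries the induction: a product in \<open>a\<close>
  is absorbed one generator at a time, so two graded sums never have to be multiplied out.\<close>

lemma homogeneous_finite_mult: "a \<in> QW q \<Longrightarrow> homogeneous_finite b \<Longrightarrow> homogeneous_finite (a * b)"
proof (induction a arbitrary: b rule: QW.induct)
  case (QW_sc c)
  have "\<exists>p. sc c * (hpoly q r * s) = hpoly q p * s" for r s
    by (rule exI[of _ "smult c r"]) (simp add: hpoly_arith mult.assoc)
  then show ?case using QW_sc unfolding homogeneous_finite_def proj_sc by (metis mult_zero_right)
next
  case QW_X
  obtain N where N: "\<And>n. \<bar>n\<bar> > N \<Longrightarrow> proj n b = 0" using QW_X by (auto simp: homogeneous_finite_def)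
  have "\<exists>p. proj n (X_op * b) = hpoly q p * G q n" for n
    using QW_X X_G[of _ "n - 1"] unfolding homogeneous_finite_def proj_X_left by (metis diff_add_cancel)
  moreover have "proj n (X_op * b) = 0" if "\<bar>n\<bar> > N + 1" for n
    using that N[of "n - 1"] by (simp add: proj_X_left)
  ultimately show ?case by (auto simp: homogeneous_finite_def)
next
  case QW_Y
  obtain N where N: "\<And>n. \<bar>n\<bar> > N \<Longrightarrow> proj n b = 0" using QW_Y by (auto simp: homogeneous_finite_def)
  have "\<exists>p. proj n (Y_op q * b) = hpoly q p * G q n" for n
    using QW_Y Y_G[of _ "n + 1"] unfolding homogeneous_finite_def proj_Y_left by (metis add_diff_cancel_right')
  moreover have "proj n (Y_op q * b) = 0" if "\<bar>n\<bar> > N + 1" for n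
    using that N[of "n + 1"] by (simp add: proj_Y_left)
  ultimately show ?case by (auto simp: homogeneous_finite_def)
next
  case (QW_add a a')
  from QW_add.IH[OF QW_add.prems] show ?case
    unfolding homogeneous_finite_def distrib_right proj_add
  proof (safe, goal_cases)
    case (1 N N' n)
    then show ?case by (metis hpoly_arith(1) distrib_right)
  next
    case (2 N N')
    then show ?case by (intro exI[of _ "max N N'"]) auto
  qed
next
  case (QW_mult a a')
  then show ?case by (simp add: mult.assoc)
qed

lemma QW_homogeneous_finite: "a \<in> QW q \<Longrightarrow> homogeneous_finite a"
  using homogeneous_finite_mult[OF _ homogeneous_finite_1] by simp

lemma proj_QW: "a \<in> QW q \<Longrightarrow> \<exists>p. proj n a = hpoly q p * G q n"
  using QW_homogeneous_finite by (auto simp: homogeneous_finite_def)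

lemma proj_QW_bound: "a \<in> QW q \<Longrightarrow> \<exists>N. \<forall>n. \<bar>n\<bar> > N \<longrightarrow> proj n a = 0"
  using QW_homogeneous_finite by (auto simp: homogeneous_finite_def)

lemma hpoly_G_QW: "hpoly q p * G q n \<in> QW q"
  by (intro QW_closed QW_hpoly)

end

section \<open>The difference equation behind the classification\<close>

text \<open>The operator p -> p - \<nu> p(s h) multiplies the k-th coefficient by 1 - \<nu> s^k. One
  divides wherever this is nonzero; at the resonant k the coefficient of p is taken to be 0 and that
  of f remains.\<close>

lemma q_difference_solve:
  fixes f :: "'k::field poly"
  shows "\<exists>p. \<forall>k. coeff (f - (p - smult \<nu> (sub s p))) k = (if \<nu> * s ^ k = 1 then coeff f k else 0)"
proof -
  define p where "p = (\<Sum>k\<le>degree f. monom (if \<nu> * s ^ k = 1 then 0 else coeff f k / (1 - \<nu> * s ^ k)) k)"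
  have c: "coeff p k = (if \<nu> * s ^ k = 1 then 0 else coeff f k / (1 - \<nu> * s ^ k))" for k
    by (auto simp: p_def coeff_sum not_le coeff_eq_0)
  have A: "(1 - \<nu> * s ^ k) * coeff p k = (if \<nu> * s ^ k = 1 then 0 else coeff f k)" for k
    by (simp add: c)
  have B: "coeff (f - (p - smult \<nu> (sub s p))) k = coeff f k - (1 - \<nu> * s ^ k) * coeff p k" for k
    by (simp add: left_diff_distrib)
  have "coeff (f - (p - smult \<nu> (sub s p))) k = (if \<nu> * s ^ k = 1 then coeff f k else 0)" for k
    unfolding B A by simp
  then show ?thesis by blast
qed

lemma q_difference_kernel:
  fixes p :: "'k::field poly"
  assumes "p = smult \<nu> (sub s p)" "\<nu> * s ^ k \<noteq> 1" shows "coeff p k = 0"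
proof -
  have "coeff p k = \<nu> * s ^ k * coeff p k" using assms(1) by (metis coeff_smult coeff_sub mult.assoc)
  then have "(1 - \<nu> * s ^ k) * coeff p k = 0" by (simp add: algebra_simps)
  then show ?thesis using assms(2) by simp
qed

lemma coeff_mult_kap:
  "coeff (p * kap a s) k = a * (coeff p k - s * (if k = 0 then 0 else coeff p (k - 1)))"
proof -
  have "p * kap a s = smult a (p - smult s (pCons 0 p))"
    by (simp add: kap_def smult_diff_right)
  then show ?thesis by (auto simp: coeff_pCons split: nat.split)
qed

context qparam
begin

text \<open>For a = 1/(1 - q), t = 1 and w = p(h) x^n, \<open>F p\<close> and \<open>H p\<close> are
  the coefficients of the inner value at x and of the inner value at y times x. \<open>E\<close> is
  compatibility for u = f(h) x^(n+1) and v x = g(h) x^n. The parameters a and t are kept free so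
  that the mirror image, with q inverted, is an instance too.\<close>

lemma homogeneous_pair:
  fixes f g :: "'k poly" and \<mu> a t :: 'k and n :: nat
  defines "F \<equiv> \<lambda>p. p - smult (inverse \<mu>) (sub (inverse q) p)"
    and "H \<equiv> \<lambda>p. p * kap a (t * inverse q ^ n) - smult \<mu> (sub q p * kap a t)"
  assumes mu: "\<mu> \<noteq> 0" and a: "a \<noteq> 0" and t: "t \<noteq> 0"
    and E: "g - smult (q / \<mu>) (sub (inverse q) g) =
      smult q (f * kap a (t * inverse q ^ Suc n)) - smult \<mu> (sub q f * kap a t)"
  shows "\<exists>p c d. f = F p + c \<and> g = H p + d \<and>
    (c = 0 \<and> d = 0 \<or> \<mu> = q \<and> c = 0 \<and> (\<exists>e. d = [:e:]) \<or>
      (\<exists>r \<gamma> e. \<mu> * q ^ r = 1 \<and> n = 0 \<and> c = monom \<gamma> r \<and> d = monom (- \<gamma> * a) r + monom e (Suc r)))"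
proof -
  obtain p where p: "\<And>k. coeff (f - F p) k = (if inverse \<mu> * inverse q ^ k = 1 then coeff f k else 0)"
    using q_difference_solve[of f "inverse \<mu>" "inverse q"] unfolding F_def by blast
  define c where "c = f - F p"
  define d where "d = g - H p"
  \<comment> \<open>The difference of \<open>kap a s\<close> and q times
    \<open>kap a (s / q)\<close> is the constant a (1 - q), whatever s is; here s is t q^-n and t.
    This is the trace of the relation yx - qxy = 1.\<close>
  have K: "kap a (t * inverse q ^ n) + smult q (kap a (t * inverse q)) =
      smult q (kap a (t * inverse q ^ Suc n)) + kap a t"
    using q0 by (auto simp: kap_def field_simps)
  have pK: "p * kap a (t * inverse q ^ n) + smult q (p * kap a (t * inverse q)) =
      smult q (p * kap a (t * inverse q ^ Suc n)) + p * kap a t"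
    using arg_cong[OF K, of "\<lambda>x. p * x"] by (simp add: distrib_left)
  have sH: "sub (inverse q) (H p) = sub (inverse q) p * kap a (t * inverse q ^ Suc n) - smult \<mu> (p * kap a (t * inverse q))"
    using q0 by (simp add: H_def sub_arith mult_ac)
  have sF: "sub q (F p) = sub q p - smult (inverse \<mu>) p"
    using q0 by (simp add: F_def sub_arith)
  \<comment> \<open>Pairs (F p, H p) come from inner skew derivations and satisfy \<open>E\<close>;
    by subtraction the remainder (c, d) satisfies it as well.\<close>
  have E0: "H p - smult (q / \<mu>) (sub (inverse q) (H p)) =
      smult q (F p * kap a (t * inverse q ^ Suc n)) - smult \<mu> (sub q (F p) * kap a t)"
    using pK mu unfolding sH sF unfolding H_def F_def
    by (simp add: left_diff_distrib smult_diff_right, simp add: algebra_simps divide_inverse)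
  have cd: "d - smult (q / \<mu>) (sub (inverse q) d) =
      smult q (c * kap a (t * inverse q ^ Suc n)) - smult \<mu> (sub q c * kap a t)"
    using arg_cong2[OF E E0, of "(-)"]
    by (simp add: c_def d_def sub_arith smult_diff_right left_diff_distrib, simp add: algebra_simps)
  have inv: "inverse \<mu> * inverse q ^ k = 1 \<longleftrightarrow> \<mu> * q ^ k = 1" for k
    using mu q0 by (simp add: field_simps)
  have c_coeff: "coeff c k = 0" if "\<mu> * q ^ k \<noteq> 1" for k
    using p[of k] that unfolding inv by (simp add: c_def)
  show ?thesis
  proof (cases "\<exists>r. \<mu> * q ^ r = 1")
    case False
    then have "c = 0" using c_coeff by (auto simp: poly_eq_iff)
    then have "d = smult (q / \<mu>) (sub (inverse q) d)" using cd by (simp add: sub_arith)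
    then have d0: "coeff d k = 0" if "q / \<mu> * inverse q ^ k \<noteq> 1" for k
      using q_difference_kernel that by blast
    have "coeff d k = 0" if "k > 0" for k
    proof (rule d0)
      obtain j where k: "k = Suc j" using \<open>k > 0\<close> by (cases k) auto
      \<comment> \<open>With k = j + 1, equality would say \<mu> q^j = 1, a resonance excluded in
        this case.\<close>
      show "q / \<mu> * inverse q ^ k \<noteq> 1"
        using False q0 mu by (auto simp: k field_simps)
    qed
    then have d: "d = [:coeff d 0:]" by (auto simp: poly_eq_iff coeff_pCons split: nat.split)
    have "d = 0" if "\<mu> \<noteq> q" using d0[of 0] d that by (metis divide_eq_1_iff mult.right_neutral pCons_0_0 power_0)
    then have "c = 0 \<and> d = 0 \<or> \<mu> = q \<and> c = 0 \<and> (\<exists>e. d = [:e:])"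
      using d \<open>c = 0\<close> by metis
    moreover have "f = F p + c" "g = H p + d" by (simp_all add: c_def d_def)
    ultimately show ?thesis by blast
  next
    case True
    then obtain r where r: "\<mu> * q ^ r = 1" by blast
    have mu_r: "inverse \<mu> = q ^ r" using r mu by (simp add: field_simps)
    have r_unique: "k = r" if "\<mu> * q ^ k = 1" for k
    proof -
      have "\<mu> * q ^ k = \<mu> * q ^ r" using r that by simp
      then show ?thesis using mu q_pow_inj by simp
    qed
    define \<gamma> where "\<gamma> = coeff c r"
    have c: "c = monom \<gamma> r" using c_coeff r_unique by (auto simp: poly_eq_iff \<gamma>_def)
    \<comment> \<open>Coefficient k of the equation for (c, d), with \<mu>^-1 = q^r inserted. The
      left factor vanishes exactly at k = r + 1, so that coefficient of d is free and the equation
      there constrains c instead.\<close>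
    have dk: "(1 - q ^ Suc r * inverse q ^ k) * coeff d k =
        a * ((q - \<mu> * q ^ k) * coeff c k - t * (if k = 0 then 0 else (inverse q ^ n - \<mu> * q ^ (k - 1)) * coeff c (k - 1)))" for k
    proof -
      have qq: "q * (t * inverse q ^ Suc n) = t * inverse q ^ n" using q0 by simp
      have "(1 - q ^ Suc r * inverse q ^ k) * coeff d k = coeff (d - smult (q / \<mu>) (sub (inverse q) d)) k"
        by (simp add: divide_inverse mu_r algebra_simps)
      also have "\<dots> = q * (a * (coeff c k - t * inverse q ^ Suc n * (if k = 0 then 0 else coeff c (k - 1))))
         - \<mu> * (a * (q ^ k * coeff c k - t * (if k = 0 then 0 else q ^ (k - 1) * coeff c (k - 1))))"
        unfolding cd by (simp add: coeff_mult_kap)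
      also have "\<dots> = a * ((q - \<mu> * q ^ k) * coeff c k - (if k = 0 then 0 else
          (q * (t * inverse q ^ Suc n) - t * \<mu> * q ^ (k - 1)) * coeff c (k - 1)))"
        by (simp add: algebra_simps)
      finally show ?thesis unfolding qq by (cases k) (simp_all add: algebra_simps)
    qed
    have qk: "q ^ k * inverse q ^ k = 1" for k
      using q0 by (simp flip: power_mult_distrib)
    \<comment> \<open>At k = r + 1 what is left is (q^-n - 1) \<gamma> = 0: an obstruction in c
      survives only in degree 0.\<close>
    have n0: "\<gamma> = 0" if "n > 0"
    proof -
      have "a * (t * ((inverse q ^ n - 1) * \<gamma>)) = 0"
        using dk[of "Suc r"] r unfolding qk[of "Suc r"] by (simp add: c)
      moreover have "inverse q ^ n - 1 \<noteq> 0"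
        using q_root[OF that] by (simp add: power_inverse)
      ultimately show ?thesis using a t by simp
    qed
    have dr: "coeff d r = - \<gamma> * a"
    proof -
      have "(1 - q) * coeff d r = a * ((q - 1) * \<gamma>)"
        using dk[of r] r unfolding power_Suc[of q r] mult.assoc[of q] qk[of r]
        by (cases r) (auto simp: c)
      then have "(1 - q) * coeff d r = (1 - q) * (- \<gamma> * a)" by (simp add: algebra_simps)
      then show ?thesis by (rule mult_left_cancel[THEN iffD1, OF q1'])
    qed
    have dz: "coeff d k = 0" if "k \<noteq> r" "k \<noteq> Suc r" for k
    proof -
      have "(1 - q ^ Suc r * inverse q ^ k) * coeff d k = 0"
        using dk[of k] that by (auto simp: c)
      moreover have "1 - q ^ Suc r * inverse q ^ k \<noteq> 0"
        using q_pow_inj[of "Suc r" k] that q0 by (auto simp: field_simps)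
      ultimately show ?thesis by simp
    qed
    define e where "e = coeff d (Suc r)"
    have d: "d = monom (- \<gamma> * a) r + monom e (Suc r)"
      using dr dz by (auto simp: poly_eq_iff e_def)
    have fg: "f = F p + c" "g = H p + d" by (simp_all add: c_def d_def)
    show ?thesis
    proof (cases "n = 0")
      case True
      then show ?thesis using fg c d r by blast
    next
      case False
      have nz: "a * t * (1 - inverse q ^ n) \<noteq> 0"
        using a t q_root[of n] False by (simp add: power_inverse)
      \<comment> \<open>For n > 0 the free coefficient e is inner: h^r lies in the kernel of F, and
        H maps l h^r to a t (1 - q^-n) l h^(r+1).\<close>
      define l where "l = e / (a * t * (1 - inverse q ^ n))"
      have F0: "F (p + monom l r) = F p"
      proof -
        have "q ^ r * (inverse (q ^ r) * x) = x" for x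
          using q0 by simp
        then show ?thesis
          using mu_r by (auto simp: F_def sub_arith poly_eq_iff power_inverse distrib_left)
      qed
      have "H (p + monom l r) = H p + monom e (Suc r)"
      proof -
        have "H (monom l r) = monom e (Suc r)"
        proof (rule poly_eqI)
          fix k
          have "coeff (H P) k = a * ((1 - \<mu> * q ^ k) * coeff P k -
            t * (if k = 0 then 0 else (inverse q ^ n - \<mu> * q ^ (k - 1)) * coeff P (k - 1)))" for P
            by (cases k) (simp_all only: H_def coeff_mult_kap coeff_diff coeff_smult coeff_sub,
              simp_all add: algebra_simps)
          then have "coeff (H (monom l r)) k = a * ((1 - \<mu> * q ^ k) * coeff (monom l r) k -
            t * (if k = 0 then 0 else (inverse q ^ n - \<mu> * q ^ (k - 1)) * coeff (monom l r) (k - 1)))" .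
          also have "\<dots> = (if k = Suc r then a * (t * (1 - inverse q ^ n)) * l else 0)"
            using r by (cases k) (auto simp: algebra_simps)
          finally show "coeff (H (monom l r)) k = coeff (monom e (Suc r)) k"
            using nz by (auto simp: l_def)
        qed
        moreover have "H (p + monom l r) = H p + H (monom l r)"
          by (simp add: H_def sub_arith distrib_right smult_add_right)
        ultimately show ?thesis by simp
      qed
      moreover have "c = 0" "d = monom e (Suc r)" using n0 False c d by auto
      ultimately show ?thesis using fg F0
        by (intro exI[of _ "p + monom l r"] exI[of _ 0]) auto
    qed
  qed
qed

end

section \<open>Pairs of values of skew derivations\<close>

definition peval :: "'k::field lop \<Rightarrow> 'k poly \<Rightarrow> 'k lop"
  where "peval t p = (\<Sum>i\<le>degree p. sc (coeff p i) * t ^ i)"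

lemma peval_altdef:
  assumes "degree p < N" shows "peval t p = (\<Sum>i<N. sc (coeff p i) * t ^ i)"
  unfolding peval_def using assms by (intro sum.mono_neutral_left) (auto simp: not_le coeff_eq_0)

lemma peval_add: "peval t (p + r) = peval t p + peval t r"
proof -
  define N where "N = Suc (max (degree p) (degree r))"
  have "degree (p + r) < N" "degree p < N" "degree r < N"
    using degree_add_le_max[of p r] by (auto simp: N_def)
  then show ?thesis by (simp add: peval_altdef[where N = N] sc_arith distrib_right sum.distrib)
qed

lemma peval_0 [simp]: "peval t 0 = 0"
  by (simp add: peval_def)

lemma peval_smult: "peval t (smult c p) = sc c * peval t p"
proof -
  have "degree (smult c p) < Suc (degree p)" by (simp add: le_imp_less_Suc degree_smult_le)
  then show ?thesis
    by (simp add: peval_altdef[where N = "Suc (degree p)"] sc_arith sum_distrib_left mult.assoc del: sum.lessThan_Suc)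
qed

lemma peval_monom: "peval t (monom c i) = sc c * t ^ i"
proof -
  have "peval t (monom c i) = (\<Sum>j<Suc i. sc (coeff (monom c i) j) * t ^ j)"
    by (rule peval_altdef) (simp add: le_imp_less_Suc degree_monom_le)
  also have "\<dots> = (\<Sum>j<Suc i. if j = i then sc c * t ^ i else 0)"
    by (rule sum.cong) auto
  finally show ?thesis by simp
qed

lemma peval_sum: "peval t (sum f S) = (\<Sum>i\<in>S. peval t (f i))"
  by (induction S rule: infinite_finite_induct) (auto simp: peval_add)

text \<open>The value at x of the skew derivation induced by w, and below that at y; w may be any
  operator.\<close>

definition inner_x :: "'k::field \<Rightarrow> 'k lop \<Rightarrow> 'k lop"
  where "inner_x \<mu> w = w * X_op - sc (inverse \<mu>) * (X_op * w)"

definition inner_y :: "'k::field \<Rightarrow> 'k \<Rightarrow> 'k lop \<Rightarrow> 'k lop"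
  where "inner_y q \<mu> w = w * Y_op q - sc \<mu> * (Y_op q * w)"

text \<open>The result of applying a skew derivation with values u at x and v at y to yx = qxy + 1;
  the constant 1 contributes 0.\<close>

definition compatible :: "'k::field \<Rightarrow> 'k \<Rightarrow> 'k lop \<Rightarrow> 'k lop \<Rightarrow> bool"
  where "compatible q \<mu> u v \<longleftrightarrow>
    v * X_op + sc \<mu> * (Y_op q * u) = sc q * (u * Y_op q + sc (inverse \<mu>) * (X_op * v))"

text \<open>The values of c H_r: when \<mu> q^r = 1, the scalars \<mu>^-1 and q^-r at y cancel.
  Admitting c = 0 with every r makes this the zero space if there is no resonance.\<close>

definition H_pairs :: "'k::field \<Rightarrow> 'k \<Rightarrow> ('k lop \<times> 'k lop) set"
  where "H_pairs q \<mu> = {(sc c * (h_op q ^ r * X_op), - (sc c * (h_op q ^ r * Y_op q))) | c r.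
    \<mu> * q ^ r = 1 \<or> c = 0}"

definition P_pairs :: "'k::field \<Rightarrow> 'k \<Rightarrow> ('k lop \<times> 'k lop) set"
  where "P_pairs q \<mu> = {(peval (Y_op q) a, peval X_op b) | a b. \<mu> = q \<or> a = 0 \<and> b = 0}"

lemma inner_x_add: "inner_x \<mu> (a + b) = inner_x \<mu> a + inner_x \<mu> b"
  and inner_y_add: "inner_y q \<mu> (a + b) = inner_y q \<mu> a + inner_y q \<mu> b"
  by (simp_all add: inner_x_def inner_y_def algebra_simps)

lemma inner_0 [simp]: "inner_x \<mu> 0 = 0" "inner_y q \<mu> 0 = 0"
  by (simp_all add: inner_x_def inner_y_def)

lemma inner_x_sum: "inner_x \<mu> (sum f S) = (\<Sum>i\<in>S. inner_x \<mu> (f i))"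
  and inner_y_sum: "inner_y q \<mu> (sum f S) = (\<Sum>i\<in>S. inner_y q \<mu> (f i))"
  by (induction S rule: infinite_finite_induct) (auto simp: inner_x_add inner_y_add)

lemma inner_sc: "inner_x \<mu> (sc c * a) = sc c * inner_x \<mu> a" "inner_y q \<mu> (sc c * a) = sc c * inner_y q \<mu> a"
  by (simp_all add: inner_x_def inner_y_def right_diff_distrib mult.assoc sc_left_comm[of X_op]
    sc_left_comm[of "Y_op q"] sc_left_comm[of "sc (inverse \<mu>)" c] sc_left_comm[of "sc \<mu>" c])

lemma proj_inner_x: "proj n (inner_x \<mu> w) = inner_x \<mu> (proj (n - 1) w)"
  by (simp add: inner_x_def proj_diff proj_sc proj_X_left proj_X_right)

lemma proj_inner_y: "proj n (inner_y q \<mu> w) = inner_y q \<mu> (proj (n + 1) w)"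
  by (simp add: inner_y_def proj_diff proj_sc proj_Y_left proj_Y_right)

lemma inner_QW: "w \<in> QW q \<Longrightarrow> inner_x \<mu> w \<in> QW q" "w \<in> QW q \<Longrightarrow> inner_y q \<mu> w \<in> QW q"
  by (simp_all add: inner_x_def inner_y_def QW_closed)

lemma P_pairs_0: "(0, 0) \<in> P_pairs q \<mu>"
  by (force simp: P_pairs_def intro: exI[of _ 0])

lemma P_pairs_I: "(peval (Y_op q) a, peval X_op b) \<in> P_pairs q q"
  by (auto simp: P_pairs_def)

lemma H_pairs_I:
  "\<mu> * q ^ r = 1 \<Longrightarrow> (sc c * (h_op q ^ r * X_op), - (sc c * (h_op q ^ r * Y_op q))) \<in> H_pairs q \<mu>"
  unfolding H_pairs_def by blast

lemma H_pairs_0: "(0, 0) \<in> H_pairs q \<mu>"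
  by (force simp: H_pairs_def intro: exI[of _ 0])

lemma P_pairs_add: "s \<in> P_pairs q \<mu> \<Longrightarrow> s' \<in> P_pairs q \<mu> \<Longrightarrow> s + s' \<in> P_pairs q \<mu>"
  unfolding P_pairs_def
  by clarsimp (metis add.right_neutral peval_add)

context qparam
begin

lemma H_pairs_add:
  assumes "s \<in> H_pairs q \<mu>" "s' \<in> H_pairs q \<mu>" shows "s + s' \<in> H_pairs q \<mu>"
proof -
  from assms obtain c r c' r' where s: "s = (sc c * (h_op q ^ r * X_op), - (sc c * (h_op q ^ r * Y_op q)))"
      "s' = (sc c' * (h_op q ^ r' * X_op), - (sc c' * (h_op q ^ r' * Y_op q)))"
    and c: "\<mu> * q ^ r = 1 \<or> c = 0" "\<mu> * q ^ r' = 1 \<or> c' = 0"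
    by (auto simp: H_pairs_def)
  show ?thesis
  proof (cases "c = 0 \<or> c' = 0")
    case True
    then show ?thesis using assms s by (auto simp: zero_prod_def[symmetric])
  next
    case False
    then have "\<mu> * q ^ r = \<mu> * q ^ r'" "\<mu> \<noteq> 0" using c by auto
    then have "r = r'" using q_pow_inj by simp
    then have "s + s' = (sc (c + c') * (h_op q ^ r * X_op), - (sc (c + c') * (h_op q ^ r * Y_op q)))"
      by (simp add: s sc_arith distrib_right)
    then show ?thesis using c False by (auto simp: H_pairs_def)
  qed
qed

definition special where
  "special \<mu> = {s + s' | s s'. s \<in> H_pairs q \<mu> \<and> s' \<in> P_pairs q \<mu>}"

lemma special_H: "s \<in> H_pairs q \<mu> \<Longrightarrow> s \<in> special \<mu>"
  using P_pairs_0[of q \<mu>] unfolding special_def by (intro CollectI exI[of _ s] exI[of _ "(0, 0)"]) (auto simp: prod_eq_iff)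

lemma special_0: "(0, 0) \<in> special \<mu>"
  by (rule special_H[OF H_pairs_0])

lemma special_P: "s \<in> P_pairs q \<mu> \<Longrightarrow> s \<in> special \<mu>"
  using H_pairs_0[of q \<mu>] unfolding special_def by (intro CollectI exI[of _ "(0, 0)"] exI[of _ s]) (auto simp: prod_eq_iff)

lemma special_add: "s \<in> special \<mu> \<Longrightarrow> s' \<in> special \<mu> \<Longrightarrow> s + s' \<in> special \<mu>"
  unfolding special_def
proof clarify
  fix a b a' b' c d c' d'
  assume "(a, b) \<in> H_pairs q \<mu>" "(c, d) \<in> P_pairs q \<mu>" "(a', b') \<in> H_pairs q \<mu>" "(c', d') \<in> P_pairs q \<mu>"
  then have "(a, b) + (a', b') \<in> H_pairs q \<mu>" "(c, d) + (c', d') \<in> P_pairs q \<mu>"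
    using H_pairs_add P_pairs_add by blast+
  then show "\<exists>s s'. (a, b) + (c, d) + ((a', b') + (c', d')) = s + s' \<and> s \<in> H_pairs q \<mu> \<and> s' \<in> P_pairs q \<mu>"
    by (intro exI[of _ "(a, b) + (a', b')"] exI[of _ "(c, d) + (c', d')"]) (auto simp: algebra_simps)
qed

lemma special_sum: "(\<And>i. i \<in> S \<Longrightarrow> f i \<in> special \<mu>) \<Longrightarrow> sum f S \<in> special \<mu>"
  by (induction S rule: infinite_finite_induct)
    (auto intro: special_add special_H H_pairs_0[folded zero_prod_def])

text \<open>A skew derivation of degree n sends x into degree n + 1 and y into degree n - 1, and
  both sides of the relation lie in degree n of the same identity.\<close>

lemma compatible_proj:
  assumes "compatible q \<mu> u v" shows "compatible q \<mu> (proj (n + 1) u) (proj (n - 1) v)"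
  using arg_cong[OF assms[unfolded compatible_def], of "proj n"]
  by (simp add: compatible_def proj_add proj_sc proj_X_left proj_X_right proj_Y_left proj_Y_right)

lemma hpoly_monom: "hpoly q (monom c r) = sc c * h_op q ^ r"
  by (simp only: monom_altdef hpoly_arith(4) hpoly_pow)

lemma hpoly_hpoly_mult: "hpoly q p * (hpoly q r * b) = hpoly q (p * r) * b"
  by (simp add: hpoly_arith mult.assoc)

lemma X_pow_hpoly_l: "X_op ^ n * (hpoly q p * b) = hpoly q (sub (inverse q ^ n) p) * (X_op ^ n * b)"
  by (metis X_pow_hpoly mult.assoc)
lemma Y_pow_hpoly_l: "Y_op q ^ n * (hpoly q p * b) = hpoly q (sub (q ^ n) p) * (Y_op q ^ n * b)"
  by (metis Y_pow_hpoly mult.assoc)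
lemma X_hpoly_l: "X_op * (hpoly q p * b) = hpoly q (sub (inverse q) p) * (X_op * b)"
  by (metis X_hpoly mult.assoc)
lemma Y_hpoly_l: "Y_op q * (hpoly q p * b) = hpoly q (sub q p) * (Y_op q * b)"
  by (metis Y_hpoly mult.assoc)
lemma Y_X_l: "Y_op q * (X_op * b) = hpoly q (k1 1) * b"
  by (metis Y_X mult.assoc)
lemma X_Y_l: "X_op * (Y_op q * b) = hpoly q (k1 (inverse q)) * b"
  by (metis X_Y mult.assoc)

text \<open>Normal ordering: polynomials in h move to the left, and adjacent yx or xy collapse into
  k[h].\<close>

lemmas reorder_rules = X_pow_hpoly X_pow_hpoly_l Y_pow_hpoly Y_pow_hpoly_l X_hpoly X_hpoly_l Y_hpoly Y_hpoly_l
  Y_X Y_X_l X_Y X_Y_l hpoly_hpoly_mult hpoly_arith(5)[symmetric] mult.assoc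

lemma k1_nz: "k1 s \<noteq> 0"
  using q1' by (auto simp: kap_def)

text \<open>The part of degree n >= 0. Since v may be a multiple of y when n = 0,
  \<open>homogeneous_pair\<close> is applied to v x = g(h) x^n, and v is recovered
  afterwards.\<close>

lemma homogeneous_x:
  assumes mu: "\<mu> \<noteq> 0" and u: "u = hpoly q f * X_op ^ Suc n" and v: "v = hpoly q g0 * G q (int n - 1)"
    and c: "compatible q \<mu> u v"
  shows "\<exists>w\<in>QW q. \<exists>s\<in>special \<mu>. (u, v) = (inner_x \<mu> w, inner_y q \<mu> w) + s"
proof -
  define g where "g = (if n = 0 then g0 * k1 1 else g0)"
  have vX: "hpoly q r * G q (int n - 1) * X_op = hpoly q (if n = 0 then r * k1 1 else r) * X_op ^ n" for r
  proof (cases n)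
    case 0
    then show ?thesis by (simp add: G_def reorder_rules)
  next
    case (Suc k)
    then show ?thesis by (simp add: mult.assoc power_Suc2 del: power_Suc)
  qed
  have g: "v * X_op = hpoly q g * X_op ^ n" unfolding v g_def by (rule vX)
  have XX: "X_op ^ n * X_op = X_op * X_op ^ n" by (simp add: power_commutes)
  \<comment> \<open>Multiplying the compatibility relation by x on the right turns all four terms
    into multiples of x^(n+1), also for n = 0.\<close>
  have "hpoly q (g + smult \<mu> (sub q f * k1 1)) * G q (int (Suc n)) = v * X_op * X_op + sc \<mu> * (Y_op q * u) * X_op"
    unfolding g u by (simp only: G_nat) (simp add: reorder_rules hpoly_arith(1,4) distrib_right XX)
  also have "\<dots> = sc q * (u * (Y_op q * X_op) + sc (inverse \<mu>) * (X_op * (v * X_op)))"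
    using arg_cong[OF c[unfolded compatible_def], of "\<lambda>a. a * X_op"] by (simp add: algebra_simps)
  also have "\<dots> = hpoly q (smult q (f * k1 (inverse q ^ Suc n) + smult (inverse \<mu>) (sub (inverse q) g))) * G q (int (Suc n))"
    unfolding g u G_nat by (simp add: reorder_rules hpoly_arith(1,4) distrib_left distrib_right XX)
  finally have "g + smult \<mu> (sub q f * k1 1) =
     smult q (f * k1 (inverse q ^ Suc n) + smult (inverse \<mu>) (sub (inverse q) g))"
    by (simp only: hpoly_G_inj)
  then have E: "g - smult (q / \<mu>) (sub (inverse q) g) =
      smult q (f * k1 (1 * inverse q ^ Suc n)) - smult \<mu> (sub q f * k1 1)"
    by (simp add: smult_add_right divide_inverse algebra_simps)
  have "inverse (1 - q) \<noteq> 0" using q1' by simp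
  from homogeneous_pair[OF mu this one_neq_zero E, unfolded mult_1_left] obtain p c d where
    f: "f = p - smult (inverse \<mu>) (sub (inverse q) p) + c" and
    gd: "g = p * k1 (inverse q ^ n) - smult \<mu> (sub q p * k1 1) + d" and
    cd: "c = 0 \<and> d = 0 \<or> \<mu> = q \<and> c = 0 \<and> (\<exists>e. d = [:e:]) \<or>
      (\<exists>r \<gamma> e. \<mu> * q ^ r = 1 \<and> n = 0 \<and> c = monom \<gamma> r \<and> d = monom (- \<gamma> * inverse (1 - q)) r + monom e (Suc r))"
    by blast
  define w where "w = hpoly q p * X_op ^ n"
  have w: "w \<in> QW q" unfolding w_def by (intro QW_closed QW_hpoly)
  have ux: "u - inner_x \<mu> w = hpoly q c * X_op ^ Suc n"
    unfolding u f w_def inner_x_def by (simp add: reorder_rules hpoly_arith(1-4) algebra_simps XX)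
  have vy: "(v - inner_y q \<mu> w) * X_op = hpoly q d * X_op ^ n"
    unfolding left_diff_distrib g gd w_def inner_y_def
    by (simp add: reorder_rules hpoly_arith(1-4) XX, simp add: algebra_simps power_commutes)
  have "v = proj (int n - 1) v" by (simp add: v proj_hpoly_G)
  moreover have "inner_y q \<mu> w = proj (int n - 1) (inner_y q \<mu> w)"
    using proj_hpoly_G[of "int n" p "int n"] by (simp add: proj_inner_y w_def)
  ultimately have "v - inner_y q \<mu> w = proj (int n - 1) (v - inner_y q \<mu> w)" by (simp add: proj_diff)
  moreover have "v - inner_y q \<mu> w \<in> QW q" using w by (auto simp: v intro!: QW_closed QW_hpoly inner_QW)
  ultimately obtain e where e: "v - inner_y q \<mu> w = hpoly q e * G q (int n - 1)"
    using proj_QW by metis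
  have "hpoly q d * G q (int n) = hpoly q (if n = 0 then e * k1 1 else e) * G q (int n)"
    using vy unfolding e vX by simp
  then have d: "d = (if n = 0 then e * k1 1 else e)" by (simp only: hpoly_G_inj)
  have uv: "(u, v) = (inner_x \<mu> w, inner_y q \<mu> w) + (hpoly q c * X_op ^ Suc n, hpoly q e * G q (int n - 1))"
    by (simp del: power_Suc flip: ux e)
  \<comment> \<open>For n = 0 the remainder d is divisible by \<open>k1 1\<close>, hence vanishes at
    h = 1. This excludes a nonzero constant d when \<mu> = q, and in the resonant case fixes the
    free coefficient b so that the remainder is a multiple of H_r.\<close>
  have k10: "poly (k1 1) 1 = 0" by (simp add: kap_def)
  from cd have "(hpoly q c * X_op ^ Suc n, hpoly q e * G q (int n - 1)) \<in> special \<mu>"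
  proof (elim disjE conjE exE)
    assume cd0: "c = 0" "d = 0"
    then have "e = 0" using d k1_nz[of 1] by (auto split: if_splits)
    then show ?thesis using cd0 special_0 by simp
  next
    fix b assume b: "\<mu> = q" "c = 0" "d = [:b:]"
    show ?thesis
    proof (cases n)
      case 0
      then have "b = 0" using arg_cong[OF d, of "\<lambda>p. poly p 1"] k10 b by simp
      then have "e = 0" using d 0 b k1_nz[of 1] by auto
      then show ?thesis using b special_0 by simp
    next
      case (Suc k)
      then have "(hpoly q c * X_op ^ Suc n, hpoly q e * G q (int n - 1)) = (peval (Y_op q) 0, peval X_op (monom b k))"
        using d[symmetric] b by (simp add: peval_monom)
      then show ?thesis using b(1) special_P[OF P_pairs_I] by (simp only:)
    qed
  next
    fix r \<gamma> b
    assume r: "\<mu> * q ^ r = 1" "n = 0" "c = monom \<gamma> r"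
      "d = monom (- \<gamma> * inverse (1 - q)) r + monom b (Suc r)"
    have "poly d 1 = 0" using d r(2) k10 by simp
    then have b: "b = \<gamma> * inverse (1 - q)" by (simp add: r(4) poly_monom)
    have "e * k1 1 = monom (- \<gamma>) r * k1 1"
      using d r(2) unfolding r(4) b
      by (auto simp: kap_def smult_monom monom_Suc smult_add_right mult.commute)
    then have "e = monom (- \<gamma>) r" using k1_nz[of 1] by simp
    then have "(hpoly q c * X_op ^ Suc n, hpoly q e * G q (int n - 1)) =
       (sc \<gamma> * (h_op q ^ r * X_op), - (sc \<gamma> * (h_op q ^ r * Y_op q)))"
      using r by (simp add: hpoly_monom G_def sc_arith mult.assoc)
    then show ?thesis using special_H[OF H_pairs_I[OF r(1)]] by (simp only:)
  qed
  then show ?thesis using uv w by blast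
qed

lemma inverse_qparam: "qparam (inverse q)"
  using q0 q_root by unfold_locales (auto simp: power_inverse)

text \<open>The mirror image, in degree -(n+1): q and \<mu> are inverted, v takes the part of u, and
  t = 1/q because xy replaces yx. The factor a stays 1/(1 - q).\<close>

lemma homogeneous_y:
  assumes mu: "\<mu> \<noteq> 0" and u: "u = hpoly q f * Y_op q ^ n" and v: "v = hpoly q g * Y_op q ^ Suc (Suc n)"
    and c: "compatible q \<mu> u v"
  shows "\<exists>w\<in>QW q. \<exists>s\<in>special \<mu>. (u, v) = (inner_x \<mu> w, inner_y q \<mu> w) + s"
proof -
  interpret Q': qparam "inverse q" by (rule inverse_qparam)
  let ?m = "Suc n"
  have YY: "Y_op q ^ k * Y_op q = Y_op q * Y_op q ^ k" for k by (simp add: power_commutes)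
  have YX: "Y_op q ^ Suc k * X_op = hpoly q (k1 (q ^ k)) * Y_op q ^ k" for k
    by (simp add: power_Suc2 reorder_rules del: power_Suc)
  have "hpoly q (g * k1 (q ^ ?m) + smult \<mu> (sub q f)) * G q (- int ?m) = v * X_op + sc \<mu> * (Y_op q * u)"
    unfolding v u G_nat mult.assoc YX
    by (simp add: reorder_rules hpoly_arith(1,4) distrib_right)
  also have "\<dots> = sc q * (u * Y_op q + sc (inverse \<mu>) * (X_op * v))"
    using c by (simp add: compatible_def)
  also have "\<dots> = hpoly q (smult q (f + smult (inverse \<mu>) (sub (inverse q) g * k1 (inverse q)))) * G q (- int ?m)"
    unfolding v u G_nat by (simp add: reorder_rules hpoly_arith(1,4) distrib_right distrib_left YY)
  finally have E: "g * k1 (q ^ ?m) + smult \<mu> (sub q f) = smult q (f + smult (inverse \<mu>) (sub (inverse q) g * k1 (inverse q)))"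
    by (simp only: hpoly_G_inj)
  have "f - smult (inverse q / inverse \<mu>) (sub (inverse (inverse q)) f) =
      smult (inverse q) (g * k1 (inverse q * inverse (inverse q) ^ Suc ?m)) - smult (inverse \<mu>) (sub (inverse q) g * k1 (inverse q))"
  proof -
    have e1: "inverse q * inverse (inverse q) ^ Suc ?m = q ^ ?m" using q0 by simp
    have "smult (inverse q) (g * k1 (q ^ ?m)) = smult (inverse q) (smult q (f + smult (inverse \<mu>) (sub (inverse q) g * k1 (inverse q))) - smult \<mu> (sub q f))"
      using E[folded eq_diff_eq] by (rule arg_cong)
    moreover have "inverse q * (q * inverse \<mu>) = inverse \<mu>" "inverse q * q = 1" using q0 by simp_all
    ultimately show ?thesis unfolding e1
      by (simp add: smult_diff_right smult_add_right divide_inverse)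
  qed
  \<comment> \<open>The index here is n + 1 > 0, which rules out the third alternative, the one with
    a resonance.\<close>
  from Q'.homogeneous_pair[OF _ _ _ this] mu q0 q1' obtain p c d where
    g: "g = p - smult \<mu> (sub q p) + c" and
    f: "f = p * k1 (inverse q * q ^ ?m) - smult (inverse \<mu>) (sub (inverse q) p * k1 (inverse q)) + d" and
    cd: "c = 0 \<and> d = 0 \<or> \<mu> = q \<and> c = 0 \<and> (\<exists>e. d = [:e:])"
    by auto
  have f': "f = p * k1 (q ^ n) - smult (inverse \<mu>) (sub (inverse q) p * k1 (inverse q)) + d"
  proof -
    have "inverse q * q ^ ?m = q ^ n" using q0 by simp
    then show ?thesis using f by (simp only:)
  qed
  define w where "w = hpoly q p * Y_op q ^ ?m"
  have w: "w \<in> QW q" unfolding w_def by (intro QW_closed QW_hpoly)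
  have vy: "v = inner_y q \<mu> w + hpoly q c * Y_op q ^ Suc ?m"
    unfolding v g w_def inner_y_def by (simp add: reorder_rules hpoly_arith(1-4) algebra_simps YY)
  have ux: "u = inner_x \<mu> w + hpoly q d * Y_op q ^ n"
    unfolding u f' w_def inner_x_def mult.assoc YX
    by (simp add: reorder_rules hpoly_arith(1-4), simp add: algebra_simps)
  have "(hpoly q d * Y_op q ^ n, hpoly q c * Y_op q ^ Suc ?m) \<in> special \<mu>"
    using cd
  proof (elim disjE conjE exE)
    assume "c = 0" "d = 0"
    then show ?thesis using special_0 by simp
  next
    fix e assume e: "\<mu> = q" "c = 0" "d = [:e:]"
    then have "(hpoly q d * Y_op q ^ n, hpoly q c * Y_op q ^ Suc ?m) = (peval (Y_op q) (monom e n), peval X_op 0)"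
      by (simp add: peval_monom)
    then show ?thesis using e(1) special_P[OF P_pairs_I] by (simp only:)
  qed
  then show ?thesis using ux vy w by (intro bexI[of _ w] bexI) auto
qed

theorem compatible_decomposition:
  assumes mu: "\<mu> \<noteq> 0" and uv: "u \<in> QW q" "v \<in> QW q" "compatible q \<mu> u v"
  shows "\<exists>w\<in>QW q. \<exists>s\<in>special \<mu>. (u, v) = (inner_x \<mu> w, inner_y q \<mu> w) + s"
proof -
  have "\<exists>w\<in>QW q. \<exists>s\<in>special \<mu>. (proj (n + 1) u, proj (n - 1) v) = (inner_x \<mu> w, inner_y q \<mu> w) + s" for n
  proof -
    obtain f g where fg: "proj (n + 1) u = hpoly q f * G q (n + 1)" "proj (n - 1) v = hpoly q g * G q (n - 1)"
      using proj_QW uv by metis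
    note c = compatible_proj[OF uv(3), of n]
    show ?thesis
    proof (cases "n \<ge> 0")
      case True
      then obtain k where k: "n = int k" using nonneg_int_cases by blast
      have "G q (n + 1) = X_op ^ Suc k" unfolding k using G_nat(1)[of q "Suc k"] by (simp add: add.commute)
      then show ?thesis using homogeneous_x[OF mu _ _ c] fg k by metis
    next
      case False
      then obtain k where k: "n = - int (Suc k)" by (metis not_le int_cases of_nat_0_le_iff)
      have "G q (n + 1) = Y_op q ^ k" "G q (n - 1) = Y_op q ^ Suc (Suc k)"
        unfolding k using G_nat(2)[of q k] G_nat(2)[of q "Suc (Suc k)"] by (simp_all add: algebra_simps)
      then show ?thesis using homogeneous_y[OF mu _ _ c] fg by metis
    qed
  qed
  then obtain w s where ws: "\<And>n. w n \<in> QW q" "\<And>n. s n \<in> special \<mu>"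
    "\<And>n. (proj (n + 1) u, proj (n - 1) v) = (inner_x \<mu> (w n), inner_y q \<mu> (w n)) + s n"
    by metis
  obtain N where N: "\<And>n. \<bar>n\<bar> > N \<Longrightarrow> proj n u = 0" using proj_QW_bound[OF uv(1)] by blast
  obtain M where M: "\<And>n. \<bar>n\<bar> > M \<Longrightarrow> proj n v = 0" using proj_QW_bound[OF uv(2)] by blast
  \<comment> \<open>The extra 1 covers the shift: component n of the pair involves degree n + 1 of u
    and n - 1 of v.\<close>
  define S where "S = {- (\<bar>N\<bar> + \<bar>M\<bar> + 1) .. \<bar>N\<bar> + \<bar>M\<bar> + 1}"
  have su: "(\<Sum>n\<in>S. proj (n + 1) u) = u"
  proof -
    have "(\<Sum>n\<in>S. proj (n + 1) u) = (\<Sum>n\<in>(\<lambda>n. n + 1) ` S. proj n u)"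
      by (subst sum.reindex) (auto simp: inj_on_def)
    also have "\<dots> = u"
    proof (rule sum_proj)
      fix n assume "n \<notin> (\<lambda>n. n + 1) ` S"
      then have "n - 1 \<notin> S" by (metis diff_add_cancel imageI)
      then show "proj n u = 0" by (intro N) (auto simp: S_def)
    qed (simp add: S_def)
    finally show ?thesis .
  qed
  have sv: "(\<Sum>n\<in>S. proj (n - 1) v) = v"
  proof -
    have "(\<Sum>n\<in>S. proj (n - 1) v) = (\<Sum>n\<in>(\<lambda>n. n - 1) ` S. proj n v)"
      by (subst sum.reindex) (auto simp: inj_on_def)
    also have "\<dots> = v"
    proof (rule sum_proj)
      fix n assume "n \<notin> (\<lambda>n. n - 1) ` S"
      then have "n + 1 \<notin> S" by (metis add_diff_cancel_right' imageI)
      then show "proj n v = 0" by (intro M) (auto simp: S_def)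
    qed (simp add: S_def)
    finally show ?thesis .
  qed
  have "(u, v) = (\<Sum>n\<in>S. (proj (n + 1) u, proj (n - 1) v))"
    by (simp add: sum_prod su sv)
  also have "\<dots> = (inner_x \<mu> (sum w S), inner_y q \<mu> (sum w S)) + sum s S"
    unfolding ws(3) by (simp add: sum.distrib sum_prod inner_x_sum inner_y_sum)
  finally show ?thesis
    using ws(1,2) by (meson QW_sum special_sum)
qed

section \<open>Uniqueness of the decomposition of pairs\<close>

lemma proj_peval_Y: "proj n (peval (Y_op q) p) = (if n \<le> 0 then sc (coeff p (nat (- n))) * Y_op q ^ nat (- n) else 0)"
proof -
  have "proj n (peval (Y_op q) p) = (\<Sum>i\<le>degree p. if i = nat (- n) then (if n \<le> 0 then sc (coeff p (nat (- n))) * Y_op q ^ nat (- n) else 0) else 0)"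
    unfolding peval_def proj_sum proj_sc proj_Y_pow by (rule sum.cong) (auto simp: proj_Y_pow)
  then show ?thesis by (auto simp: not_le coeff_eq_0)
qed

lemma proj_peval_X: "proj n (peval X_op (p :: 'k poly)) = (if n \<ge> 0 then sc (coeff p (nat n)) * X_op ^ nat n else 0)"
proof -
  have "proj n (peval X_op p) = (\<Sum>i\<le>degree p. if i = nat n then (if n \<ge> 0 then sc (coeff p (nat n)) * X_op ^ nat n else 0) else 0)"
    unfolding peval_def proj_sum proj_sc by (rule sum.cong) (auto simp: proj_X_pow)
  then show ?thesis by (auto simp: not_le coeff_eq_0)
qed

lemma sc_pow_eq_0: "sc c * X_op ^ n = 0 \<longleftrightarrow> c = 0" "sc c * Y_op q ^ n = 0 \<longleftrightarrow> c = 0"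
  using hpoly_G_eq_0[of "[:c:]" "int n"] hpoly_G_eq_0[of "[:c:]" "- int n"] by simp_all

text \<open>A resonance \<mu> q^r = 1 excludes \<mu> = q, so at most one of the two special parts is
  nonzero, and each is refuted in the single degree where it lives.\<close>

theorem decomposition_unique:
  assumes mu: "\<mu> \<noteq> 0" and w: "w \<in> QW q" and AB: "(A, B) \<in> H_pairs q \<mu>" and CD: "(C, D) \<in> P_pairs q \<mu>"
    and e1: "inner_x \<mu> w + A + C = 0" and e2: "inner_y q \<mu> w + B + D = 0"
  shows "A = 0 \<and> B = 0 \<and> C = 0 \<and> D = 0"
proof (cases "\<exists>r. \<mu> * q ^ r = 1")
  case True
  have "\<mu> \<noteq> q" using True q_root[of "Suc r" for r] by (metis power_Suc zero_less_Suc)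
  then have CD0: "C = 0" "D = 0" using CD by (auto simp: P_pairs_def)
  from AB obtain c r where A: "A = sc c * (h_op q ^ r * X_op)" and B: "B = - (sc c * (h_op q ^ r * Y_op q))"
    and r: "\<mu> * q ^ r = 1 \<or> c = 0" by (auto simp: H_pairs_def)
  have "c = 0"
  proof (rule ccontr)
    assume "c \<noteq> 0"
    then have r': "\<mu> * q ^ r = 1" using r by auto
    obtain p where p: "proj 0 w = hpoly q p" using proj_QW[OF w, of 0] by auto
    have A': "A = hpoly q (monom c r) * G q 1"
      by (simp add: A hpoly_monom G_def mult.assoc)
    have "inner_x \<mu> (proj 0 w) + A = 0"
      using arg_cong[OF e1, of "proj 1"] CD0 by (simp add: proj_add proj_inner_x A' proj_hpoly_G)
    then have "hpoly q (p - smult (inverse \<mu>) (sub (inverse q) p) + monom c r) * G q 1 = 0"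
      unfolding A' p inner_x_def by (simp add: reorder_rules hpoly_arith(1-4) G_def algebra_simps)
    \<comment> \<open>At the resonant exponent r the inner term has coefficient 0, so c alone
      remains.\<close>
    then have "coeff (p - smult (inverse \<mu>) (sub (inverse q) p) + monom c r) r = 0"
      by (simp only: hpoly_G_eq_0) simp
    moreover have "inverse \<mu> * inverse q ^ r = 1" using r' by (metis inverse_1 inverse_mult_distrib power_inverse)
    ultimately have "c = 0" by (simp flip: mult.assoc)
    then show False using \<open>c \<noteq> 0\<close> by simp
  qed
  then show ?thesis using CD0 A B by simp
next
  case False
  then have AB0: "A = 0" "B = 0" using AB by (auto simp: H_pairs_def)
  from CD obtain a b where C: "C = peval (Y_op q) a" and D: "D = peval X_op b" and ab: "\<mu> = q \<or> a = 0 \<and> b = 0"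
    by (auto simp: P_pairs_def)
  have "a = 0 \<and> b = 0"
  proof (cases "\<mu> = q")
    case mq: True
    have "coeff a i = 0" for i
    proof -
      \<comment> \<open>y^i sits in degree n + 1 of the values at x. The same component of w also
        enters the values at y in degree n - 1 < 0, where D, a polynomial in x, has no part; this
        forces that component to vanish.\<close>
      define n where "n = - int (Suc i)"
      obtain p where p: "proj n w = hpoly q p * Y_op q ^ Suc i" using proj_QW[OF w, of n]
        by (metis G_nat(2) n_def)
      have "inner_y q \<mu> (proj n w) = 0"
        using arg_cong[OF e2, of "proj (n - 1)"] AB0 unfolding D
        by (simp add: proj_add proj_inner_y proj_peval_X n_def)
      then have "hpoly q (p - smult \<mu> (sub q p)) * G q (- int (Suc (Suc i))) = 0"
        unfolding p inner_y_def G_nat by (simp add: reorder_rules hpoly_arith(1-4) algebra_simps power_commutes)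
      then have "p = smult \<mu> (sub q p)" by (simp only: hpoly_G_eq_0) simp
      then have "coeff p k = 0" for k
        by (rule q_difference_kernel) (use q_root[of "Suc k"] in \<open>simp add: mq\<close>)
      then have "p = 0" by (simp add: poly_eq_iff)
      then have "proj n w = 0" using p by simp
      then have "proj (n + 1) C = 0"
        using arg_cong[OF e1, of "proj (n + 1)"] AB0 by (simp add: proj_add proj_inner_x)
      then show ?thesis by (simp add: C proj_peval_Y n_def sc_pow_eq_0)
    qed
    moreover have "coeff b i = 0" for i
    proof -
      define n where "n = int (Suc i)"
      obtain p where p: "proj n w = hpoly q p * X_op ^ Suc i" using proj_QW[OF w, of n]
        by (metis G_nat(1) n_def)
      have "inner_x \<mu> (proj n w) = 0"
        using arg_cong[OF e1, of "proj (n + 1)"] AB0 unfolding C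
        by (simp add: proj_add proj_inner_x proj_peval_Y n_def)
      then have "hpoly q (p - smult (inverse \<mu>) (sub (inverse q) p)) * G q (int (Suc (Suc i))) = 0"
        unfolding p inner_x_def G_nat by (simp add: reorder_rules hpoly_arith(1-4) algebra_simps power_commutes)
      then have "p = smult (inverse \<mu>) (sub (inverse q) p)" by (simp only: hpoly_G_eq_0) simp
      then have "coeff p k = 0" for k
      proof (rule q_difference_kernel)
        show "inverse \<mu> * inverse q ^ k \<noteq> 1"
          using q_root[of "Suc k"] q0 by (auto simp: mq field_simps)
      qed
      then have "p = 0" by (simp add: poly_eq_iff)
      then have "proj n w = 0" using p by simp
      then have "proj (n - 1) D = 0"
        using arg_cong[OF e2, of "proj (n - 1)"] AB0 by (simp add: proj_add proj_inner_y)
      then show ?thesis by (simp add: D proj_peval_X n_def sc_pow_eq_0)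
    qed
    ultimately show ?thesis by (simp add: poly_eq_iff)
  qed (use ab in auto)
  then show ?thesis using AB0 C D by simp
qed

end

section \<open>Faithfulness of the operator representation\<close>

definition gen_op :: "'k::field \<Rightarrow> gen \<Rightarrow> 'k lop"
  where "gen_op q g = (case g of X_gen \<Rightarrow> X_op | Y_gen \<Rightarrow> Y_op q)"

definition word_op :: "'k::field \<Rightarrow> gword \<Rightarrow> 'k lop"
  where "word_op q w = prod_list (map (gen_op q) (letters w))"

definition rep :: "'k::field \<Rightarrow> 'k free_alg \<Rightarrow> 'k lop"
  where "rep q f = (\<Sum>w \<in> Poly_Mapping.keys f. sc (Poly_Mapping.lookup f w) * word_op q w)"

lemma rep_superset:
  "finite S \<Longrightarrow> Poly_Mapping.keys f \<subseteq> S \<Longrightarrow>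
    rep q f = (\<Sum>w\<in>S. sc (Poly_Mapping.lookup f w) * word_op q w)"
  unfolding rep_def by (rule sum.mono_neutral_left) (auto simp: in_keys_iff)

lemma rep_add: "rep q (f + g) = rep q f + rep q g"
proof -
  let ?S = "Poly_Mapping.keys f \<union> Poly_Mapping.keys g"
  have "Poly_Mapping.keys (f + g) \<subseteq> ?S" by (rule Poly_Mapping.keys_add)
  then show ?thesis
    by (subst (1 2 3) rep_superset[of ?S])
       (auto simp: lookup_add sc_arith distrib_right sum.distrib)
qed

lemma rep_single: "rep q (Poly_Mapping.single w c) = sc c * word_op q w"
  by (subst rep_superset[of "{w}"]) auto

lemma rep_0: "rep q 0 = 0" by (simp add: rep_def)

lemma rep_sum: "rep q (sum F S) = (\<Sum>s\<in>S. rep q (F s))"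
  by (induction S rule: infinite_finite_induct) (auto simp: rep_0 rep_add)

lemma rep_mult: "rep q (f * g) = rep q f * rep q g"
proof -
  have "f * g = (\<Sum>w\<in>Poly_Mapping.keys f. \<Sum>v\<in>Poly_Mapping.keys g.
      Poly_Mapping.single (w + v) (Poly_Mapping.lookup f w * Poly_Mapping.lookup g v))"
    by (subst expand[of f], subst expand[of g]) (simp add: sum_product mult_single)
  moreover have "sc (a * b) * word_op q (w + v) = sc a * word_op q w * (sc b * word_op q v)" for a b w v
    by (simp add: word_op_def plus_gword_def sc_arith mult.assoc sc_left_comm[of "prod_list _" b])
  ultimately show ?thesis
    by (simp add: rep_sum rep_single sum_product rep_def[of q f] rep_def[of q g])
qed

lemma rep_1: "rep q 1 = 1"
  using rep_single[of q 0 1] by (simp add: word_op_def letters_zero)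

lemma rep_uminus: "rep q (- f) = - rep q f"
  using rep_add[of q f "- f"] by (simp add: rep_0 eq_neg_iff_add_eq_0 add.commute)

lemma rep_diff: "rep q (f - g) = rep q f - rep q g"
  using rep_add[of q f "- g"] by (simp add: rep_uminus)

lemma rep_pow: "rep q (f ^ n) = rep q f ^ n"
  by (induction n) (auto simp: rep_1 rep_mult)

lemma rep_scalar: "rep q (free_scalar c) = sc c"
  by (simp add: free_scalar_def rep_single word_op_def letters_zero)

lemma rep_free_gen: "rep q (free_gen g) = gen_op q g"
  by (simp add: free_gen_def rep_single word_op_def)

lemmas rep_simps = rep_add rep_mult rep_0 rep_1 rep_uminus rep_diff rep_pow rep_scalar
  rep_free_gen gen_op_def

lemma free_scalar_arith:
  "free_scalar (c + d) = free_scalar c + free_scalar d"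
  "free_scalar (c * d) = free_scalar c * free_scalar d"
  "free_scalar 0 = 0" "free_scalar 1 = 1"
  by (simp_all add: free_scalar_def single_add mult_single)

lemma free_alg_induct [case_names scalar gen add mult]:
  fixes f :: "'k::field free_alg"
  assumes "\<And>c. P (free_scalar c)" "\<And>g. P (free_gen g)"
    and "\<And>f g. P f \<Longrightarrow> P g \<Longrightarrow> P (f + g)" "\<And>f g. P f \<Longrightarrow> P g \<Longrightarrow> P (f * g)"
  shows "P f"
proof -
  have w: "P (Poly_Mapping.single (Word l) 1)" for l
  proof (induction l)
    case Nil
    show ?case using assms(1)[of 1] by (simp add: free_scalar_def zero_gword_def)
  next
    case (Cons g l)
    have "Poly_Mapping.single (Word (g # l)) 1 = free_gen g * Poly_Mapping.single (Word l) (1::'k)"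
      by (simp add: free_gen_def mult_single plus_gword_def)
    then show ?case using assms(2,4) Cons by simp
  qed
  have s: "P (Poly_Mapping.single w c)" for w c
  proof -
    have "Poly_Mapping.single w c = free_scalar c * Poly_Mapping.single (Word (letters w)) (1::'k)"
      by (simp add: free_scalar_def mult_single)
    then show ?thesis using assms(4)[OF assms(1) w[of "letters w"]] by simp
  qed
  have sm: "P (sum F S)" if "\<And>i. P (F i)" for F :: "gword \<Rightarrow> 'k free_alg" and S
    using that assms(1)[of 0] assms(3)
    by (induction S rule: infinite_finite_induct) (auto simp: free_scalar_arith)
  show ?thesis by (subst expand) (rule sm, rule s)
qed

lemma free_scalar_comm: "f * free_scalar c = free_scalar c * f"
proof (induction f rule: free_alg_induct)
  case (scalar d)
  show ?case by (metis free_scalar_arith(2) mult.commute)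
next
  case (gen g)
  show ?case by (simp add: free_gen_def free_scalar_def mult_single)
next
  case (add f g)
  then show ?case by (simp add: distrib_left distrib_right)
next
  case (mult f g)
  then show ?case by (metis mult.assoc)
qed

lemma free_scalar_left_comm: "f * (free_scalar c * g) = free_scalar c * (f * g)"
  by (metis free_scalar_comm mult.assoc)

lemma rep_in_QW: "rep q f \<in> QW q"
proof (induction f rule: free_alg_induct)
  case (gen g)
  show ?case by (cases g) (simp_all add: rep_simps QW_closed)
qed (auto simp: rep_simps intro: QW_closed)

lemma QW_eq_range: "QW q = range (rep q)"
proof
  show "QW q \<subseteq> range (rep q)"
  proof
    fix a assume "a \<in> QW q"
    then show "a \<in> range (rep q)"
    proof (induction a rule: QW.induct)
      case (QW_sc c)
      show ?case by (metis rangeI rep_scalar)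
    next
      case QW_X
      have "rep q (free_gen X_gen) = X_op" by (simp add: rep_simps)
      then show ?case by (metis rangeI)
    next
      case QW_Y
      have "rep q (free_gen Y_gen) = Y_op q" by (simp add: rep_simps)
      then show ?case by (metis rangeI)
    next
      case (QW_add a b)
      then obtain f g where "a = rep q f" "b = rep q g" by auto
      then show ?case using rep_add[of q f g] by (metis rangeI)
    next
      case (QW_mult a b)
      then obtain f g where "a = rep q f" "b = rep q g" by auto
      then show ?case using rep_mult[of q f g] by (metis rangeI)
    qed
  qed
qed (auto simp: rep_in_QW)

lemma cls_add_cong: "qweyl_cls q f = qweyl_cls q f' \<Longrightarrow> qweyl_cls q g = qweyl_cls q g' \<Longrightarrow>
    qweyl_cls q (f + g) = qweyl_cls q (f' + g')"
  by (metis qweyl_simps(4))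

lemma cls_mult_cong: "qweyl_cls q f = qweyl_cls q f' \<Longrightarrow> qweyl_cls q g = qweyl_cls q g' \<Longrightarrow>
    qweyl_cls q (f * g) = qweyl_cls q (f' * g')"
  by (metis qweyl_simps(5))

section \<open>Spanning of the quotient by the ordered monomials x^i y^j\<close>

abbreviation "fX \<equiv> free_gen X_gen"
abbreviation "fY \<equiv> free_gen Y_gen"

lemma cls_YX: "qweyl_cls q (fY * fX) = qweyl_cls q (free_scalar q * (fX * fY) + 1)"
  using qweyl_relation[of q] by (simp add: qweyl_simps qweyl_x_def qweyl_y_def)

text \<open>Iterating the relation moves y past x^i; the new coefficient follows [i+1] = q [i] + 1.
  At i = 0 the truncated exponent is multiplied by 0.\<close>

lemma cls_Y_X_pow:
  assumes "q \<noteq> 1"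
  shows "qweyl_cls q (fY * fX ^ i) =
    qweyl_cls q (free_scalar (q ^ i) * (fX ^ i * fY) + free_scalar (qnum q i) * fX ^ (i - 1))"
proof (induction i)
  case 0
  show ?case by (simp add: free_scalar_arith)
next
  case (Suc i)
  have "qweyl_cls q (fY * fX ^ Suc i) = qweyl_cls q ((fY * fX) * fX ^ i)" by (simp add: mult.assoc)
  also have "\<dots> = qweyl_cls q ((free_scalar q * (fX * fY) + 1) * fX ^ i)"
    by (rule cls_mult_cong[OF cls_YX refl])
  also have "\<dots> = qweyl_cls q (free_scalar q * fX * (fY * fX ^ i) + fX ^ i)"
    by (simp add: distrib_right mult.assoc)
  also have "\<dots> = qweyl_cls q (free_scalar q * fX *
      (free_scalar (q ^ i) * (fX ^ i * fY) + free_scalar (qnum q i) * fX ^ (i - 1)) + fX ^ i)"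
    by (intro cls_add_cong cls_mult_cong Suc refl)
  also have "free_scalar q * fX * (free_scalar (q ^ i) * (fX ^ i * fY) + free_scalar (qnum q i) * fX ^ (i - 1)) + fX ^ i
    = free_scalar (q ^ Suc i) * (fX ^ Suc i * fY) + free_scalar (qnum q (Suc i)) * fX ^ i"
  proof -
    have "free_scalar (qnum q i) * fX ^ (i - 1) * fX = free_scalar (qnum q i) * fX ^ i"
      by (cases i) (simp_all add: free_scalar_arith mult.assoc power_commutes)
    then have "fX * (free_scalar (qnum q i) * fX ^ (i - 1)) = free_scalar (qnum q i) * fX ^ i"
      by (simp add: free_scalar_left_comm[of fX] mult.assoc power_commutes)
    moreover have "qnum q (Suc i) = q * qnum q i + 1"
      using assms by (simp add: qnum_def divide_simps, simp add: algebra_simps)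
    ultimately show ?thesis
      by (simp add: free_scalar_arith distrib_left distrib_right mult.assoc free_scalar_left_comm[of fX])
  qed
  finally show ?case by simp
qed

text \<open>Sums of ordered monomials in which an exponent pair may occur repeatedly, so that
  closure under addition is immediate; \<open>NF_sum\<close> collects the repetitions.\<close>

inductive_set NF :: "'k::field free_alg set" where
  "0 \<in> NF"
| "f \<in> NF \<Longrightarrow> free_scalar c * (fX ^ i * fY ^ j) + f \<in> NF"

lemma NF_add: "f \<in> NF \<Longrightarrow> g \<in> NF \<Longrightarrow> f + g \<in> NF"
  by (induction f rule: NF.induct) (auto simp: add.assoc intro: NF.intros)

lemma NF_term: "free_scalar c * (fX ^ i * fY ^ j) \<in> NF"
  using NF.intros(2)[OF NF.intros(1)] by simp

text \<open>Letting g vary over all normal forms makes the product case a composition of two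
  reductions, so only left multiplication by x and by y has to be computed.\<close>

lemma NF_mult:
  assumes "q \<noteq> 1" "g \<in> NF"
  shows "\<exists>g'\<in>NF. qweyl_cls q (f * g) = qweyl_cls q g'"
  using assms(2)
proof (induction f arbitrary: g rule: free_alg_induct)
  case (scalar c)
  from scalar show ?case
  proof (induction g rule: NF.induct)
    case 1
    show ?case using NF.intros(1) by auto
  next
    case (2 f d i j)
    then obtain g' where g': "g' \<in> NF" "qweyl_cls q (free_scalar c * f) = qweyl_cls q g'" by auto
    have "qweyl_cls q (free_scalar c * (free_scalar d * (fX ^ i * fY ^ j) + f)) =
      qweyl_cls q (free_scalar (c * d) * (fX ^ i * fY ^ j) + g')"
      using cls_add_cong[OF refl g'(2)] by (simp add: distrib_left free_scalar_arith mult.assoc)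
    then show ?case using g'(1) NF.intros(2) by blast
  qed
next
  case (gen s)
  from gen show ?case
  proof (induction g rule: NF.induct)
    case 1
    show ?case using NF.intros(1) by auto
  next
    case (2 f d i j)
    then obtain g' where g': "g' \<in> NF" "qweyl_cls q (free_gen s * f) = qweyl_cls q g'" by auto
    have "\<exists>t\<in>NF. qweyl_cls q (free_gen s * (free_scalar d * (fX ^ i * fY ^ j))) = qweyl_cls q t"
    proof (cases s)
      case X_gen
      have "free_gen s * (free_scalar d * (fX ^ i * fY ^ j)) = free_scalar d * (fX ^ Suc i * fY ^ j)"
        by (simp add: X_gen free_scalar_left_comm[of fX] mult.assoc)
      then show ?thesis using NF_term by metis
    next
      case Y_gen
      have "qweyl_cls q (free_gen s * (free_scalar d * (fX ^ i * fY ^ j))) =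
        qweyl_cls q (free_scalar d * (fY * fX ^ i * fY ^ j))"
        by (simp add: Y_gen free_scalar_left_comm[of fY] mult.assoc)
      also have "\<dots> = qweyl_cls q (free_scalar d * ((free_scalar (q ^ i) * (fX ^ i * fY) + free_scalar (qnum q i) * fX ^ (i - 1)) * fY ^ j))"
        by (intro cls_mult_cong cls_Y_X_pow assms refl)
      also have "\<dots> = qweyl_cls q (free_scalar (d * q ^ i) * (fX ^ i * fY ^ Suc j) + free_scalar (d * qnum q i) * (fX ^ (i - 1) * fY ^ j))"
        by (simp add: distrib_left distrib_right free_scalar_arith mult.assoc)
      finally show ?thesis using NF_add[OF NF_term NF_term] by blast
    qed
    then obtain t where t: "t \<in> NF" "qweyl_cls q (free_gen s * (free_scalar d * (fX ^ i * fY ^ j))) = qweyl_cls q t" by blast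
    show ?case
      using NF_add[OF t(1) g'(1)] cls_add_cong[OF t(2) g'(2)] by (auto simp: distrib_left)
  qed
next
  case (add f f')
  from add.IH(1)[OF add.prems] obtain g1 where 1: "g1 \<in> NF" "qweyl_cls q (f * g) = qweyl_cls q g1"
    by blast
  from add.IH(2)[OF add.prems] obtain g2 where 2: "g2 \<in> NF" "qweyl_cls q (f' * g) = qweyl_cls q g2"
    by blast
  show ?case using NF_add[OF 1(1) 2(1)] cls_add_cong[OF 1(2) 2(2)] by (auto simp: distrib_right)
next
  case (mult f f')
  from mult.IH(2)[OF mult.prems] obtain g1 where 1: "g1 \<in> NF" "qweyl_cls q (f' * g) = qweyl_cls q g1"
    by blast
  from mult.IH(1)[OF 1(1)] obtain g2 where 2: "g2 \<in> NF" "qweyl_cls q (f * g1) = qweyl_cls q g2"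
    by blast
  show ?case using 2 cls_mult_cong[OF refl 1(2), of f] by (auto simp: mult.assoc)
qed

lemma NF_exists:
  assumes "q \<noteq> 1"
  shows "\<exists>g\<in>NF. qweyl_cls q f = qweyl_cls q g"
  using NF_mult[OF assms NF_term[of 1 0 0], of f] by (simp add: free_scalar_arith)

text \<open>Both summands are extended by zero to the index set enlarged by (k, l), which adds the
  coefficients of a repeated monomial.\<close>

lemma NF_sum:
  assumes "g \<in> NF"
  shows "\<exists>S c. finite S \<and> g = (\<Sum>(i, j)\<in>S. free_scalar (c (i, j)) * (fX ^ i * fY ^ j))"
  using assms
proof (induction g rule: NF.induct)
  case 1
  show ?case by (intro exI[of _ "{}"]) simp
next
  case (2 f d k l)
  let ?t = "\<lambda>c (i, j). free_scalar (c (i, j)) * (fX ^ i * fY ^ j)"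
  from 2 obtain S c where S: "finite S" "f = sum (?t c) S" by auto
  define c' where "c' p = (if p \<in> S then c p else 0)" for p
  define e where "e p = (if p = (k, l) then d else 0)" for p
  have "f = sum (?t c') (insert (k, l) S)"
    unfolding S(2) using S(1)
    by (intro sum.mono_neutral_cong_left) (auto simp: c'_def free_scalar_arith)
  moreover have "free_scalar d * (fX ^ k * fY ^ l) = sum (?t e) (insert (k, l) S)"
  proof -
    have "sum (?t e) (insert (k, l) S) = (\<Sum>p\<in>insert (k, l) S. if p = (k, l) then free_scalar d * (fX ^ k * fY ^ l) else 0)"
    proof (rule sum.cong[OF refl])
      fix p show "?t e p = (if p = (k, l) then free_scalar d * (fX ^ k * fY ^ l) else 0)"
        by (cases "p = (k, l)") (auto simp: split_def e_def free_scalar_arith prod_eq_iff)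
    qed
    then show ?thesis using S(1) by simp
  qed
  ultimately have "free_scalar d * (fX ^ k * fY ^ l) + f = sum (?t (\<lambda>p. e p + c' p)) (insert (k, l) S)"
    by (simp add: sum.distrib[symmetric] split_def free_scalar_arith distrib_right)
  then show ?case using S(1) by (intro exI[of _ "insert (k, l) S"] exI[of _ "\<lambda>p. e p + c' p"]) auto
qed

section \<open>Faithfulness and translation between the quotient and the operators\<close>

context qparam
begin

text \<open>The ordered monomials act triangularly: on z^l the terms with j > l vanish, those with j
  < l have coefficient 0 by induction, and x^k y^l contributes z^k times the q-factorial \<kappa>,
  which is nonzero as q is not a root of unity.\<close>

lemma NF_rep_inj:
  assumes "g \<in> NF" "rep q g = 0" shows "g = 0"
proof -
  obtain S c where S: "finite S" and g: "g = (\<Sum>(i, j)\<in>S. free_scalar (c (i, j)) * (fX ^ i * fY ^ j))"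
    using NF_sum[OF assms(1)] by blast
  have "c (i, j) = 0" if "(i, j) \<in> S" for i j
    using that
  proof (induction j arbitrary: i rule: less_induct)
    case (less l k)
    define \<kappa> where "\<kappa> = (\<Prod>i<l. qnum q (l - i))"
    have k0: "\<kappa> \<noteq> 0" by (auto simp: \<kappa>_def qnum_nz)
    have t: "coeff (app (sc (c p) * (X_op ^ fst p * Y_op q ^ snd p)) (monom 1 l)) k =
        (if p = (k, l) then c (k, l) * \<kappa> else 0)" if "p \<in> S" for p
    proof -
      obtain i j where p: "p = (i, j)" by (cases p)
      consider "j < l" | "j = l" | "l < j" by linarith
      then show ?thesis
      proof cases
        case 1
        then show ?thesis using less that p by auto
      next
        case 2
        then show ?thesis by (auto simp: p \<kappa>_def)
      next
        case 3
        then have "(\<Prod>i<j. qnum q (l - i)) = 0" by (intro prod_zero) (auto intro!: bexI[of _ l])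
        then show ?thesis using 3 by (simp add: p)
      qed
    qed
    have app_sum_left: "app (\<Sum>p\<in>S. f p) x = (\<Sum>p\<in>S. app (f p) x)" for f :: "nat \<times> nat \<Rightarrow> 'k lop" and x
      by (induction S rule: infinite_finite_induct) auto
    have "rep q g = (\<Sum>p\<in>S. sc (c p) * (X_op ^ fst p * Y_op q ^ snd p))"
      by (simp add: g rep_sum rep_simps split_def)
    then have "0 = coeff (app (\<Sum>p\<in>S. sc (c p) * (X_op ^ fst p * Y_op q ^ snd p)) (monom 1 l)) k"
      using assms(2) by simp
    also have "\<dots> = (\<Sum>p\<in>S. if p = (k, l) then c (k, l) * \<kappa> else 0)"
      unfolding app_sum_left coeff_sum by (rule sum.cong) (use t in auto)
    also have "\<dots> = c (k, l) * \<kappa>" using S less.prems by simp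
    finally show ?case using k0 by simp
  qed
  then show ?thesis unfolding g by (intro sum.neutral) (auto simp: free_scalar_arith)
qed

lemma cls_imp_rep:
  assumes "qweyl_cls q f = qweyl_cls q g" shows "rep q f = rep q g"
proof -
  have ker: "a_kernel type_ring type_ring (rep q) = {f. rep q f = 0}"
    by (auto simp: a_kernel_def' type_ring_def)
  have "ring_hom_ring type_ring type_ring (rep q)"
    by (rule ring_hom_ringI[OF ring_type_ring ring_type_ring])
      (auto simp: type_ring_def rep_add rep_mult rep_1)
  then have K: "ideal {f. rep q f = 0} type_ring"
    using ring_hom_ring.kernel_is_ideal ker by metis
  have "qweyl_ideal q \<subseteq> {f. rep q f = 0}"
    unfolding qweyl_ideal_def
    by (intro ring.genideal_minimal[OF ring_type_ring K]) (simp add: rep_simps YX_rel)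
  moreover have "f \<in> qweyl_cls q f"
    using abelian_subgroup.a_rcos_self[OF ideal.axioms(1)[OF ideal_qweyl_ideal,
        THEN abelian_subgroupI3, OF ring.is_abelian_group[OF ring_type_ring]]]
    by (simp add: qweyl_cls_def type_ring_def)
  then obtain k where "k \<in> qweyl_ideal q" "f = k + g"
    unfolding assms by (auto simp: qweyl_cls_def a_r_coset_def' type_ring_def)
  ultimately show ?thesis
    by (auto simp: rep_add)
qed

text \<open>The difference of two representatives reduces to a normal form, and a normal form acting
  as zero is zero.\<close>

theorem cls_eq_iff: "qweyl_cls q f = qweyl_cls q g \<longleftrightarrow> rep q f = rep q g"
proof
  assume e: "rep q f = rep q g"
  obtain k where k: "k \<in> NF" "qweyl_cls q (f - g) = qweyl_cls q k"
    using NF_exists[OF q1] by blast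
  have "rep q k = 0" using cls_imp_rep[OF k(2)] e by (simp add: rep_diff)
  then have "k = 0" using NF_rep_inj k(1) by blast
  then have "qweyl_cls q (f - g + g) = qweyl_cls q (0 + g)"
    using k(2) by (intro cls_add_cong) auto
  then show "qweyl_cls q f = qweyl_cls q g" by simp
qed (rule cls_imp_rep)

text \<open>Together with \<open>of_op\<close> this gives mutually inverse bijections between the
  quotient and \<open>QW q\<close>; by \<open>cls_eq_iff\<close> the result is the same for every
  choice of representative.\<close>

definition to_op :: "'k free_alg set \<Rightarrow> 'k lop" where "to_op a = rep q (SOME f. qweyl_cls q f = a)"
definition of_op :: "'k lop \<Rightarrow> 'k free_alg set" where "of_op t = qweyl_cls q (SOME f. rep q f = t)"

lemma to_op_cls: "to_op (qweyl_cls q f) = rep q f"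
  unfolding to_op_def by (metis (mono_tags, lifting) cls_eq_iff someI_ex)

lemma of_op_rep: "of_op (rep q f) = qweyl_cls q f"
  unfolding of_op_def cls_eq_iff by (metis (mono_tags, lifting) someI_ex)

abbreviation "R \<equiv> qweyl q"

lemma to_op_in: "a \<in> carrier R \<Longrightarrow> to_op a \<in> QW q"
  and of_op_in: "t \<in> QW q \<Longrightarrow> of_op t \<in> carrier R"
  and to_op_of_op: "t \<in> QW q \<Longrightarrow> to_op (of_op t) = t"
  and of_op_to_op: "a \<in> carrier R \<Longrightarrow> of_op (to_op a) = a"
  by (auto simp: qweyl_simps QW_eq_range to_op_cls of_op_rep)

lemma to_op_inj: "a \<in> carrier R \<Longrightarrow> b \<in> carrier R \<Longrightarrow> to_op a = to_op b \<Longrightarrow> a = b"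
  by (metis of_op_to_op)

lemma x_in: "qweyl_x q \<in> carrier R" and y_in: "qweyl_y q \<in> carrier R"
  and one_in: "\<one>\<^bsub>R\<^esub> \<in> carrier R" and zero_in: "\<zero>\<^bsub>R\<^esub> \<in> carrier R"
  by (auto simp: qweyl_simps qweyl_x_def qweyl_y_def)

lemma add_in: "a \<in> carrier R \<Longrightarrow> b \<in> carrier R \<Longrightarrow> a \<oplus>\<^bsub>R\<^esub> b \<in> carrier R"
  and mult_in: "a \<in> carrier R \<Longrightarrow> b \<in> carrier R \<Longrightarrow> a \<otimes>\<^bsub>R\<^esub> b \<in> carrier R"
  and smult_in: "a \<in> carrier R \<Longrightarrow> c \<odot>\<^bsub>R\<^esub> a \<in> carrier R"
  and uminus_in: "a \<in> carrier R \<Longrightarrow> \<ominus>\<^bsub>R\<^esub> a \<in> carrier R"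
  and minus_in: "a \<in> carrier R \<Longrightarrow> b \<in> carrier R \<Longrightarrow> a \<ominus>\<^bsub>R\<^esub> b \<in> carrier R"
  and pow_in: "a \<in> carrier R \<Longrightarrow> a [^]\<^bsub>R\<^esub> (n::nat) \<in> carrier R"
  by (auto simp: qweyl_simps qweyl_uminus a_minus_def qweyl_pow)

lemmas carrier_in = x_in y_in one_in zero_in add_in mult_in smult_in uminus_in minus_in pow_in

lemma to_op_simps:
  "to_op (qweyl_x q) = X_op" "to_op (qweyl_y q) = Y_op q" "to_op \<one>\<^bsub>R\<^esub> = 1" "to_op \<zero>\<^bsub>R\<^esub> = 0"
  "a \<in> carrier R \<Longrightarrow> b \<in> carrier R \<Longrightarrow> to_op (a \<oplus>\<^bsub>R\<^esub> b) = to_op a + to_op b"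
  "a \<in> carrier R \<Longrightarrow> b \<in> carrier R \<Longrightarrow> to_op (a \<otimes>\<^bsub>R\<^esub> b) = to_op a * to_op b"
  "a \<in> carrier R \<Longrightarrow> to_op (c \<odot>\<^bsub>R\<^esub> a) = sc c * to_op a"
  "a \<in> carrier R \<Longrightarrow> to_op (\<ominus>\<^bsub>R\<^esub> a) = - to_op a"
  "a \<in> carrier R \<Longrightarrow> b \<in> carrier R \<Longrightarrow> to_op (a \<ominus>\<^bsub>R\<^esub> b) = to_op a - to_op b"
  "a \<in> carrier R \<Longrightarrow> to_op (a [^]\<^bsub>R\<^esub> (n::nat)) = to_op a ^ n"
  by (auto simp: qweyl_simps qweyl_uminus a_minus_def qweyl_pow to_op_cls rep_simps
    qweyl_x_def qweyl_y_def)

lemma to_op_h: "to_op (qweyl_h q) = h_op q" and h_in: "qweyl_h q \<in> carrier R"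
  by (simp_all add: qweyl_h_def to_op_simps carrier_in h_eq mult.assoc)

end

section \<open>Automorphisms\<close>

definition mulop :: "'k::field poly \<Rightarrow> 'k lop" where "mulop P = mk (\<lambda>m. monom 1 m * P)"

lemma app_mulop_monom [simp]: "app (mulop P) (monom c m) = monom c m * P"
  by (simp add: mulop_def smult_monom flip: mult_smult_left)

lemma app_mulop: "app (mulop P) p = p * P"
proof -
  have "app (mulop P) p = (\<Sum>i\<le>degree p. monom (coeff p i) i * P)"
    by (subst app_expand) (simp add: smult_monom flip: mult_smult_left)
  then show ?thesis by (simp add: poly_as_sum_of_monoms flip: sum_distrib_right)
qed

lemma mulop_arith: "mulop (P + Q) = mulop P + mulop Q" "mulop (P * Q) = mulop P * mulop Q"
  "mulop 0 = 0" "mulop 1 = 1" "mulop [:c:] = sc c"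
  by (rule lop_eqI; simp add: app_mulop algebra_simps)+

lemma mulop_X: "X_op = mulop [:0, 1:]"
  by (rule lop_eqI) (simp add: app_mulop monom_Suc)

lemma qnum_add: "qnum q (a + b) = q ^ a * qnum q b + qnum q a"
  by (simp add: qnum_def power_add divide_inverse algebra_simps)

text \<open>The q-Leibniz rule y P(x) = P(qx) y + (D_q P)(x), where D_q is the q-derivative. On
  monomials it is the addition formula for q-integers.\<close>

lemma Y_mulop: "Y_op q * mulop P = mulop (sub q P) * Y_op q + mulop (app (Y_op q) P)"
proof (rule lop_eqI, rule poly_eqI)
  fix m k
  have "coeff (app (Y_op q * mulop P) (monom 1 m)) k = (if m \<le> Suc k then qnum q (Suc k) * coeff P (Suc k - m) else 0)"
    by (simp add: coeff_app_Y coeff_monom_mult)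
  also have "\<dots> = (if m \<le> Suc k then (q ^ (Suc k - m) * qnum q m + qnum q (Suc k - m)) * coeff P (Suc k - m) else 0)"
    using qnum_add[of q "Suc k - m" m] by auto
  also have "\<dots> = coeff (app (mulop (sub q P) * Y_op q + mulop (app (Y_op q) P)) (monom 1 m)) k"
  proof (cases "m = 0")
    case False
    then have "m - 1 \<le> k \<longleftrightarrow> m \<le> Suc k" "k - (m - 1) = Suc k - m" by auto
    moreover have "m \<le> k \<Longrightarrow> Suc (k - m) = Suc k - m" by auto
    moreover have "\<not> m \<le> k \<Longrightarrow> m \<le> Suc k \<Longrightarrow> Suc k - m = 0" by auto
    ultimately show ?thesis
      by (auto simp: coeff_app_Y coeff_monom_mult distrib_right mult.assoc mult.left_commute mult.commute[of "sub _ _"])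
  qed (simp add: coeff_app_Y app_mulop)
  finally show "coeff (app (Y_op q * mulop P) (monom 1 m)) k =
    coeff (app (mulop (sub q P) * Y_op q + mulop (app (Y_op q) P)) (monom 1 m)) k" .
qed

text \<open>Elements of degree less than N in y, with coefficients from k[x] on the left. The strict
  bound gives the zero element the level N = 0.\<close>

definition filt :: "'k::field \<Rightarrow> nat \<Rightarrow> 'k lop set"
  where "filt q N = range (\<lambda>P. \<Sum>j<N. mulop (P j) * Y_op q ^ j)"

lemma filtI: "a = (\<Sum>j<N. mulop (P j) * Y_op q ^ j) \<Longrightarrow> a \<in> filt q N"
  unfolding filt_def by (rule range_eqI)

lemma filt_0: "a \<in> filt q 0 \<longleftrightarrow> a = 0" by (auto simp: filt_def)

lemma filt_Suc: "a \<in> filt q (Suc N) \<longleftrightarrow> (\<exists>b\<in>filt q N. \<exists>P. a = mulop P * Y_op q ^ N + b)"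
proof
  assume "\<exists>b\<in>filt q N. \<exists>P. a = mulop P * Y_op q ^ N + b"
  then obtain P Q where "a = mulop P * Y_op q ^ N + (\<Sum>j<N. mulop (Q j) * Y_op q ^ j)"
    by (auto simp: filt_def)
  also have "\<dots> = (\<Sum>j<Suc N. mulop (if j < N then Q j else P) * Y_op q ^ j)"
    by simp
  finally show "a \<in> filt q (Suc N)" by (rule filtI)
qed (auto simp: filt_def add.commute)

lemma filt_mono: "N \<le> M \<Longrightarrow> filt q N \<subseteq> filt q M"
proof (induction M rule: dec_induct)
  case (step M)
  have "filt q M \<subseteq> filt q (Suc M)"
    unfolding subset_iff filt_Suc by (metis add_0 mult_zero_left mulop_arith(3))
  then show ?case using step by blast
qed simp

lemma filt_add: "a \<in> filt q N \<Longrightarrow> b \<in> filt q N \<Longrightarrow> a + b \<in> filt q N"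
proof -
  assume "a \<in> filt q N" "b \<in> filt q N"
  then obtain P Q where "a = (\<Sum>j<N. mulop (P j) * Y_op q ^ j)" "b = (\<Sum>j<N. mulop (Q j) * Y_op q ^ j)"
    by (auto simp: filt_def)
  then have "a + b = (\<Sum>j<N. mulop (P j + Q j) * Y_op q ^ j)"
    by (simp add: mulop_arith distrib_right sum.distrib)
  then show ?thesis by (rule filtI)
qed

lemma filt_mulop: "a \<in> filt q N \<Longrightarrow> mulop P * a \<in> filt q N"
proof -
  assume "a \<in> filt q N"
  then obtain Q where "a = (\<Sum>j<N. mulop (Q j) * Y_op q ^ j)" by (auto simp: filt_def)
  then have "mulop P * a = (\<Sum>j<N. mulop (P * Q j) * Y_op q ^ j)"
    by (simp add: mulop_arith sum_distrib_left mult.assoc)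
  then show ?thesis by (rule filtI)
qed

lemma filt_0_in: "0 \<in> filt q N"
  using filt_mono[of 0 N q] by (auto simp: filt_0)

lemma filt_term: "j < N \<Longrightarrow> mulop P * Y_op q ^ j \<in> filt q N"
proof -
  assume "j < N"
  have "mulop P * Y_op q ^ j \<in> filt q (Suc j)" using filt_0_in by (force simp: filt_Suc)
  then show ?thesis using filt_mono[of "Suc j" N] \<open>j < N\<close> by auto
qed

lemma filt_Y: "a \<in> filt q N \<Longrightarrow> Y_op q * a \<in> filt q (Suc N)"
proof (induction N arbitrary: a)
  case 0
  then show ?case by (simp add: filt_0 filt_0_in)
next
  case (Suc N)
  then obtain b P where b: "b \<in> filt q N" and a: "a = mulop P * Y_op q ^ N + b" by (auto simp: filt_Suc)
  have "Y_op q * a = (Y_op q * mulop P) * Y_op q ^ N + Y_op q * b" by (simp add: a distrib_left mult.assoc)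
  also have "\<dots> = mulop (sub q P) * Y_op q ^ Suc N + mulop (app (Y_op q) P) * Y_op q ^ N + Y_op q * b"
    by (simp add: Y_mulop distrib_right mult.assoc)
  also have "\<dots> \<in> filt q (Suc (Suc N))"
    using Suc.IH[OF b] filt_mono[of "Suc N" "Suc (Suc N)" q]
    by (intro filt_add filt_term) auto
  finally show ?case .
qed

lemma filt_Y_pow: "a \<in> filt q N \<Longrightarrow> Y_op q ^ j * a \<in> filt q (j + N)"
  by (induction j) (auto simp: mult.assoc intro: filt_Y)

text \<open>The bounds are asymmetric: degree below J times degree at most K stays below J + K. This
  keeps the lower part of the first factor from reaching the leading term in
  \<open>QW_unit\<close>.\<close>

lemma filt_mult: "a \<in> filt q J \<Longrightarrow> b \<in> filt q (Suc K) \<Longrightarrow> a * b \<in> filt q (J + K)"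
proof (induction J arbitrary: a)
  case (Suc J)
  then obtain c P where c: "c \<in> filt q J" and a: "a = mulop P * Y_op q ^ J + c" by (auto simp: filt_Suc)
  have "a * b = mulop P * (Y_op q ^ J * b) + c * b" by (simp add: a distrib_right mult.assoc)
  also have "\<dots> \<in> filt q (Suc J + K)"
    using filt_Y_pow[OF Suc.prems(2), of J] Suc.IH[OF c Suc.prems(2)] filt_mono[of "J + K" "Suc J + K" q]
    by (intro filt_add filt_mulop) auto
  finally show ?case .
qed (simp add: filt_0 filt_0_in)

text \<open>Moving y^J past Q(x) rescales the leading coefficient to Q(q^J x), which is nonzero
  whenever Q is, so degrees in y add up.\<close>

lemma filt_lead: "\<exists>r\<in>filt q (J + K). Y_op q ^ J * (mulop Q * Y_op q ^ K) = mulop (sub (q ^ J) Q) * Y_op q ^ (J + K) + r"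
proof (induction J)
  case 0
  show ?case by (auto intro: filt_0_in)
next
  case (Suc J)
  then obtain r where r: "r \<in> filt q (J + K)" and
    e: "Y_op q ^ J * (mulop Q * Y_op q ^ K) = mulop (sub (q ^ J) Q) * Y_op q ^ (J + K) + r" by blast
  let ?r = "mulop (app (Y_op q) (sub (q ^ J) Q)) * Y_op q ^ (J + K) + Y_op q * r"
  have "Y_op q ^ Suc J * (mulop Q * Y_op q ^ K) = Y_op q * (mulop (sub (q ^ J) Q) * Y_op q ^ (J + K) + r)"
    by (simp add: mult.assoc flip: e)
  also have "\<dots> = (Y_op q * mulop (sub (q ^ J) Q)) * Y_op q ^ (J + K) + Y_op q * r"
    by (simp add: distrib_left mult.assoc)
  also have "\<dots> = mulop (sub (q ^ Suc J) Q) * Y_op q ^ (Suc J + K) + ?r"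
    by (simp add: Y_mulop distrib_right mult.assoc add.assoc)
  finally show ?case
    using filt_add[OF filt_term filt_Y[OF r]] by (metis add_Suc lessI)
qed

lemma filt_mult_QW: "a \<in> QW q \<Longrightarrow> b \<in> filt q N \<Longrightarrow> \<exists>M. a * b \<in> filt q M"
proof (induction a arbitrary: b N rule: QW.induct)
  case (QW_sc c)
  then show ?case using filt_mulop[of b q N "[:c:]"] by (auto simp: mulop_arith)
next
  case QW_X
  then show ?case using filt_mulop by (metis mulop_X)
next
  case QW_Y
  then show ?case using filt_Y by blast
next
  case (QW_add a a')
  then obtain M M' where "a * b \<in> filt q M" "a' * b \<in> filt q M'" by metis
  then have "a * b \<in> filt q (max M M')" "a' * b \<in> filt q (max M M')"
    using filt_mono[of M "max M M'" q] filt_mono[of M' "max M M'" q] by auto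
  then show ?case using filt_add by (metis distrib_right)
next
  case (QW_mult a a')
  then show ?case by (metis mult.assoc)
qed

lemma QW_filt: "a \<in> QW q \<Longrightarrow> \<exists>M. a \<in> filt q M"
  using filt_mult_QW[of a q 1 1] filt_term[of 0 1 1 q] by (simp add: mulop_arith)

lemma QW_leading:
  assumes "a \<in> QW q" "a \<noteq> 0"
  shows "\<exists>J P. P \<noteq> 0 \<and> (\<exists>a'\<in>filt q J. a = mulop P * Y_op q ^ J + a')"
proof -
  define N where "N = (LEAST N. a \<in> filt q N)"
  have N: "a \<in> filt q N" unfolding N_def using QW_filt[OF assms(1)] by (rule LeastI_ex)
  then obtain J where J: "N = Suc J" using assms(2) by (cases N) (auto simp: filt_0)
  have nJ: "a \<notin> filt q J" using not_less_Least[of J "\<lambda>N. a \<in> filt q N"] J by (simp add: N_def)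
  from N obtain a' P where a: "a' \<in> filt q J" "a = mulop P * Y_op q ^ J + a'" unfolding J filt_Suc by blast
  then have "P \<noteq> 0" using nJ by (auto simp: mulop_arith)
  then show ?thesis using a by blast
qed

context qparam
begin

text \<open>The triangularity argument of \<open>NF_rep_inj\<close>, now with coefficients in k[x]:
  z^l isolates P(l).\<close>

lemma filt_inj:
  assumes "(\<Sum>j<N. mulop (P j) * Y_op q ^ j) = 0" "j < N"
  shows "P j = 0"
  using assms(2)
proof (induction j rule: less_induct)
  case (less l)
  define \<kappa> where "\<kappa> = (\<Prod>i<l. qnum q (l - i))"
  have k0: "\<kappa> \<noteq> 0" by (auto simp: \<kappa>_def qnum_nz)
  have app_sum_left: "app (\<Sum>p\<in>S. f p) x = (\<Sum>p\<in>S. app (f p) x)" for f :: "nat \<Rightarrow> 'k lop" and x S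
    by (induction S rule: infinite_finite_induct) auto
  have t: "app (mulop (P j) * Y_op q ^ j) (monom 1 l) = (if j = l then smult \<kappa> (P l) else 0)" if "j < N" for j
  proof -
    consider "j < l" | "j = l" | "l < j" by linarith
    then show ?thesis
    proof cases
      case 1
      then show ?thesis using less that by (simp add: mulop_arith)
    next
      case 2
      then show ?thesis by (simp add: app_mulop \<kappa>_def monom_0)
    next
      case 3
      then have "(\<Prod>i<j. qnum q (l - i)) = 0" by (intro prod_zero) (auto intro!: bexI[of _ l])
      then show ?thesis using 3 by simp
    qed
  qed
  have "0 = app (\<Sum>j<N. mulop (P j) * Y_op q ^ j) (monom 1 l)" using assms(1) by simp
  also have "\<dots> = (\<Sum>j<N. if j = l then smult \<kappa> (P l) else 0)"
    unfolding app_sum_left by (rule sum.cong) (use t in auto)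
  also have "\<dots> = smult \<kappa> (P l)" using less.prems by simp
  finally show ?case using k0 by simp
qed

lemma filt_top:
  assumes "mulop P * Y_op q ^ N + b = 0" "b \<in> filt q N"
  shows "P = 0"
proof -
  obtain Q where b: "b = (\<Sum>j<N. mulop (Q j) * Y_op q ^ j)" using assms(2) by (auto simp: filt_def)
  have "(\<Sum>j<Suc N. mulop (if j < N then Q j else P) * Y_op q ^ j) = 0"
    using assms(1) by (simp add: b add.commute)
  from filt_inj[OF this, of N] show ?thesis by simp
qed

text \<open>The leading coefficients multiply to a nonzero polynomial, so both factors of 1 have
  degree 0 in y. They are then polynomials in x, where units are constant.\<close>

theorem QW_unit:
  assumes "a \<in> QW q" "b \<in> QW q" "a * b = 1"
  shows "\<exists>c. a = sc c"
proof -
  have "a \<noteq> 0" "b \<noteq> 0" using assms(3) by auto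
  then obtain J P a' K Q b' where P: "P \<noteq> 0" "a' \<in> filt q J" "a = mulop P * Y_op q ^ J + a'"
    and Q: "Q \<noteq> 0" "b' \<in> filt q K" "b = mulop Q * Y_op q ^ K + b'"
    using QW_leading assms by metis
  obtain r where r: "r \<in> filt q (J + K)"
    "Y_op q ^ J * (mulop Q * Y_op q ^ K) = mulop (sub (q ^ J) Q) * Y_op q ^ (J + K) + r"
    using filt_lead by blast
  have b: "b \<in> filt q (Suc K)" using Q by (auto simp: filt_Suc)
  have "a * b = mulop P * (Y_op q ^ J * (mulop Q * Y_op q ^ K)) + (mulop P * (Y_op q ^ J * b') + a' * b)"
    by (simp add: P(3) Q(3) algebra_simps)
  also have "\<dots> = mulop (P * sub (q ^ J) Q) * Y_op q ^ (J + K) + (mulop P * r + (mulop P * (Y_op q ^ J * b') + a' * b))"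
    by (simp add: r(2) mulop_arith algebra_simps)
  finally have ab: "a * b = mulop (P * sub (q ^ J) Q) * Y_op q ^ (J + K) + (mulop P * r + (mulop P * (Y_op q ^ J * b') + a' * b))" .
  have rest: "mulop P * r + (mulop P * (Y_op q ^ J * b') + a' * b) \<in> filt q (J + K)"
    by (intro filt_add filt_mulop r(1) filt_Y_pow Q(2) filt_mult[OF P(2) b])
  have "sub (q ^ J) Q \<noteq> 0"
  proof
    assume z: "sub (q ^ J) Q = 0"
    have "coeff Q k = 0" for k using arg_cong[OF z, of "\<lambda>p. coeff p k"] q0 by simp
    then show False using Q(1) by (simp add: poly_eq_iff)
  qed
  then have nz: "P * sub (q ^ J) Q \<noteq> 0" using P(1) by simp
  have JK: "J + K = 0"
  proof (rule ccontr)
    assume "J + K \<noteq> 0"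
    \<comment> \<open>If J + K > 0, the term -1 belongs to the lower part of a b - 1 = 0, and the
      leading coefficient would have to vanish.\<close>
    then have "mulop (- 1) * Y_op q ^ 0 \<in> filt q (J + K)" by (intro filt_term) auto
    from filt_add[OF rest this]
    have "mulop P * r + (mulop P * (Y_op q ^ J * b') + a' * b) + mulop (- 1) \<in> filt q (J + K)" by simp
    moreover have m1: "mulop (- 1 :: 'k poly) = - 1" by (rule lop_eqI) (simp add: app_mulop)
    moreover have "mulop (P * sub (q ^ J) Q) * Y_op q ^ (J + K) +
       (mulop P * r + (mulop P * (Y_op q ^ J * b') + a' * b) + mulop (- 1)) = 0"
    proof -
      have "mulop (P * sub (q ^ J) Q) * Y_op q ^ (J + K) +
        (mulop P * r + (mulop P * (Y_op q ^ J * b') + a' * b) + mulop (- 1)) = a * b - 1"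
        unfolding ab m1 by (simp add: add.assoc)
      then show ?thesis using assms(3) by simp
    qed
    ultimately have "P * sub (q ^ J) Q = 0" using filt_top by blast
    then show False using nz by simp
  qed
  then have a: "a = mulop P" and b: "b = mulop Q" using P Q by (auto simp: filt_0)
  have "app (a * b) 1 = app 1 1" using assms(3) by simp
  then have "Q * P = 1" by (simp add: a b app_mulop)
  then have "P dvd 1" by (metis dvd_triv_right)
  then obtain c where "P = [:c:]" by (auto simp: is_unit_poly_iff)
  then show ?thesis by (auto simp: a mulop_arith)
qed

section \<open>The normal element h and algebra automorphisms\<close>

lemma h_X: "h_op q * X_op = sc q * (X_op * h_op q)"
  by (rule lop_eqI) (simp add: smult_monom mult_ac)

lemma Y_h: "Y_op q * h_op q = sc q * (h_op q * Y_op q)"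
proof (rule lop_eqI)
  fix m show "app (Y_op q * h_op q) (monom 1 m) = app (sc q * (h_op q * Y_op q)) (monom 1 m)"
    by (cases m) (simp_all add: smult_monom mult_ac)
qed

lemma h_eq_commutator: "h_op q = sc q * (Y_op q * X_op - X_op * Y_op q)"
proof -
  have "[:0, 1:] = smult q (k1 1 - k1 (inverse q))"
  proof -
    have A: "q * (inverse (1 - q) * inverse q) = inverse (1 - q)" using q0 by simp
    have B: "inverse (1 - q) - q * inverse (1 - q) = 1"
      using q1' by (metis left_diff_distrib mult_1 right_inverse)
    show ?thesis by (simp add: kap_def right_diff_distrib A B)
  qed
  then show ?thesis unfolding Y_X X_Y by (metis hpoly_arith(2,4))
qed

lemma h_cancel:
  assumes "h_op q * a = 0" shows "a = 0"
proof (rule lop_eqI, rule poly_eqI)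
  fix m k
  have "coeff (app (h_op q * a) (monom 1 m)) k = 0" using assms by simp
  then show "coeff (app a (monom 1 m)) k = coeff (app 0 (monom 1 m)) k"
    using q0 by (simp add: coeff_app_hpoly)
qed

lemma h_normal: "a \<in> QW q \<Longrightarrow> \<exists>c\<in>QW q. a * h_op q = h_op q * c"
proof (induction a rule: QW.induct)
  case (QW_sc c)
  show ?case using sc_comm[of "h_op q" c] QW.QW_sc by metis
next
  case QW_X
  have "X_op * h_op q = h_op q * (sc (inverse q) * X_op)"
    using q0 by (simp add: sc_left_comm[of "h_op q"] h_X sc_sc)
  then show ?case using QW.QW_mult[OF QW.QW_sc QW.QW_X] by blast
next
  case QW_Y
  have "Y_op q * h_op q = h_op q * (sc q * Y_op q)"
    by (simp add: sc_left_comm[of "h_op q"] Y_h)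
  then show ?case using QW.QW_mult[OF QW.QW_sc QW.QW_Y] by blast
next
  case (QW_add a b)
  then obtain c d where "c \<in> QW q" "d \<in> QW q" "a * h_op q = h_op q * c" "b * h_op q = h_op q * d" by blast
  then have "(a + b) * h_op q = h_op q * (c + d)" "c + d \<in> QW q"
    by (simp_all add: distrib_left distrib_right QW.QW_add)
  then show ?case by blast
next
  case (QW_mult a b)
  then obtain c d where cd: "c \<in> QW q" "d \<in> QW q" and e: "a * h_op q = h_op q * c" "b * h_op q = h_op q * d" by blast
  have "a * b * h_op q = a * h_op q * d" by (simp only: mult.assoc e(2))
  also have "\<dots> = h_op q * (c * d)" by (simp only: e(1) mult.assoc)
  finally show ?case using QW.QW_mult[OF cd] by blast
qed

text \<open>The commutator of a and b lies in hR. By \<open>h_normal\<close> this right ideal is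
  two-sided; the aim is commutativity of R/hR.\<close>

definition hcomm :: "'k lop \<Rightarrow> 'k lop \<Rightarrow> bool"
  where "hcomm a b \<longleftrightarrow> (\<exists>c\<in>QW q. a * b - b * a = h_op q * c)"

lemma hcomm_sym: "hcomm a b \<Longrightarrow> hcomm b a"
  unfolding hcomm_def by (metis QW_uminus minus_diff_eq mult_minus_right)

lemma hcomm_sc: "hcomm a (sc c)"
  unfolding hcomm_def using QW_0 by (force simp: sc_comm)

lemma hcomm_add: "hcomm a b \<Longrightarrow> hcomm a c \<Longrightarrow> hcomm a (b + c)"
proof -
  assume "hcomm a b" "hcomm a c"
  then obtain d e where "d \<in> QW q" "e \<in> QW q" "a * b - b * a = h_op q * d" "a * c - c * a = h_op q * e"
    by (auto simp: hcomm_def)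
  then have "a * (b + c) - (b + c) * a = h_op q * (d + e)" "d + e \<in> QW q"
    by (simp_all add: algebra_simps QW_closed)
  then show ?thesis by (auto simp: hcomm_def)
qed

lemma hcomm_mult: "b \<in> QW q \<Longrightarrow> c \<in> QW q \<Longrightarrow> hcomm a b \<Longrightarrow> hcomm a c \<Longrightarrow> hcomm a (b * c)"
proof -
  assume bc: "b \<in> QW q" "c \<in> QW q" and "hcomm a b" "hcomm a c"
  then obtain d e where d: "d \<in> QW q" "a * b - b * a = h_op q * d" and e: "e \<in> QW q" "a * c - c * a = h_op q * e"
    by (auto simp: hcomm_def)
  obtain b' where b': "b' \<in> QW q" "b * h_op q = h_op q * b'" using h_normal bc by blast
  have "a * (b * c) - (b * c) * a = (a * b - b * a) * c + b * (a * c - c * a)"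
    by (simp add: algebra_simps)
  also have "\<dots> = h_op q * (d * c + b' * e)"
  proof -
    have "b * (h_op q * e) = h_op q * (b' * e)" by (simp only: b'(2) mult.assoc[symmetric])
    then show ?thesis unfolding d e by (simp add: distrib_left mult.assoc)
  qed
  finally show ?thesis using d e b' bc by (auto simp: hcomm_def intro!: QW_closed)
qed

lemma hcomm_gen:
  assumes "hcomm a X_op" "hcomm a (Y_op q)" "b \<in> QW q"
  shows "hcomm a b"
  using assms(3) by (induction b rule: QW.induct) (auto intro: assms hcomm_sc hcomm_add hcomm_mult)

lemma hcomm_X_Y: "hcomm (Y_op q) X_op"
proof -
  have "Y_op q * X_op - X_op * Y_op q = h_op q * sc (inverse q)"
    unfolding h_eq_commutator using q0 by (simp add: sc_comm[of _ "inverse q"] sc_sc)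
  then show ?thesis unfolding hcomm_def using QW_sc by blast
qed

lemma hcomm_refl: "hcomm a a"
  unfolding hcomm_def using QW_0 by force

text \<open>The generators commute modulo hR because h = q(yx - xy). \<open>hcomm_gen\<close>
  extends this in one argument and, by symmetry, in the other.\<close>

lemma QW_hcomm: "a \<in> QW q \<Longrightarrow> b \<in> QW q \<Longrightarrow> hcomm a b"
  by (meson hcomm_gen hcomm_sym hcomm_refl hcomm_X_Y)

text \<open>The eigenvalues q^(k+1) of h on z^k are distinct, so an operator that q-commutes with h
  like x can only send z^m to multiples of z^(m+1).\<close>

lemma homogeneous_1:
  assumes "h_op q * a = sc q * (a * h_op q)" shows "proj 1 a = a"
proof (rule lop_eqI, rule poly_eqI)
  fix m k
  have e: "q ^ Suc k * coeff (app a (monom 1 m)) k = q * (q ^ Suc m * coeff (app a (monom 1 m)) k)"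
    using arg_cong[OF assms, of "\<lambda>a. coeff (app a (monom 1 m)) k"]
    by (auto simp: coeff_app_hpoly app_monom[of a "q * q ^ m"])
  have "coeff (app a (monom 1 m)) k = 0" if "k \<noteq> Suc m"
  proof -
    have "(q ^ Suc k - q ^ Suc (Suc m)) * coeff (app a (monom 1 m)) k = 0"
      using e by (simp add: algebra_simps)
    moreover have "q ^ Suc k \<noteq> q ^ Suc (Suc m)" using q_pow_inj that by (metis Suc_inject)
    ultimately show ?thesis by simp
  qed
  then show "coeff (app (proj 1 a) (monom 1 m)) k = coeff (app a (monom 1 m)) k"
    by (auto simp: proj_def nat_add_distrib)
qed

lemma homogeneous_minus_1:
  assumes "a * h_op q = sc q * (h_op q * a)" shows "proj (- 1) a = a"
proof (rule lop_eqI, rule poly_eqI)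
  fix m k
  have e: "q ^ Suc m * coeff (app a (monom 1 m)) k = q * (q ^ Suc k * coeff (app a (monom 1 m)) k)"
    using arg_cong[OF assms, of "\<lambda>a. coeff (app a (monom 1 m)) k"]
    by (auto simp: coeff_app_hpoly app_monom[of a "q * q ^ m"])
  have "coeff (app a (monom 1 m)) k = 0" if "m \<noteq> Suc k"
  proof -
    have "(q ^ Suc m - q ^ Suc (Suc k)) * coeff (app a (monom 1 m)) k = 0"
      using e by (simp add: algebra_simps)
    moreover have "q ^ Suc m \<noteq> q ^ Suc (Suc k)" using q_pow_inj that by (metis Suc_inject)
    ultimately show ?thesis by simp
  qed
  then show "coeff (app (proj (- 1) a) (monom 1 m)) k = coeff (app a (monom 1 m)) k"
    by (auto simp: proj_def nat_diff_distrib)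
qed

definition QW_hom :: "('k lop \<Rightarrow> 'k lop) \<Rightarrow> bool" where
  "QW_hom r \<longleftrightarrow> (\<forall>a\<in>QW q. r a \<in> QW q) \<and> (\<forall>c. r (sc c) = sc c) \<and>
    (\<forall>a\<in>QW q. \<forall>b\<in>QW q. r (a + b) = r a + r b) \<and> (\<forall>a\<in>QW q. \<forall>b\<in>QW q. r (a * b) = r a * r b)"

lemma QW_homD:
  assumes "QW_hom r"
  shows "a \<in> QW q \<Longrightarrow> r a \<in> QW q" "r (sc c) = sc c" "a \<in> QW q \<Longrightarrow> b \<in> QW q \<Longrightarrow> r (a + b) = r a + r b"
    "a \<in> QW q \<Longrightarrow> b \<in> QW q \<Longrightarrow> r (a * b) = r a * r b" "a \<in> QW q \<Longrightarrow> b \<in> QW q \<Longrightarrow> r (a - b) = r a - r b"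
    "r 1 = 1"
proof -
  show a: "a \<in> QW q \<Longrightarrow> b \<in> QW q \<Longrightarrow> r (a + b) = r a + r b" for a b using assms by (auto simp: QW_hom_def)
  show "a \<in> QW q \<Longrightarrow> b \<in> QW q \<Longrightarrow> r (a - b) = r a - r b"
    using a[of "a - b" b] QW_diff[of a q b] by (simp add: eq_diff_eq)
  show "r 1 = 1" using assms sc_simps(2) by (metis QW_hom_def)
qed (use assms in \<open>auto simp: QW_hom_def\<close>)

text \<open>h is a scalar times a commutator, a homomorphism maps commutators to commutators, and
  these lie in hR.\<close>

lemma hom_h:
  assumes "QW_hom r" shows "\<exists>c\<in>QW q. r (h_op q) = h_op q * c"
proof -
  note r = QW_homD[OF assms]
  have "r (h_op q) = sc q * (r (Y_op q) * r X_op - r X_op * r (Y_op q))"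
    unfolding h_eq_commutator by (simp add: r QW_closed)
  moreover obtain c where "c \<in> QW q" "r (Y_op q) * r X_op - r X_op * r (Y_op q) = h_op q * c"
    using QW_hcomm[OF r(1)[OF QW_Y] r(1)[OF QW_X]] by (auto simp: hcomm_def)
  ultimately have "r (h_op q) = h_op q * (sc q * c)" by (simp add: sc_left_comm[of "h_op q"])
  then show ?thesis using \<open>c \<in> QW q\<close> QW_closed by blast
qed

theorem QW_automorphism:
  assumes "QW_hom r" "QW_hom r'" and inv: "\<And>a. a \<in> QW q \<Longrightarrow> r (r' a) = a"
  shows "\<exists>\<beta>. \<beta> \<noteq> 0 \<and> r X_op = sc (inverse \<beta>) * X_op \<and> r (Y_op q) = sc \<beta> * Y_op q"
proof -
  note r = QW_homD[OF assms(1)]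
  note cl = QW_h QW_closed
  obtain c where c: "c \<in> QW q" "r (h_op q) = h_op q * c" using hom_h[OF assms(1)] by blast
  obtain c' where c': "c' \<in> QW q" "r' (h_op q) = h_op q * c'" using hom_h[OF assms(2)] by blast
  \<comment> \<open>This expands to h = h c r(c'), and cancelling h shows c to be a unit, hence a
    scalar.\<close>
  have "h_op q = r (r' (h_op q))" using inv QW_h by simp
  also have "\<dots> = h_op q * (c * r c')" using c c' QW_h by (simp add: r mult.assoc)
  finally have "h_op q * (c * r c' - 1) = 0" by (simp add: right_diff_distrib)
  from h_cancel[OF this] have cc: "c * r c' = 1" by simp
  then obtain l where l: "c = sc l" using QW_unit c(1) c'(1) r(1) by blast
  then have l0: "l \<noteq> 0" using cc by auto
  have rh: "r (h_op q) = sc l * h_op q" using c l by (simp add: sc_comm)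
  have scc: "sc l * a = sc l * b \<Longrightarrow> a = b" for a b :: "'k lop"
    using l0 by (metis mult_1 sc_sc sc_simps(2) left_inverse)
  have "r (h_op q * X_op) = r (sc q * (X_op * h_op q))" by (simp only: h_X)
  then have "r (h_op q) * r X_op = sc q * (r X_op * r (h_op q))"
    using QW_h by (simp add: r QW_closed)
  then have "sc l * (h_op q * r X_op) = sc l * (sc q * (r X_op * h_op q))"
    unfolding rh by (simp add: mult.assoc sc_left_comm[of "r X_op"] sc_left_comm[of "sc q" l])
  from homogeneous_1[OF scc[OF this]] have "r X_op = proj 1 (r X_op)" by simp
  then obtain p where p: "r X_op = hpoly q p * X_op"
    using proj_QW[OF r(1)[OF QW_X], of 1] G_nat(1)[of q 1] by auto
  have "r (Y_op q * h_op q) = r (sc q * (h_op q * Y_op q))" by (simp only: Y_h)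
  then have "r (Y_op q) * r (h_op q) = sc q * (r (h_op q) * r (Y_op q))"
    using QW_h by (simp add: r QW_closed)
  then have "sc l * (r (Y_op q) * h_op q) = sc l * (sc q * (h_op q * r (Y_op q)))"
    unfolding rh by (simp add: mult.assoc sc_left_comm[of "r (Y_op q)"] sc_left_comm[of "sc q" l])
  from homogeneous_minus_1[OF scc[OF this]] have "r (Y_op q) = proj (- 1) (r (Y_op q))" by simp
  then obtain s where s: "r (Y_op q) = hpoly q s * Y_op q"
    using proj_QW[OF r(1)[OF QW_Y], of "- 1"] G_nat(2)[of q 1] by auto
  \<comment> \<open>In k[h] the image of h = 1 - (1 - q)yx reads l h = 1 - s(h) p(qh) (1 - h).
    Comparing degrees makes s and p constant, and the constant term makes them inverse to each
    other.\<close>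
  have "sc l * h_op q = r (1 - sc (1 - q) * (Y_op q * X_op))" using rh h_eq by metis
  also have "\<dots> = 1 - sc (1 - q) * (r (Y_op q) * r X_op)" by (simp add: r QW_closed)
  also have "r (Y_op q) * r X_op = hpoly q s * (Y_op q * hpoly q p) * X_op" by (simp add: p s mult.assoc)
  also have "\<dots> = hpoly q (s * sub q p * k1 1)" by (simp add: Y_hpoly hpoly_arith mult.assoc flip: Y_X)
  finally have "hpoly q (smult l [:0, 1:]) = hpoly q (1 - smult (1 - q) (s * sub q p * k1 1))"
    by (simp only: hpoly_arith(2,4) hpoly_simps)
  then have "smult l [:0, 1:] = 1 - smult (1 - q) (s * sub q p * k1 1)"
    using hpoly_G_inj[of "smult l [:0, 1:]" 0 "1 - smult (1 - q) (s * sub q p * k1 1)"] by simp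
  moreover have "smult (1 - q) (s * sub q p * k1 1) = s * sub q p * [:1, - 1:]"
  proof -
    have "smult (1 - q) (k1 1) = [:1, - 1:]" using q1' by (simp add: kap_def)
    then show ?thesis by (metis mult_smult_right)
  qed
  ultimately have "smult l [:0, 1:] = 1 - s * sub q p * [:1, - 1:]" by (simp only:)
  moreover have "s * sub q p * [:1, - 1:] = 1 - (1 - s * sub q p * [:1, - 1:])" by (simp del: mult_pCons_right)
  ultimately have "s * sub q p * [:1, - 1:] = 1 - smult l [:0, 1:]" by (simp only:)
  also have "\<dots> = [:1, - l:]" by (simp add: one_pCons)
  finally have e: "s * sub q p * [:1, - 1:] = [:1, - l:]" .
  then have nz: "s * sub q p \<noteq> 0" by auto
  have "degree (s * sub q p * [:1, - 1:]) = degree (s * sub q p) + 1"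
    using nz by (subst degree_mult_eq) auto
  moreover have "degree [:1, - l:] \<le> 1" by simp
  ultimately have "degree (s * sub q p) = 0" unfolding e by linarith
  moreover have "degree (s * sub q p) = degree s + degree (sub q p)"
    using nz by (intro degree_mult_eq) auto
  ultimately have "degree s = 0" "degree (sub q p) = 0" by auto
  then obtain a b where ab: "s = [:b:]" "sub q p = [:a:]" by (metis degree_eq_zeroE)
  have pa: "p = [:a:]"
  proof (rule poly_eqI)
    fix k show "coeff p k = coeff [:a:] k"
      using arg_cong[OF ab(2), of "\<lambda>p. coeff p k"] q0 by (cases k) auto
  qed
  have "b * a = 1" using arg_cong[OF e, of "\<lambda>p. coeff p 0"] by (simp add: ab mult.commute)
  then have "b \<noteq> 0" "a = inverse b" using inverse_unique[of b a] by auto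
  then show ?thesis using p s pa ab by (intro exI[of _ b]) simp
qed

end

section \<open>Skew derivations and their values on the generators\<close>

text \<open>Conjugation by the diagonal operator z^m -> \<beta>^m z^m. It extends
  \<open>\<rho>_\<beta>\<close> from the algebra to all operators.\<close>

definition twist :: "'k::field \<Rightarrow> 'k lop \<Rightarrow> 'k lop"
  where "twist \<beta> a = diag (\<lambda>m. inverse \<beta> ^ m) * a * diag (\<lambda>m. \<beta> ^ m)"

lemma diag_mult: "diag f * diag g = diag (\<lambda>m. f m * g m)"
  by (rule lop_eqI) (simp add: mult.commute)

lemma diag_1: "diag (\<lambda>m. 1) = 1"
  by (rule lop_eqI) simp

lemma diag_inverse:
  assumes "\<beta> \<noteq> 0"
  shows "diag (\<lambda>m. \<beta> ^ m) * diag (\<lambda>m. inverse \<beta> ^ m) = 1" "diag (\<lambda>m. inverse \<beta> ^ m) * diag (\<lambda>m. \<beta> ^ m) = 1"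
  using assms by (simp_all add: diag_mult diag_1 flip: power_mult_distrib)

lemma twist_arith: "twist \<beta> (a + b) = twist \<beta> a + twist \<beta> b" "twist \<beta> (a - b) = twist \<beta> a - twist \<beta> b"
  "twist \<beta> 0 = 0" "twist \<beta> (- a) = - twist \<beta> a"
  by (simp_all add: twist_def algebra_simps)

lemma twist_sc_mult: "twist \<beta> (sc c * a) = sc c * twist \<beta> a"
  by (simp add: twist_def sc_left_comm mult.assoc)

lemma twist_mult: "\<beta> \<noteq> 0 \<Longrightarrow> twist \<beta> (a * b) = twist \<beta> a * twist \<beta> b"
proof -
  assume "\<beta> \<noteq> 0"
  have "twist \<beta> a * twist \<beta> b = diag (\<lambda>m. inverse \<beta> ^ m) * a *
    (diag (\<lambda>m. \<beta> ^ m) * diag (\<lambda>m. inverse \<beta> ^ m)) * b * diag (\<lambda>m. \<beta> ^ m)"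
    by (simp only: twist_def mult.assoc)
  then show ?thesis using \<open>\<beta> \<noteq> 0\<close> by (simp add: diag_inverse twist_def mult.assoc)
qed

lemma twist_1: "\<beta> \<noteq> 0 \<Longrightarrow> twist \<beta> 1 = 1"
  by (simp add: twist_def diag_inverse)

lemma twist_sc: "\<beta> \<noteq> 0 \<Longrightarrow> twist \<beta> (sc c) = sc c"
  using twist_sc_mult[of \<beta> c 1] by (simp add: twist_1)

lemma twist_X: "\<beta> \<noteq> 0 \<Longrightarrow> twist \<beta> X_op = sc (inverse \<beta>) * X_op"
  by (rule lop_eqI) (simp add: twist_def smult_monom mult.left_commute flip: power_mult_distrib)

lemma twist_Y: "\<beta> \<noteq> 0 \<Longrightarrow> twist \<beta> (Y_op q) = sc \<beta> * Y_op q"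
proof (rule lop_eqI)
  fix m assume "\<beta> \<noteq> 0"
  then show "app (twist \<beta> (Y_op q)) (monom 1 m) = app (sc \<beta> * Y_op q) (monom 1 m)"
    by (cases m) (simp_all add: twist_def smult_monom field_simps)
qed

lemma twist_hpoly: "\<beta> \<noteq> 0 \<Longrightarrow> twist \<beta> (hpoly q p) = hpoly q p"
  by (rule lop_eqI) (simp add: twist_def field_simps)

lemma twist_pow: "\<beta> \<noteq> 0 \<Longrightarrow> twist \<beta> (a ^ n) = twist \<beta> a ^ n"
  by (induction n) (simp_all add: twist_1 twist_mult)

lemma twist_twist: "twist \<beta> (twist \<gamma> a) = twist (\<beta> * \<gamma>) a"
proof -
  have "twist \<beta> (twist \<gamma> a) = (diag (\<lambda>m. inverse \<beta> ^ m) * diag (\<lambda>m. inverse \<gamma> ^ m)) * a *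
    (diag (\<lambda>m. \<gamma> ^ m) * diag (\<lambda>m. \<beta> ^ m))"
    by (simp only: twist_def mult.assoc)
  then show ?thesis
    by (simp add: diag_mult twist_def power_mult_distrib mult.commute)
qed

lemma twist_one_param: "twist 1 a = a"
  by (simp add: twist_def diag_1)

lemma twist_QW: "\<beta> \<noteq> 0 \<Longrightarrow> a \<in> QW q \<Longrightarrow> twist \<beta> a \<in> QW q"
  by (rule QW.induct[of a q "\<lambda>a. twist \<beta> a \<in> QW q"])
    (simp_all add: twist_sc twist_X twist_Y twist_arith twist_mult QW_closed)

lemma sc_mult_pow: "(sc c * a) ^ n = sc (c ^ n) * a ^ n"
  by (induction n) (simp_all add: sc_arith sc_left_comm[of a] mult.assoc)

lemma twist_peval_Y: "\<beta> \<noteq> 0 \<Longrightarrow> twist \<beta> (peval (Y_op q) a) = peval (Y_op q) (sub \<beta> a)"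
proof -
  assume b: "\<beta> \<noteq> 0"
  have ts: "twist \<beta> (sum f S) = (\<Sum>i\<in>S. twist \<beta> (f i))" for f and S :: "nat set"
    by (induction S rule: infinite_finite_induct) (auto simp: twist_arith)
  have "degree (sub \<beta> a) < Suc (degree a)"
    unfolding sub_def using degree_pcompose_le[of a "[:0, \<beta>:]"] by (simp split: if_splits)
  then show ?thesis using b
    by (simp add: peval_altdef[where N = "Suc (degree a)"] ts twist_sc_mult twist_pow twist_Y sc_mult_pow
      sc_sc mult.commute del: sum.lessThan_Suc)
qed

lemma twist_peval_X: "\<beta> \<noteq> 0 \<Longrightarrow> twist \<beta> (peval X_op a) = peval X_op (sub (inverse \<beta>) a)"
proof -
  assume b: "\<beta> \<noteq> 0"
  have ts: "twist \<beta> (sum f S) = (\<Sum>i\<in>S. twist \<beta> (f i))" for f and S :: "nat set"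
    by (induction S rule: infinite_finite_induct) (auto simp: twist_arith)
  have "degree (sub (inverse \<beta>) a) < Suc (degree a)"
    unfolding sub_def using degree_pcompose_le[of a "[:0, inverse \<beta>:]"] by (simp split: if_splits)
  then show ?thesis using b
    by (simp add: peval_altdef[where N = "Suc (degree a)"] ts twist_sc_mult twist_pow twist_X sc_mult_pow
      sc_sc mult.commute del: sum.lessThan_Suc)
qed

context qparam
begin

lemma R_induct [consumes 1, case_names x y scalar add mult]:
  assumes "a \<in> carrier R" "P (qweyl_x q)" "P (qweyl_y q)" "\<And>c. P (c \<odot>\<^bsub>R\<^esub> \<one>\<^bsub>R\<^esub>)"
    "\<And>a b. a \<in> carrier R \<Longrightarrow> b \<in> carrier R \<Longrightarrow> P a \<Longrightarrow> P b \<Longrightarrow> P (a \<oplus>\<^bsub>R\<^esub> b)"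
    "\<And>a b. a \<in> carrier R \<Longrightarrow> b \<in> carrier R \<Longrightarrow> P a \<Longrightarrow> P b \<Longrightarrow> P (a \<otimes>\<^bsub>R\<^esub> b)"
  shows "P a"
proof -
  have "P (qweyl_cls q f)" for f
  proof (induction f rule: free_alg_induct)
    case (scalar c)
    show ?case using assms(4)[of c] by (simp add: qweyl_simps)
  next
    case (gen g)
    show ?case using assms(2,3) by (cases g) (simp_all add: qweyl_x_def qweyl_y_def)
  next
    case (add f g)
    then show ?case using assms(5)[of "qweyl_cls q f" "qweyl_cls q g"] by (simp add: qweyl_simps)
  next
    case (mult f g)
    then show ?case using assms(6)[of "qweyl_cls q f" "qweyl_cls q g"] by (simp add: qweyl_simps)
  qed
  then show ?thesis using assms(1) by (auto simp: qweyl_simps)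
qed

lemma alg_autD:
  assumes "\<rho> \<in> alg_aut R"
  shows "a \<in> carrier R \<Longrightarrow> \<rho> a \<in> carrier R" "\<rho> \<one>\<^bsub>R\<^esub> = \<one>\<^bsub>R\<^esub>"
    "a \<in> carrier R \<Longrightarrow> b \<in> carrier R \<Longrightarrow> \<rho> (a \<oplus>\<^bsub>R\<^esub> b) = \<rho> a \<oplus>\<^bsub>R\<^esub> \<rho> b"
    "a \<in> carrier R \<Longrightarrow> b \<in> carrier R \<Longrightarrow> \<rho> (a \<otimes>\<^bsub>R\<^esub> b) = \<rho> a \<otimes>\<^bsub>R\<^esub> \<rho> b"
    "a \<in> carrier R \<Longrightarrow> \<rho> (c \<odot>\<^bsub>R\<^esub> a) = c \<odot>\<^bsub>R\<^esub> \<rho> a"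
    "bij_betw \<rho> (carrier R) (carrier R)"
  using assms by (auto simp: alg_aut_def ring_iso_def ring_hom_def)

lemma alg_aut_twist:
  assumes \<rho>: "\<rho> \<in> alg_aut R" and b: "\<beta> \<noteq> 0"
    and x: "\<rho> (qweyl_x q) = inverse \<beta> \<odot>\<^bsub>R\<^esub> qweyl_x q" and y: "\<rho> (qweyl_y q) = \<beta> \<odot>\<^bsub>R\<^esub> qweyl_y q"
    and a: "a \<in> carrier R"
  shows "to_op (\<rho> a) = twist \<beta> (to_op a)"
  using a
proof (induction a rule: R_induct)
  case (scalar c)
  show ?case by (simp add: alg_autD[OF \<rho>] to_op_simps carrier_in twist_sc b)
qed (simp_all add: alg_autD[OF \<rho>] to_op_simps carrier_in x y twist_X twist_Y twist_arith twist_mult b)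

text \<open>The hypotheses are spelled out because the lemma is also applied to
  \<open>inv_into (carrier R) \<rho>\<close>, whose membership in \<open>alg_aut R\<close> has not
  been shown.\<close>

lemma alg_aut_QW_hom:
  assumes "\<And>a. a \<in> carrier R \<Longrightarrow> \<rho> a \<in> carrier R" "\<rho> \<one>\<^bsub>R\<^esub> = \<one>\<^bsub>R\<^esub>"
    "\<And>a b. a \<in> carrier R \<Longrightarrow> b \<in> carrier R \<Longrightarrow> \<rho> (a \<oplus>\<^bsub>R\<^esub> b) = \<rho> a \<oplus>\<^bsub>R\<^esub> \<rho> b"
    "\<And>a b. a \<in> carrier R \<Longrightarrow> b \<in> carrier R \<Longrightarrow> \<rho> (a \<otimes>\<^bsub>R\<^esub> b) = \<rho> a \<otimes>\<^bsub>R\<^esub> \<rho> b"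
    "\<And>a c. a \<in> carrier R \<Longrightarrow> \<rho> (c \<odot>\<^bsub>R\<^esub> a) = c \<odot>\<^bsub>R\<^esub> \<rho> a"
  shows "QW_hom (\<lambda>t. to_op (\<rho> (of_op t)))"
proof -
  have "of_op (sc c) = c \<odot>\<^bsub>R\<^esub> \<one>\<^bsub>R\<^esub>" for c
    by (rule to_op_inj) (simp_all add: to_op_simps to_op_of_op of_op_in carrier_in QW_closed)
  moreover have "of_op (a + b) = of_op a \<oplus>\<^bsub>R\<^esub> of_op b" if "a \<in> QW q" "b \<in> QW q" for a b
    using that by (intro to_op_inj) (simp_all add: to_op_simps to_op_of_op of_op_in carrier_in QW_closed)
  moreover have "of_op (a * b) = of_op a \<otimes>\<^bsub>R\<^esub> of_op b" if "a \<in> QW q" "b \<in> QW q" for a b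
    using that by (intro to_op_inj) (simp_all add: to_op_simps to_op_of_op of_op_in carrier_in QW_closed)
  ultimately show ?thesis
    by (simp add: QW_hom_def assms to_op_in of_op_in to_op_simps carrier_in)
qed

lemma alg_aut_inv:
  assumes \<rho>: "\<rho> \<in> alg_aut R" and a: "a \<in> carrier R"
  shows "inv_into (carrier R) \<rho> a \<in> carrier R" "\<rho> (inv_into (carrier R) \<rho> a) = a"
  using alg_autD(6)[OF \<rho>] a
  by (metis bij_betw_imp_surj_on inv_into_into, metis bij_betw_inv_into_right)

theorem alg_aut_classification:
  assumes \<rho>: "\<rho> \<in> alg_aut R"
  shows "\<exists>\<beta>. \<beta> \<noteq> 0 \<and> \<rho> (qweyl_x q) = inverse \<beta> \<odot>\<^bsub>R\<^esub> qweyl_x q \<and> \<rho> (qweyl_y q) = \<beta> \<odot>\<^bsub>R\<^esub> qweyl_y q"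
proof -
  let ?s = "inv_into (carrier R) \<rho>"
  note r = alg_autD[OF \<rho>] and i = alg_aut_inv[OF \<rho>]
  have inj: "a = b" if "a \<in> carrier R" "b \<in> carrier R" "\<rho> a = \<rho> b" for a b
    using r(6) that by (auto simp: bij_betw_def inj_on_def)
  have h1: "QW_hom (\<lambda>t. to_op (\<rho> (of_op t)))"
    by (rule alg_aut_QW_hom) (simp_all add: r)
  have h2: "QW_hom (\<lambda>t. to_op (?s (of_op t)))"
    by (rule alg_aut_QW_hom) (simp add: i, (rule inj; simp add: i r carrier_in)+)
  have "\<exists>\<beta>. \<beta> \<noteq> 0 \<and> to_op (\<rho> (of_op X_op)) = sc (inverse \<beta>) * X_op \<and> to_op (\<rho> (of_op (Y_op q))) = sc \<beta> * Y_op q"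
    by (rule QW_automorphism[OF h1 h2]) (simp add: of_op_to_op to_op_of_op i of_op_in)
  moreover have "of_op X_op = qweyl_x q" "of_op (Y_op q) = qweyl_y q"
    using of_op_to_op x_in y_in to_op_simps(1,2) by metis+
  ultimately obtain \<beta> where b: "\<beta> \<noteq> 0" and x: "to_op (\<rho> (qweyl_x q)) = sc (inverse \<beta>) * X_op"
    and y: "to_op (\<rho> (qweyl_y q)) = sc \<beta> * Y_op q" by auto
  have "\<rho> (qweyl_x q) = inverse \<beta> \<odot>\<^bsub>R\<^esub> qweyl_x q" "\<rho> (qweyl_y q) = \<beta> \<odot>\<^bsub>R\<^esub> qweyl_y q"
    by (rule to_op_inj; simp add: x y to_op_simps carrier_in r)+
  then show ?thesis using b by blast
qed

end

section \<open>Skew derivations of the quotient and their values\<close>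

locale qskew = qparam q for q :: "'k::field" +
  fixes \<mu> :: 'k and \<sigma> :: "'k free_alg set \<Rightarrow> 'k free_alg set"
  assumes mu: "\<mu> \<noteq> 0" and \<sigma>: "\<sigma> \<in> alg_aut R"
    and \<sigma>_x: "\<sigma> (qweyl_x q) = inverse \<mu> \<odot>\<^bsub>R\<^esub> qweyl_x q"
    and \<sigma>_y: "\<sigma> (qweyl_y q) = \<mu> \<odot>\<^bsub>R\<^esub> qweyl_y q"
begin

lemma to_op_\<sigma>: "a \<in> carrier R \<Longrightarrow> to_op (\<sigma> a) = twist \<mu> (to_op a)"
  by (rule alg_aut_twist[OF \<sigma> mu \<sigma>_x \<sigma>_y])

lemma \<sigma>_in: "a \<in> carrier R \<Longrightarrow> \<sigma> a \<in> carrier R"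
  by (rule alg_autD(1)[OF \<sigma>])

abbreviation "SD \<equiv> skew_der R \<sigma>"
abbreviation "D \<equiv> Der R \<sigma>"

lemma SD_D:
  assumes "\<delta> \<in> SD"
  shows "a \<in> carrier R \<Longrightarrow> \<delta> a \<in> carrier R" "\<delta> \<in> extensional (carrier R)"
    "a \<in> carrier R \<Longrightarrow> b \<in> carrier R \<Longrightarrow> to_op (\<delta> (a \<oplus>\<^bsub>R\<^esub> b)) = to_op (\<delta> a) + to_op (\<delta> b)"
    "a \<in> carrier R \<Longrightarrow> to_op (\<delta> (c \<odot>\<^bsub>R\<^esub> a)) = sc c * to_op (\<delta> a)"
    "a \<in> carrier R \<Longrightarrow> b \<in> carrier R \<Longrightarrow>
      to_op (\<delta> (a \<otimes>\<^bsub>R\<^esub> b)) = to_op (\<delta> a) * to_op b + twist \<mu> (to_op a) * to_op (\<delta> b)"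
proof -
  have d: "\<delta> a \<in> carrier R" if "a \<in> carrier R" for a using assms that by (auto simp: skew_der_def)
  then show "a \<in> carrier R \<Longrightarrow> \<delta> a \<in> carrier R" .
  show "\<delta> \<in> extensional (carrier R)" using assms by (auto simp: skew_der_def PiE_def)
  show "a \<in> carrier R \<Longrightarrow> b \<in> carrier R \<Longrightarrow> to_op (\<delta> (a \<oplus>\<^bsub>R\<^esub> b)) = to_op (\<delta> a) + to_op (\<delta> b)"
    using assms d by (simp add: skew_der_def to_op_simps)
  show "a \<in> carrier R \<Longrightarrow> to_op (\<delta> (c \<odot>\<^bsub>R\<^esub> a)) = sc c * to_op (\<delta> a)"
    using assms d by (simp add: skew_der_def to_op_simps)
  show "a \<in> carrier R \<Longrightarrow> b \<in> carrier R \<Longrightarrow>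
      to_op (\<delta> (a \<otimes>\<^bsub>R\<^esub> b)) = to_op (\<delta> a) * to_op b + twist \<mu> (to_op a) * to_op (\<delta> b)"
    using assms d by (simp add: skew_der_def to_op_simps carrier_in to_op_\<sigma> \<sigma>_in)
qed

lemma SD_I:
  assumes "\<delta> \<in> extensional (carrier R)" "\<And>a. a \<in> carrier R \<Longrightarrow> \<delta> a \<in> carrier R"
    "\<And>a b. a \<in> carrier R \<Longrightarrow> b \<in> carrier R \<Longrightarrow> to_op (\<delta> (a \<oplus>\<^bsub>R\<^esub> b)) = to_op (\<delta> a) + to_op (\<delta> b)"
    "\<And>a c. a \<in> carrier R \<Longrightarrow> to_op (\<delta> (c \<odot>\<^bsub>R\<^esub> a)) = sc c * to_op (\<delta> a)"
    "\<And>a b. a \<in> carrier R \<Longrightarrow> b \<in> carrier R \<Longrightarrow>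
      to_op (\<delta> (a \<otimes>\<^bsub>R\<^esub> b)) = to_op (\<delta> a) * to_op b + twist \<mu> (to_op a) * to_op (\<delta> b)"
  shows "\<delta> \<in> SD"
proof -
  have "\<delta> \<in> carrier R \<rightarrow>\<^sub>E carrier R" using assms(1,2) by (auto simp: PiE_def)
  then show ?thesis
    unfolding skew_der_def
    by (intro CollectI conjI ballI allI to_op_inj)
      (use assms in \<open>simp_all add: to_op_simps carrier_in to_op_\<sigma> \<sigma>_in\<close>)
qed

definition val :: "('k free_alg set \<Rightarrow> 'k free_alg set) \<Rightarrow> 'k lop \<times> 'k lop"
  where "val \<delta> = (to_op (\<delta> (qweyl_x q)), to_op (\<delta> (qweyl_y q)))"

lemma SD_one:
  assumes "\<delta> \<in> SD" shows "to_op (\<delta> \<one>\<^bsub>R\<^esub>) = 0"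
proof -
  have "\<one>\<^bsub>R\<^esub> \<otimes>\<^bsub>R\<^esub> \<one>\<^bsub>R\<^esub> = \<one>\<^bsub>R\<^esub>" by (simp add: qweyl_simps)
  then show ?thesis
    using SD_D(5)[OF assms one_in one_in] by (simp add: to_op_simps twist_1 mu)
qed

lemma val_compatible:
  assumes "\<delta> \<in> SD" shows "compatible q \<mu> (fst (val \<delta>)) (snd (val \<delta>))"
  using arg_cong[OF qweyl_relation[of q], of "\<lambda>a. to_op (\<delta> a)"]
  by (simp add: SD_D[OF assms] carrier_in to_op_simps SD_one[OF assms] twist_X twist_Y mu compatible_def
    val_def mult.assoc)

lemma val_in: "\<delta> \<in> SD \<Longrightarrow> fst (val \<delta>) \<in> QW q" "\<delta> \<in> SD \<Longrightarrow> snd (val \<delta>) \<in> QW q"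
  by (simp_all add: val_def to_op_in SD_D carrier_in)

lemma val_inj:
  assumes "\<delta> \<in> SD" "\<epsilon> \<in> SD" "val \<delta> = val \<epsilon>" shows "\<delta> = \<epsilon>"
proof (rule extensionalityI[OF SD_D(2)[OF assms(1)] SD_D(2)[OF assms(2)]])
  fix a assume a: "a \<in> carrier R"
  have "to_op (\<delta> a) = to_op (\<epsilon> a)"
    using a
  proof (induction a rule: R_induct)
    case x
    show ?case using assms(3) by (simp add: val_def)
  next
    case y
    show ?case using assms(3) by (simp add: val_def)
  next
    case (scalar c)
    show ?case using assms(1,2) by (simp add: SD_D SD_one carrier_in)
  qed (use assms(1,2) in \<open>simp_all add: SD_D\<close>)
  then show "\<delta> a = \<epsilon> a" using a assms by (intro to_op_inj) (auto intro: SD_D)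
qed

text \<open>The operator \<open>W\<close> need not lie in the algebra: the derivations \<open>H\<^sub>r\<close>, \<open>X\<^sub>i\<close> and \<open>Y\<^sub>j\<close> are
  inner in the larger ring of operators, where \<open>h\<close> is invertible and \<open>z d/dz\<close> is available.\<close>

lemma SD_from_operator:
  assumes "inner_x \<mu> W \<in> QW q" "inner_y q \<mu> W \<in> QW q"
  shows "\<exists>\<delta>\<in>SD. val \<delta> = (inner_x \<mu> W, inner_y q \<mu> W)"
proof -
  define F where "F t = W * t - twist \<mu> t * W" for t
  have Fm: "F (s * t) = F s * t + twist \<mu> s * F t" for s t
    by (simp add: F_def twist_mult mu algebra_simps)
  have Fa: "F (s + t) = F s + F t" for s t
    by (simp add: F_def twist_arith algebra_simps)
  have Fs: "F (sc c) = 0" for c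
    by (simp add: F_def twist_sc mu sc_comm)
  have Fx: "F X_op = inner_x \<mu> W" and Fy: "F (Y_op q) = inner_y q \<mu> W"
    by (simp_all add: F_def inner_x_def inner_y_def twist_X twist_Y mu mult.assoc)
  have FQ: "F t \<in> QW q" if "t \<in> QW q" for t
    using that
  proof (induction t rule: QW.induct)
    case (QW_mult a b)
    then show ?case by (simp add: Fm QW_closed twist_QW mu)
  qed (use assms in \<open>simp_all add: Fa Fs Fx Fy QW_closed\<close>)
  define \<delta> where "\<delta> = (\<lambda>a\<in>carrier R. of_op (F (to_op a)))"
  have d: "to_op (\<delta> a) = F (to_op a)" "\<delta> a \<in> carrier R" if "a \<in> carrier R" for a
    using that by (simp_all add: \<delta>_def to_op_of_op FQ to_op_in of_op_in)
  have "\<delta> \<in> SD"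
  proof (rule SD_I)
    show "to_op (\<delta> (c \<odot>\<^bsub>R\<^esub> a)) = sc c * to_op (\<delta> a)" if "a \<in> carrier R" for a c
      using that by (simp add: d carrier_in to_op_simps Fm Fs twist_sc mu)
  qed (simp_all add: d carrier_in to_op_simps Fm Fa, simp add: \<delta>_def)
  moreover have "val \<delta> = (inner_x \<mu> W, inner_y q \<mu> W)"
    by (simp add: val_def d carrier_in to_op_simps Fx Fy)
  ultimately show ?thesis by blast
qed

text \<open>Resolves the definite description: existence is assumed, and uniqueness holds because
  values at x and y determine a skew derivation (\<open>val_inj\<close>).\<close>

lemma der_on_gens:
  assumes "\<exists>\<delta>\<in>SD. val \<delta> = (to_op u, to_op v)" "u \<in> carrier R" "v \<in> carrier R"
  shows "der_on_gens q \<sigma> u v \<in> SD" "val (der_on_gens q \<sigma> u v) = (to_op u, to_op v)"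
proof -
  have iff: "\<epsilon> \<in> SD \<and> \<epsilon> (qweyl_x q) = u \<and> \<epsilon> (qweyl_y q) = v \<longleftrightarrow> \<epsilon> \<in> SD \<and> val \<epsilon> = (to_op u, to_op v)" for \<epsilon>
    using to_op_inj[OF SD_D(1)[OF _ x_in] assms(2), of \<epsilon>] to_op_inj[OF SD_D(1)[OF _ y_in] assms(3), of \<epsilon>]
    unfolding val_def by blast
  have "\<exists>!\<epsilon>. \<epsilon> \<in> SD \<and> val \<epsilon> = (to_op u, to_op v)" using assms(1) val_inj by metis
  from theI'[OF this] show "der_on_gens q \<sigma> u v \<in> SD" "val (der_on_gens q \<sigma> u v) = (to_op u, to_op v)"
    unfolding der_on_gens_def iff by auto
qed

section \<open>Existence of the exceptional skew derivations\<close>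

lemma inverse_h:
  "diag (\<lambda>m. inverse q ^ Suc m) * h_op q = 1"
  by (rule lop_eqI) (use q0 in \<open>simp add: field_simps\<close>)

lemma X_hinv: "X_op * diag (\<lambda>m. inverse q ^ Suc m) = sc q * (diag (\<lambda>m. inverse q ^ Suc m) * X_op)"
  by (rule lop_eqI) (use q0 in \<open>simp add: smult_monom\<close>)

lemma Y_hinv: "Y_op q * diag (\<lambda>m. inverse q ^ Suc m) = sc (inverse q) * (diag (\<lambda>m. inverse q ^ Suc m) * Y_op q)"
proof (rule lop_eqI)
  fix m show "app (Y_op q * diag (\<lambda>m. inverse q ^ Suc m)) (monom 1 m) =
    app (sc (inverse q) * (diag (\<lambda>m. inverse q ^ Suc m) * Y_op q)) (monom 1 m)"
    by (cases m) (simp_all add: smult_monom mult_ac)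
qed

text \<open>The constant terms cancel, leaving a multiple of h that the inverse of h can absorb in
  \<open>X_values\<close> and \<open>Y_values\<close>.\<close>

lemma k1_diff: "hpoly q (k1 s - k1 t) = sc (inverse (1 - q) * (t - s)) * h_op q"
proof -
  have "k1 s - k1 t = smult (inverse (1 - q) * (t - s)) [:0, 1:]"
    by (simp add: kap_def algebra_simps)
  then show ?thesis by (simp only: hpoly_arith(4))
qed

text \<open>X_i is induced by a multiple of W = h^-1 y^(i+1). For \<mu> = q the powers of q from
  moving h^-1 cancel \<sigma>: the value at y vanishes, and that at x becomes h^-1 (y^(i+1) x - x
  y^(i+1)) = c y^i, with c nonzero since q^-1 \<noteq> q^i.\<close>

lemma X_values:
  assumes "\<mu> = q" shows "\<exists>\<delta>\<in>SD. val \<delta> = (Y_op q ^ i, 0)"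
proof -
  let ?H = "diag (\<lambda>m. inverse q ^ Suc m)"
  define c where "c = inverse (1 - q) * (inverse q - q ^ i)"
  have "inverse q - q ^ i \<noteq> 0" using q_root[of "Suc i"] q0 by (auto simp: field_simps)
  then have c0: "c \<noteq> 0" using q1' by (simp add: c_def)
  have "inner_x \<mu> (?H * Y_op q ^ Suc i) = ?H * (Y_op q ^ i * (Y_op q * X_op) - X_op * Y_op q * Y_op q ^ i)"
  proof -
    have "sc (inverse \<mu>) * (X_op * (?H * Y_op q ^ Suc i)) = sc (inverse \<mu>) * (X_op * ?H * (Y_op q * Y_op q ^ i))"
      by (simp add: mult.assoc)
    also have "\<dots> = ?H * (X_op * Y_op q * Y_op q ^ i)"
      unfolding X_hinv mult.assoc sc_sc using q0 by (simp add: assms)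
    finally show ?thesis by (simp add: inner_x_def right_diff_distrib mult.assoc power_Suc2 del: power_Suc)
  qed
  also have "\<dots> = ?H * (hpoly q (k1 (q ^ i) - k1 (inverse q)) * Y_op q ^ i)"
    unfolding Y_X X_Y Y_pow_hpoly by (simp add: hpoly_arith left_diff_distrib)
  also have "\<dots> = sc c * (?H * h_op q * Y_op q ^ i)"
    unfolding k1_diff c_def by (simp only: mult.assoc sc_left_comm[of ?H])
  also have "\<dots> = sc c * Y_op q ^ i" by (simp only: inverse_h mult_1)
  finally have x: "inner_x \<mu> (?H * Y_op q ^ Suc i) = sc c * Y_op q ^ i" .
  have "sc \<mu> * (Y_op q * (?H * Y_op q ^ Suc i)) = sc \<mu> * (Y_op q * ?H * Y_op q ^ Suc i)"
    by (simp only: mult.assoc)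
  also have "\<dots> = ?H * (Y_op q * Y_op q ^ Suc i)"
    unfolding Y_hinv mult.assoc sc_sc using q0 by (simp add: assms)
  finally have y: "inner_y q \<mu> (?H * Y_op q ^ Suc i) = 0"
    unfolding inner_y_def by (simp add: mult.assoc power_commutes)
  have "inner_x \<mu> (sc (inverse c) * (?H * Y_op q ^ Suc i)) = Y_op q ^ i"
    "inner_y q \<mu> (sc (inverse c) * (?H * Y_op q ^ Suc i)) = 0"
    unfolding inner_sc x y using c0 by (simp_all add: sc_sc)
  then show ?thesis using SD_from_operator[of "sc (inverse c) * (?H * Y_op q ^ Suc i)"]
    by (simp add: QW_closed)
qed

text \<open>Mirror image of \<open>X_values\<close>, with W a multiple of h^-1 x^(i+1).\<close>

lemma Y_values:
  assumes "\<mu> = q" shows "\<exists>\<delta>\<in>SD. val \<delta> = (0, X_op ^ i)"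
proof -
  let ?H = "diag (\<lambda>m. inverse q ^ Suc m)"
  define c where "c = inverse (1 - q) * (1 - inverse q ^ Suc i)"
  have "1 - inverse q ^ Suc i \<noteq> 0" using q_root[of "Suc i"] q0 by (simp add: power_inverse del: power_Suc)
  then have c0: "c \<noteq> 0" using q1' by (simp add: c_def)
  have "inner_y q \<mu> (?H * X_op ^ Suc i) = ?H * (X_op ^ i * (X_op * Y_op q) - Y_op q * X_op * X_op ^ i)"
  proof -
    have "sc \<mu> * (Y_op q * (?H * X_op ^ Suc i)) = sc \<mu> * (Y_op q * ?H * (X_op * X_op ^ i))"
      by (simp add: mult.assoc)
    also have "\<dots> = ?H * (Y_op q * X_op * X_op ^ i)"
      unfolding Y_hinv mult.assoc sc_sc using q0 by (simp add: assms)
    finally show ?thesis by (simp add: inner_y_def right_diff_distrib mult.assoc power_Suc2 del: power_Suc)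
  qed
  also have "\<dots> = ?H * (hpoly q (k1 (inverse q ^ Suc i) - k1 1) * X_op ^ i)"
    unfolding Y_X X_Y X_pow_hpoly by (simp add: hpoly_arith left_diff_distrib mult.commute)
  also have "\<dots> = sc c * (?H * h_op q * X_op ^ i)"
    unfolding k1_diff c_def by (simp only: mult.assoc sc_left_comm[of ?H])
  also have "\<dots> = sc c * X_op ^ i" by (simp only: inverse_h mult_1)
  finally have y: "inner_y q \<mu> (?H * X_op ^ Suc i) = sc c * X_op ^ i" .
  have "sc (inverse \<mu>) * (X_op * (?H * X_op ^ Suc i)) = sc (inverse \<mu>) * (X_op * ?H * X_op ^ Suc i)"
    by (simp only: mult.assoc)
  also have "\<dots> = ?H * (X_op * X_op ^ Suc i)"
    unfolding X_hinv mult.assoc sc_sc using q0 by (simp add: assms)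
  finally have x: "inner_x \<mu> (?H * X_op ^ Suc i) = 0"
    unfolding inner_x_def by (simp add: mult.assoc power_commutes)
  have "inner_x \<mu> (sc (inverse c) * (?H * X_op ^ Suc i)) = 0"
    "inner_y q \<mu> (sc (inverse c) * (?H * X_op ^ Suc i)) = X_op ^ i"
    unfolding inner_sc x y using c0 by (simp_all add: sc_sc)
  then show ?thesis using SD_from_operator[of "sc (inverse c) * (?H * X_op ^ Suc i)"]
    by (simp add: QW_closed)
qed

text \<open>W is h^r N with N = z d/dz. When \<mu> q^r = 1, the twist by \<sigma> cancels the factor
  from moving h^r, so the values are h^r [N, x] = h^r x and h^r [N, y] = - h^r y; the minus sign at
  y is that of [N, y] = - y.\<close>

lemma H_values:
  assumes r: "\<mu> * q ^ r = 1" shows "\<exists>\<delta>\<in>SD. val \<delta> = (h_op q ^ r * X_op, - (h_op q ^ r * Y_op q))"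
proof -
  let ?W = "diag (\<lambda>m. of_nat m * (q ^ Suc m) ^ r)"
  have hr: "h_op q ^ r = hpoly q ([:0, 1:] ^ r)" by (simp only: hpoly_pow)
  have mr: "inverse \<mu> = q ^ r" using r mu by (simp add: field_simps)
  have x: "inner_x \<mu> ?W = h_op q ^ r * X_op"
    unfolding hr by (rule lop_eqI)
      (simp add: inner_x_def mr poly_power smult_monom diff_monom power_mult_distrib algebra_simps)
  have y: "inner_y q \<mu> ?W = - (h_op q ^ r * Y_op q)"
    unfolding hr
  proof (rule lop_eqI)
    fix m
    have e: "\<mu> * (q ^ r * c) = c" for c using r by (simp flip: mult.assoc)
    then have e': "\<mu> * (d * (q ^ r * c)) = d * c" for c d by (simp add: mult.left_commute)
    show "app (inner_y q \<mu> ?W) (monom 1 m) = app (- (hpoly q ([:0, 1:] ^ r) * Y_op q)) (monom 1 m)"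
      by (cases m) (simp_all add: inner_y_def poly_power smult_monom diff_monom minus_monom
        power_mult_distrib mult_ac, simp add: algebra_simps e e')
  qed
  show ?thesis using SD_from_operator[of ?W] unfolding x y by (simp add: QW_closed QW_h)
qed

end

section \<open>Vector spaces of value pairs and the conjugation action on them\<close>

definition inner_pairs :: "'k::field \<Rightarrow> 'k \<Rightarrow> ('k lop \<times> 'k lop) set"
  where "inner_pairs q \<mu> = {(inner_x \<mu> w, inner_y q \<mu> w) | w. w \<in> QW q}"

definition vscale :: "'k::field \<Rightarrow> 'k lop \<times> 'k lop \<Rightarrow> 'k lop \<times> 'k lop"
  where "vscale c s = (sc c * fst s, sc c * snd s)"

text \<open>Such spaces pull back along \<open>val\<close> to submodules of the skew derivations
  (\<open>submodule_pairs\<close>).\<close>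

definition pair_space :: "('k::field lop \<times> 'k lop) set \<Rightarrow> bool"
  where "pair_space V \<longleftrightarrow> 0 \<in> V \<and> (\<forall>s\<in>V. \<forall>s'\<in>V. s + s' \<in> V) \<and> (\<forall>c. \<forall>s\<in>V. vscale c s \<in> V)"

text \<open>The effect of conjugation by the automorphism \<open>x \<mapsto> \<beta>\<^sup>-\<^sup>1x\<close>, \<open>y \<mapsto> \<beta>y\<close> on the values at
  the generators.\<close>

definition conj_pair :: "'k::field \<Rightarrow> 'k lop \<times> 'k lop \<Rightarrow> 'k lop \<times> 'k lop"
  where "conj_pair \<beta> s = (sc \<beta> * twist \<beta> (fst s), sc (inverse \<beta>) * twist \<beta> (snd s))"

lemma pair_space_inner: "pair_space (inner_pairs q \<mu>)"
  unfolding pair_space_def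
proof (intro conjI ballI allI)
  show "0 \<in> inner_pairs q \<mu>"
    unfolding inner_pairs_def by (rule CollectI, rule exI[of _ 0]) (simp add: QW_0 prod_eq_iff)
  fix s assume "s \<in> inner_pairs q \<mu>"
  then obtain w where w: "w \<in> QW q" "s = (inner_x \<mu> w, inner_y q \<mu> w)" by (auto simp: inner_pairs_def)
  show "vscale c s \<in> inner_pairs q \<mu>" for c
    unfolding inner_pairs_def by (rule CollectI, rule exI[of _ "sc c * w"]) (simp add: w vscale_def inner_sc QW_closed)
  fix s' assume "s' \<in> inner_pairs q \<mu>"
  then obtain w' where w': "w' \<in> QW q" "s' = (inner_x \<mu> w', inner_y q \<mu> w')" by (auto simp: inner_pairs_def)
  show "s + s' \<in> inner_pairs q \<mu>"
    unfolding inner_pairs_def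
    by (rule CollectI, rule exI[of _ "w + w'"]) (simp add: w w' inner_x_add inner_y_add QW_closed)
qed

lemma pair_space_P: "pair_space (P_pairs q \<mu>)"
  unfolding pair_space_def
proof (intro conjI ballI allI)
  show "0 \<in> P_pairs q \<mu>" using P_pairs_0 by (simp add: zero_prod_def)
  show "s + s' \<in> P_pairs q \<mu>" if "s \<in> P_pairs q \<mu>" "s' \<in> P_pairs q \<mu>" for s s'
    using that by (rule P_pairs_add)
  fix c s assume "s \<in> P_pairs q \<mu>"
  then obtain a b where s: "s = (peval (Y_op q) a, peval X_op b)" "\<mu> = q \<or> a = 0 \<and> b = 0"
    by (auto simp: P_pairs_def)
  show "vscale c s \<in> P_pairs q \<mu>"
    unfolding P_pairs_def by (rule CollectI, rule exI[of _ "smult c a"], rule exI[of _ "smult c b"])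
      (use s in \<open>auto simp: vscale_def peval_smult\<close>)
qed

lemma (in qparam) pair_space_H: "pair_space (H_pairs q \<mu>)"
  unfolding pair_space_def
proof (intro conjI ballI allI)
  show "0 \<in> H_pairs q \<mu>" using H_pairs_0 by (simp add: zero_prod_def)
  show "s + s' \<in> H_pairs q \<mu>" if "s \<in> H_pairs q \<mu>" "s' \<in> H_pairs q \<mu>" for s s'
    using that by (rule H_pairs_add)
  fix c s assume "s \<in> H_pairs q \<mu>"
  then obtain d r where s: "s = (sc d * (h_op q ^ r * X_op), - (sc d * (h_op q ^ r * Y_op q)))"
    "\<mu> * q ^ r = 1 \<or> d = 0" by (auto simp: H_pairs_def)
  show "vscale c s \<in> H_pairs q \<mu>"
    unfolding H_pairs_def by (rule CollectI, rule exI[of _ "c * d"], rule exI[of _ r])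
      (use s in \<open>auto simp: vscale_def sc_arith mult.assoc\<close>)
qed

text \<open>Conjugating I_w by \<rho> gives I_(\<rho>(w)), because \<rho> commutes with
  \<sigma>.\<close>

lemma conj_pair_inner:
  assumes b: "\<beta> \<noteq> 0" and s: "s \<in> inner_pairs q \<mu>" shows "conj_pair \<beta> s \<in> inner_pairs q \<mu>"
proof -
  obtain w where w: "w \<in> QW q" "s = (inner_x \<mu> w, inner_y q \<mu> w)" using s by (auto simp: inner_pairs_def)
  have cancel: "\<beta> * (c * inverse \<beta>) = c" "inverse \<beta> * (c * \<beta>) = c" for c
    using b by simp_all
  have "sc \<beta> * twist \<beta> (inner_x \<mu> w) = inner_x \<mu> (twist \<beta> w)"
    using b by (simp add: inner_x_def twist_arith twist_mult twist_sc twist_X right_diff_distrib mult.assoc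
      sc_left_comm[of "twist \<beta> w"] sc_left_comm[of "sc \<beta>" "inverse \<mu>"] sc_sc cancel)
  moreover have "sc (inverse \<beta>) * twist \<beta> (inner_y q \<mu> w) = inner_y q \<mu> (twist \<beta> w)"
    using b by (simp add: inner_y_def twist_arith twist_mult twist_sc twist_Y right_diff_distrib mult.assoc
      sc_left_comm[of "twist \<beta> w"] sc_left_comm[of "sc (inverse \<beta>)" \<mu>] sc_sc cancel)
  ultimately show ?thesis
    unfolding inner_pairs_def
    by (intro CollectI exI[of _ "twist \<beta> w"]) (simp add: w conj_pair_def twist_QW b)
qed

text \<open>Each H_r is fixed by conjugation: h is invariant, and the scalars from x and y
  cancel.\<close>

lemma conj_pair_H:
  assumes b: "\<beta> \<noteq> 0" and s: "s \<in> H_pairs q \<mu>" shows "conj_pair \<beta> s \<in> H_pairs q \<mu>"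
proof -
  obtain d r where d: "s = (sc d * (h_op q ^ r * X_op), - (sc d * (h_op q ^ r * Y_op q)))"
    using s by (auto simp: H_pairs_def)
  have cancel: "\<beta> * (c * inverse \<beta>) = c" "inverse \<beta> * (\<beta> * c) = c" for c
    using b by simp_all
  have "conj_pair \<beta> s = s"
    using b by (simp add: d conj_pair_def twist_arith twist_mult twist_pow twist_hpoly twist_sc twist_X twist_Y
      sc_left_comm[of "h_op q ^ r"] sc_sc cancel mult.commute)
  then show ?thesis using s by simp
qed

text \<open>X_i is multiplied by \<beta>^(i+1) and Y_j by \<beta>^-(j+1), which rescales the
  coefficient polynomials.\<close>

lemma conj_pair_P:
  assumes b: "\<beta> \<noteq> 0" and s: "s \<in> P_pairs q \<mu>" shows "conj_pair \<beta> s \<in> P_pairs q \<mu>"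
proof -
  obtain a c where s: "s = (peval (Y_op q) a, peval X_op c)" "\<mu> = q \<or> a = 0 \<and> c = 0"
    using s by (auto simp: P_pairs_def)
  show ?thesis
    unfolding P_pairs_def
    by (rule CollectI, rule exI[of _ "smult \<beta> (sub \<beta> a)"], rule exI[of _ "smult (inverse \<beta>) (sub (inverse \<beta>) c)"])
      (use s b in \<open>auto simp: conj_pair_def peval_smult twist_peval_X twist_peval_Y sub_arith\<close>)
qed

section \<open>The three summands as preimages of spaces of pairs\<close>

context qskew
begin

lemma D_simps:
  "carrier D = SD" "a \<in> carrier R \<Longrightarrow> \<zero>\<^bsub>D\<^esub> a = \<zero>\<^bsub>R\<^esub>"
  "a \<in> carrier R \<Longrightarrow> (\<delta> \<oplus>\<^bsub>D\<^esub> \<epsilon>) a = \<delta> a \<oplus>\<^bsub>R\<^esub> \<epsilon> a"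
  "a \<in> carrier R \<Longrightarrow> (c \<odot>\<^bsub>D\<^esub> \<delta>) a = c \<odot>\<^bsub>R\<^esub> \<delta> a"
  "\<zero>\<^bsub>D\<^esub> \<in> extensional (carrier R)" "\<delta> \<oplus>\<^bsub>D\<^esub> \<epsilon> \<in> extensional (carrier R)"
  "c \<odot>\<^bsub>D\<^esub> \<delta> \<in> extensional (carrier R)"
  by (simp_all add: Der_def)

lemma D_zero: "\<zero>\<^bsub>D\<^esub> \<in> SD" "val \<zero>\<^bsub>D\<^esub> = 0"
  by (rule SD_I; simp add: D_simps carrier_in to_op_simps)
    (simp add: val_def D_simps carrier_in to_op_simps zero_prod_def)

lemma D_add:
  assumes "\<delta> \<in> SD" "\<epsilon> \<in> SD"
  shows "\<delta> \<oplus>\<^bsub>D\<^esub> \<epsilon> \<in> SD" "val (\<delta> \<oplus>\<^bsub>D\<^esub> \<epsilon>) = val \<delta> + val \<epsilon>"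
  using assms
  by (intro SD_I; simp add: D_simps SD_D carrier_in to_op_simps algebra_simps)
    (use assms in \<open>simp add: val_def D_simps SD_D carrier_in to_op_simps\<close>)

lemma D_smult:
  assumes "\<delta> \<in> SD"
  shows "c \<odot>\<^bsub>D\<^esub> \<delta> \<in> SD" "val (c \<odot>\<^bsub>D\<^esub> \<delta>) = vscale c (val \<delta>)"
proof -
  show "c \<odot>\<^bsub>D\<^esub> \<delta> \<in> SD"
    using assms by (intro SD_I; simp add: D_simps SD_D carrier_in to_op_simps distrib_left mult.assoc
      sc_left_comm[of "twist _ _"] sc_left_comm[of "sc c"])
  show "val (c \<odot>\<^bsub>D\<^esub> \<delta>) = vscale c (val \<delta>)"
    using assms by (simp add: val_def vscale_def D_simps SD_D carrier_in to_op_simps)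
qed

lemma abelian_group_D: "abelian_group D"
proof (rule abelian_groupI; unfold D_simps(1))
  fix \<delta> assume d: "\<delta> \<in> SD"
  have "(- 1) \<odot>\<^bsub>D\<^esub> \<delta> \<oplus>\<^bsub>D\<^esub> \<delta> = \<zero>\<^bsub>D\<^esub>"
    by (rule val_inj)
      (simp_all add: d D_add D_smult D_zero, simp add: prod_eq_iff vscale_def sc_arith)
  then show "\<exists>\<epsilon>\<in>SD. \<epsilon> \<oplus>\<^bsub>D\<^esub> \<delta> = \<zero>\<^bsub>D\<^esub>" using D_smult(1)[OF d] by blast
qed (auto intro!: val_inj simp: D_add D_zero add.assoc add.commute)

lemma submodule_pairs:
  assumes "pair_space V"
  shows "submodule {\<delta> \<in> SD. val \<delta> \<in> V} type_ring D"
proof -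
  interpret D: abelian_group D by (rule abelian_group_D)
  have inv: "\<ominus>\<^bsub>D\<^esub> \<delta> = (- 1) \<odot>\<^bsub>D\<^esub> \<delta>" if d: "\<delta> \<in> SD" for \<delta>
  proof (rule D.minus_equality)
    show "(- 1) \<odot>\<^bsub>D\<^esub> \<delta> \<oplus>\<^bsub>D\<^esub> \<delta> = \<zero>\<^bsub>D\<^esub>"
      by (rule val_inj)
        (simp_all add: d D_add D_smult D_zero, simp add: prod_eq_iff vscale_def sc_arith)
  qed (simp_all add: D_simps d D_smult)
  show ?thesis
  proof (intro submodule.intro subgroup.intro submodule_axioms.intro)
    fix \<delta> assume "\<delta> \<in> {\<delta> \<in> SD. val \<delta> \<in> V}"
    then show "inv\<^bsub>add_monoid D\<^esub> \<delta> \<in> {\<delta> \<in> SD. val \<delta> \<in> V}"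
      using inv[of \<delta>] assms by (simp add: a_inv_def D_smult pair_space_def)
  qed (use assms in \<open>auto simp: D_simps D_add D_zero D_smult pair_space_def\<close>)
qed

lemma inner_der_val:
  assumes w: "w \<in> carrier R"
  shows "inner_der R \<sigma> w \<in> SD" "val (inner_der R \<sigma> w) = (inner_x \<mu> (to_op w), inner_y q \<mu> (to_op w))"
proof -
  have d: "inner_der R \<sigma> w a \<in> carrier R" "to_op (inner_der R \<sigma> w a) = to_op w * to_op a - twist \<mu> (to_op a) * to_op w"
    if "a \<in> carrier R" for a
    using that w by (simp_all add: inner_der_def carrier_in to_op_simps \<sigma>_in to_op_\<sigma>)
  show "inner_der R \<sigma> w \<in> SD"
  proof (rule SD_I)
    show "to_op (inner_der R \<sigma> w (c \<odot>\<^bsub>R\<^esub> a)) = sc c * to_op (inner_der R \<sigma> w a)" if "a \<in> carrier R" for a c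
      using that by (simp add: d carrier_in to_op_simps twist_sc_mult right_diff_distrib sc_left_comm[of "to_op w"] mult.assoc)
  qed (simp_all add: d carrier_in to_op_simps twist_arith twist_mult mu algebra_simps, simp add: inner_der_def)
  show "val (inner_der R \<sigma> w) = (inner_x \<mu> (to_op w), inner_y q \<mu> (to_op w))"
    by (simp add: val_def d carrier_in to_op_simps twist_X twist_Y mu inner_x_def inner_y_def mult.assoc)
qed

lemma Inn_eq: "Inn R \<sigma> = {\<delta> \<in> SD. val \<delta> \<in> inner_pairs q \<mu>}"
proof (intro equalityI subsetI)
  fix \<delta> assume "\<delta> \<in> Inn R \<sigma>"
  then show "\<delta> \<in> {\<delta> \<in> SD. val \<delta> \<in> inner_pairs q \<mu>}"
    using inner_der_val to_op_in by (auto simp: Inn_def inner_pairs_def)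
next
  fix \<delta> assume d: "\<delta> \<in> {\<delta> \<in> SD. val \<delta> \<in> inner_pairs q \<mu>}"
  then obtain w where w: "w \<in> QW q" "val \<delta> = (inner_x \<mu> w, inner_y q \<mu> w)" by (auto simp: inner_pairs_def)
  have "\<delta> = inner_der R \<sigma> (of_op w)"
    by (rule val_inj) (use d w in \<open>simp_all add: inner_der_val of_op_in to_op_of_op\<close>)
  then show "\<delta> \<in> Inn R \<sigma>" using w by (auto simp: Inn_def of_op_in)
qed

lemma mu_power_iff: "\<mu> = inverse q ^ r \<longleftrightarrow> \<mu> * q ^ r = 1"
  using q0 by (auto simp: power_inverse field_simps)

lemma H_der_val:
  assumes r: "\<mu> * q ^ r = 1"
  shows "H_der q \<mu> \<sigma> r \<in> SD" "val (H_der q \<mu> \<sigma> r) = (h_op q ^ r * X_op, - (h_op q ^ r * Y_op q))"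
proof -
  define u where "u = qweyl_h q [^]\<^bsub>R\<^esub> r \<otimes>\<^bsub>R\<^esub> qweyl_x q"
  define v where "v = \<ominus>\<^bsub>R\<^esub> (inverse \<mu> \<odot>\<^bsub>R\<^esub> ((inverse q \<odot>\<^bsub>R\<^esub> qweyl_h q) [^]\<^bsub>R\<^esub> r \<otimes>\<^bsub>R\<^esub> qweyl_y q))"
  have c: "u \<in> carrier R" "v \<in> carrier R" by (simp_all add: u_def v_def carrier_in h_in)
  have u: "to_op u = h_op q ^ r * X_op" by (simp add: u_def to_op_simps carrier_in h_in to_op_h)
  \<comment> \<open>These are the two scalars in the definition of the value at y; they cancel at
    resonance.\<close>
  have "inverse \<mu> * inverse q ^ r = 1" using r by (metis inverse_1 inverse_mult_distrib power_inverse)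
  then have v: "to_op v = - (h_op q ^ r * Y_op q)"
    by (simp add: v_def to_op_simps carrier_in h_in to_op_h sc_mult_pow mult.assoc sc_sc)
  show "H_der q \<mu> \<sigma> r \<in> SD" "val (H_der q \<mu> \<sigma> r) = (h_op q ^ r * X_op, - (h_op q ^ r * Y_op q))"
    using der_on_gens[of u v] H_values[OF r] c unfolding H_der_def u_def[symmetric] v_def[symmetric] by (simp_all add: u v)
qed

lemma H_space_eq: "H_space q \<mu> \<sigma> = {\<delta> \<in> SD. val \<delta> \<in> H_pairs q \<mu>}"
proof (intro equalityI subsetI)
  fix \<delta> assume d: "\<delta> \<in> H_space q \<mu> \<sigma>"
  show "\<delta> \<in> {\<delta> \<in> SD. val \<delta> \<in> H_pairs q \<mu>}"
  proof (cases "\<exists>r. \<mu> * q ^ r = 1")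
    case True
    then obtain c r where "\<delta> = c \<odot>\<^bsub>D\<^esub> H_der q \<mu> \<sigma> r" "\<mu> * q ^ r = 1"
      using d by (auto simp: H_space_def mu_power_iff)
    then show ?thesis using H_pairs_I[of \<mu> q r c] by (simp add: D_smult H_der_val vscale_def)
  next
    case False
    then have "\<delta> = \<zero>\<^bsub>D\<^esub>" using d by (simp add: H_space_def mu_power_iff)
    then show ?thesis using pair_space_H by (simp add: D_zero pair_space_def)
  qed
next
  fix \<delta> assume "\<delta> \<in> {\<delta> \<in> SD. val \<delta> \<in> H_pairs q \<mu>}"
  then obtain c r where d: "\<delta> \<in> SD" and v: "val \<delta> = (sc c * (h_op q ^ r * X_op), - (sc c * (h_op q ^ r * Y_op q)))"
    and r: "\<mu> * q ^ r = 1 \<or> c = 0"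
    by (auto simp: H_pairs_def)
  have z: "val \<delta> = 0" if "c = 0" using that v by (simp add: zero_prod_def)
  show "\<delta> \<in> H_space q \<mu> \<sigma>"
  proof (cases "\<exists>r. \<mu> * q ^ r = 1")
    case True
    \<comment> \<open>For c = 0 the exponent in the pair is arbitrary, so a resonant one is
      substituted.\<close>
    obtain r' where r': "\<mu> * q ^ r' = 1" "c = 0 \<or> r' = r" using True r by blast
    have "\<delta> = c \<odot>\<^bsub>D\<^esub> H_der q \<mu> \<sigma> r'"
      by (rule val_inj) (use r' d v z in \<open>auto simp: D_smult H_der_val vscale_def zero_prod_def\<close>)
    then show ?thesis using True r' by (auto simp: H_space_def mu_power_iff)
  next
    case False
    then have "\<delta> = \<zero>\<^bsub>D\<^esub>" using r by (intro val_inj) (simp_all add: d D_zero z)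
    then show ?thesis using False by (simp add: H_space_def mu_power_iff)
  qed
qed

lemma X_der_val:
  assumes "\<mu> = q" shows "X_der q \<sigma> i \<in> SD" "val (X_der q \<sigma> i) = (Y_op q ^ i, 0)"
  using der_on_gens[of "qweyl_y q [^]\<^bsub>R\<^esub> i" "\<zero>\<^bsub>R\<^esub>"] X_values[OF assms, of i]
  by (simp_all add: X_der_def to_op_simps carrier_in)

lemma Y_der_val:
  assumes "\<mu> = q" shows "Y_der q \<sigma> i \<in> SD" "val (Y_der q \<sigma> i) = (0, X_op ^ i)"
  using der_on_gens[of "\<zero>\<^bsub>R\<^esub>" "qweyl_x q [^]\<^bsub>R\<^esub> i"] Y_values[OF assms, of i]
  by (simp_all add: Y_der_def to_op_simps carrier_in)

lemma D_finsum:
  assumes "finite S" "\<And>i. i \<in> S \<Longrightarrow> f i \<in> SD"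
  shows "(\<Oplus>\<^bsub>D\<^esub>i\<in>S. f i) \<in> SD \<and> val (\<Oplus>\<^bsub>D\<^esub>i\<in>S. f i) = (\<Sum>i\<in>S. val (f i))"
  using assms
proof (induction S rule: finite_induct)
  interpret D: abelian_group D by (rule abelian_group_D)
  case empty
  show ?case by (simp add: D_zero)
next
  interpret D: abelian_group D by (rule abelian_group_D)
  case (insert i S)
  have "(\<Oplus>\<^bsub>D\<^esub>j\<in>insert i S. f j) = f i \<oplus>\<^bsub>D\<^esub> (\<Oplus>\<^bsub>D\<^esub>j\<in>S. f j)"
    using insert by (intro D.finsum_insert) (auto simp: D_simps)
  then show ?case using insert by (simp add: D_add)
qed

lemma P_sum_val:
  fixes a b :: "nat \<Rightarrow> 'k" and S T :: "nat set"
  assumes m: "\<mu> = q" and fin: "finite S" "finite T"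
  defines "\<delta> \<equiv> (\<Oplus>\<^bsub>D\<^esub>i \<in> S. a i \<odot>\<^bsub>D\<^esub> X_der q \<sigma> i) \<oplus>\<^bsub>D\<^esub> (\<Oplus>\<^bsub>D\<^esub>j \<in> T. b j \<odot>\<^bsub>D\<^esub> Y_der q \<sigma> j)"
  shows "\<delta> \<in> SD" "val \<delta> = (peval (Y_op q) (\<Sum>i\<in>S. monom (a i) i), peval X_op (\<Sum>j\<in>T. monom (b j) j))"
proof -
  have 1: "(\<Oplus>\<^bsub>D\<^esub>i \<in> S. a i \<odot>\<^bsub>D\<^esub> X_der q \<sigma> i) \<in> SD \<and>
      val (\<Oplus>\<^bsub>D\<^esub>i \<in> S. a i \<odot>\<^bsub>D\<^esub> X_der q \<sigma> i) = (\<Sum>i\<in>S. (sc (a i) * Y_op q ^ i, 0))"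
    using D_finsum[OF fin(1), of "\<lambda>i. a i \<odot>\<^bsub>D\<^esub> X_der q \<sigma> i"]
    by (simp add: D_smult X_der_val[OF m] vscale_def)
  have 2: "(\<Oplus>\<^bsub>D\<^esub>j \<in> T. b j \<odot>\<^bsub>D\<^esub> Y_der q \<sigma> j) \<in> SD \<and>
      val (\<Oplus>\<^bsub>D\<^esub>j \<in> T. b j \<odot>\<^bsub>D\<^esub> Y_der q \<sigma> j) = (\<Sum>j\<in>T. (0, sc (b j) * X_op ^ j))"
    using D_finsum[OF fin(2), of "\<lambda>j. b j \<odot>\<^bsub>D\<^esub> Y_der q \<sigma> j"]
    by (simp add: D_smult Y_der_val[OF m] vscale_def)
  show "\<delta> \<in> SD" using 1 2 by (simp add: \<delta>_def D_add)
  show "val \<delta> = (peval (Y_op q) (\<Sum>i\<in>S. monom (a i) i), peval X_op (\<Sum>j\<in>T. monom (b j) j))"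
    using 1 2 by (simp add: \<delta>_def D_add prod_eq_iff fst_sum snd_sum peval_sum peval_monom)
qed

lemma P_space_eq: "P_space q \<mu> \<sigma> = {\<delta> \<in> SD. val \<delta> \<in> P_pairs q \<mu>}"
proof (cases "\<mu> = q")
  case m: True
  show ?thesis
  proof (intro equalityI subsetI)
    fix \<delta> assume "\<delta> \<in> P_space q \<mu> \<sigma>"
    then obtain a b S T where "finite S" "finite T"
      "\<delta> = (\<Oplus>\<^bsub>D\<^esub>i \<in> S. a i \<odot>\<^bsub>D\<^esub> X_der q \<sigma> i) \<oplus>\<^bsub>D\<^esub> (\<Oplus>\<^bsub>D\<^esub>j \<in> T. b j \<odot>\<^bsub>D\<^esub> Y_der q \<sigma> j)"
      unfolding P_space_def Let_def if_P[OF m] by blast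
    then show "\<delta> \<in> {\<delta> \<in> SD. val \<delta> \<in> P_pairs q \<mu>}"
      using P_sum_val[OF m, of S T a b] P_pairs_I[of q] m by simp
  next
    fix \<delta> assume "\<delta> \<in> {\<delta> \<in> SD. val \<delta> \<in> P_pairs q \<mu>}"
    then obtain a b where d: "\<delta> \<in> SD" "val \<delta> = (peval (Y_op q) a, peval X_op b)" by (auto simp: P_pairs_def)
    have "\<delta> = (\<Oplus>\<^bsub>D\<^esub>i \<in> {..degree a}. coeff a i \<odot>\<^bsub>D\<^esub> X_der q \<sigma> i) \<oplus>\<^bsub>D\<^esub>
        (\<Oplus>\<^bsub>D\<^esub>j \<in> {..degree b}. coeff b j \<odot>\<^bsub>D\<^esub> Y_der q \<sigma> j)"
      by (rule val_inj) (use d in \<open>simp_all add: P_sum_val[OF m] poly_as_sum_of_monoms\<close>)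
    then show "\<delta> \<in> P_space q \<mu> \<sigma>"
      unfolding P_space_def Let_def if_P[OF m] by blast
  qed
next
  case False
  then have "P_pairs q \<mu> = {0}" by (auto simp: P_pairs_def zero_prod_def)
  moreover have "\<delta> \<in> SD \<and> val \<delta> = 0 \<longleftrightarrow> \<delta> = \<zero>\<^bsub>D\<^esub>" for \<delta>
    using val_inj[of \<delta> "\<zero>\<^bsub>D\<^esub>"] D_zero by metis
  ultimately show ?thesis using False by (simp add: P_space_def)
qed

section \<open>Decomposition, uniqueness and stability for skew derivations\<close>

lemma decomposition:
  assumes "\<delta> \<in> SD"
  shows "\<exists>\<iota>\<in>Inn R \<sigma>. \<exists>\<eta>\<in>H_space q \<mu> \<sigma>. \<exists>\<xi>\<in>P_space q \<mu> \<sigma>. \<delta> = \<iota> \<oplus>\<^bsub>D\<^esub> \<eta> \<oplus>\<^bsub>D\<^esub> \<xi>"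
proof -
  obtain w s where w: "w \<in> QW q" and s: "s \<in> special \<mu>"
    and e: "val \<delta> = (inner_x \<mu> w, inner_y q \<mu> w) + s"
    using compatible_decomposition[OF mu val_in[OF assms] val_compatible[OF assms]] by auto
  from s obtain s1 s2 where s12: "s = s1 + s2" "s1 \<in> H_pairs q \<mu>" "s2 \<in> P_pairs q \<mu>"
    by (auto simp: special_def)
  obtain \<eta> where \<eta>: "\<eta> \<in> SD" "val \<eta> = s1"
  proof -
    from s12(2) obtain c r where c: "s1 = (sc c * (h_op q ^ r * X_op), - (sc c * (h_op q ^ r * Y_op q)))"
      "\<mu> * q ^ r = 1 \<or> c = 0" by (auto simp: H_pairs_def)
    show thesis
    proof (cases "c = 0")
      case True
      then show ?thesis using that[of "\<zero>\<^bsub>D\<^esub>"] c(1) by (simp add: D_zero zero_prod_def)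
    next
      case False
      then show ?thesis using that[of "c \<odot>\<^bsub>D\<^esub> H_der q \<mu> \<sigma> r"] c by (simp add: D_smult H_der_val vscale_def)
    qed
  qed
  obtain \<xi> where \<xi>: "\<xi> \<in> SD" "val \<xi> = s2"
  proof -
    from s12(3) obtain a b where ab: "s2 = (peval (Y_op q) a, peval X_op b)" "\<mu> = q \<or> a = 0 \<and> b = 0"
      by (auto simp: P_pairs_def)
    show thesis
    proof (cases "\<mu> = q")
      case True
      show ?thesis
        using that[OF P_sum_val(1)[OF True, of "{..degree a}" "{..degree b}" "coeff a" "coeff b"]]
        by (simp add: P_sum_val[OF True] poly_as_sum_of_monoms ab(1))
    next
      case False
      then show ?thesis using that[of "\<zero>\<^bsub>D\<^esub>"] ab by (simp add: D_zero zero_prod_def)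
    qed
  qed
  define \<iota> where "\<iota> = inner_der R \<sigma> (of_op w)"
  have \<iota>: "\<iota> \<in> SD" "val \<iota> = (inner_x \<mu> w, inner_y q \<mu> w)"
    by (simp_all add: \<iota>_def inner_der_val of_op_in to_op_of_op w)
  have "\<delta> = \<iota> \<oplus>\<^bsub>D\<^esub> \<eta> \<oplus>\<^bsub>D\<^esub> \<xi>"
    by (rule val_inj) (simp_all add: assms \<iota> \<eta> \<xi> D_add e s12(1) add.assoc)
  moreover have "\<iota> \<in> Inn R \<sigma>" "\<eta> \<in> H_space q \<mu> \<sigma>" "\<xi> \<in> P_space q \<mu> \<sigma>"
    using \<iota> \<eta> \<xi> s12 w by (auto simp: Inn_eq H_space_eq P_space_eq inner_pairs_def)
  ultimately show ?thesis by blast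
qed

lemma sum_zero:
  assumes "i \<in> inner_pairs q \<mu>" "s \<in> H_pairs q \<mu>" "t \<in> P_pairs q \<mu>" "i + s + t = 0"
  shows "i = 0 \<and> s = 0 \<and> t = 0"
proof -
  obtain w where w: "w \<in> QW q" "i = (inner_x \<mu> w, inner_y q \<mu> w)" using assms(1) by (auto simp: inner_pairs_def)
  obtain A B where s: "s = (A, B)" by (cases s)
  obtain C E where t: "t = (C, E)" by (cases t)
  note st = s t
  have "A = 0 \<and> B = 0 \<and> C = 0 \<and> E = 0"
    by (rule decomposition_unique[OF mu w(1)]) (use assms(2,3,4) w st in \<open>auto simp: prod_eq_iff\<close>)
  then show ?thesis using assms(4) st by (auto simp: zero_prod_def)
qed

lemma pair_space_diff:
  assumes "pair_space V" "s \<in> V" "s' \<in> V" shows "s - s' \<in> V"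
proof -
  have "s - s' = s + vscale (- 1) s'" by (simp add: vscale_def sc_arith prod_eq_iff)
  moreover have "s + vscale (- 1) s' \<in> V" using assms unfolding pair_space_def by blast
  ultimately show ?thesis by metis
qed

lemma decomposition_inj:
  assumes "\<iota> \<in> Inn R \<sigma>" "\<eta> \<in> H_space q \<mu> \<sigma>" "\<xi> \<in> P_space q \<mu> \<sigma>"
    and "\<iota>' \<in> Inn R \<sigma>" "\<eta>' \<in> H_space q \<mu> \<sigma>" "\<xi>' \<in> P_space q \<mu> \<sigma>"
    and e: "\<iota> \<oplus>\<^bsub>D\<^esub> \<eta> \<oplus>\<^bsub>D\<^esub> \<xi> = \<iota>' \<oplus>\<^bsub>D\<^esub> \<eta>' \<oplus>\<^bsub>D\<^esub> \<xi>'"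
  shows "\<iota> = \<iota>' \<and> \<eta> = \<eta>' \<and> \<xi> = \<xi>'"
proof -
  note sp = Inn_eq H_space_eq P_space_eq
  have SD: "\<iota> \<in> SD" "\<eta> \<in> SD" "\<xi> \<in> SD" "\<iota>' \<in> SD" "\<eta>' \<in> SD" "\<xi>' \<in> SD"
    using assms by (auto simp: sp)
  have "(val \<iota> - val \<iota>') + (val \<eta> - val \<eta>') + (val \<xi> - val \<xi>') = 0"
    using arg_cong[OF e, of val] SD by (simp add: D_add algebra_simps)
  moreover have "val \<iota> - val \<iota>' \<in> inner_pairs q \<mu>" "val \<eta> - val \<eta>' \<in> H_pairs q \<mu>" "val \<xi> - val \<xi>' \<in> P_pairs q \<mu>"
    using assms pair_space_diff[OF pair_space_inner] pair_space_diff[OF pair_space_H]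
      pair_space_diff[OF pair_space_P] unfolding sp by blast+
  ultimately have "val \<iota> - val \<iota>' = 0 \<and> val \<eta> - val \<eta>' = 0 \<and> val \<xi> - val \<xi>' = 0"
    by (intro sum_zero)
  then show ?thesis using val_inj SD by auto
qed

text \<open>One \<beta> from the classification of automorphisms serves all \<delta>. As the inverse
  of \<rho> sends x to \<beta> x and y to \<beta>^-1 y, linearity of \<delta> produces the factors
  in \<open>conj_pair\<close>.\<close>

lemma conj_val:
  assumes \<rho>: "\<rho> \<in> alg_aut R"
  shows "\<exists>\<beta>. \<beta> \<noteq> 0 \<and> (\<forall>\<delta>\<in>SD. conj_map R \<rho> \<delta> \<in> SD \<and> val (conj_map R \<rho> \<delta>) = conj_pair \<beta> (val \<delta>))"
proof -
  obtain \<beta> where b: "\<beta> \<noteq> 0" and x: "\<rho> (qweyl_x q) = inverse \<beta> \<odot>\<^bsub>R\<^esub> qweyl_x q"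
    and y: "\<rho> (qweyl_y q) = \<beta> \<odot>\<^bsub>R\<^esub> qweyl_y q"
    using alg_aut_classification[OF \<rho>] by blast
  let ?s = "inv_into (carrier R) \<rho>"
  note tw = alg_aut_twist[OF \<rho> b x y] and r = alg_autD[OF \<rho>] and i = alg_aut_inv[OF \<rho>]
  have si: "to_op (?s a) = twist (inverse \<beta>) (to_op a)" if "a \<in> carrier R" for a
  proof -
    have "twist (inverse \<beta>) (to_op a) = twist (inverse \<beta>) (to_op (\<rho> (?s a)))" using i(2)[OF that] by simp
    also have "\<dots> = to_op (?s a)" unfolding tw[OF i(1)[OF that]] using b by (simp add: twist_twist twist_one_param)
    finally show ?thesis by simp
  qed
  have b': "inverse \<beta> \<noteq> 0" using b by simp
  have s_add: "?s (a \<oplus>\<^bsub>R\<^esub> c) = ?s a \<oplus>\<^bsub>R\<^esub> ?s c" if "a \<in> carrier R" "c \<in> carrier R" for a c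
    using that by (intro to_op_inj) (simp_all add: i si carrier_in to_op_simps twist_arith)
  have s_mult: "?s (a \<otimes>\<^bsub>R\<^esub> c) = ?s a \<otimes>\<^bsub>R\<^esub> ?s c" if "a \<in> carrier R" "c \<in> carrier R" for a c
    using that by (intro to_op_inj) (simp_all add: i si carrier_in to_op_simps twist_mult b)
  have s_smult: "?s (d \<odot>\<^bsub>R\<^esub> a) = d \<odot>\<^bsub>R\<^esub> ?s a" if "a \<in> carrier R" for a d
    using that by (intro to_op_inj) (simp_all add: i si carrier_in to_op_simps twist_sc_mult)
  have sx: "?s (qweyl_x q) = \<beta> \<odot>\<^bsub>R\<^esub> qweyl_x q" and sy: "?s (qweyl_y q) = inverse \<beta> \<odot>\<^bsub>R\<^esub> qweyl_y q"
    by (rule to_op_inj; simp add: i si carrier_in to_op_simps twist_X twist_Y b)+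
  have "conj_map R \<rho> \<delta> \<in> SD \<and> val (conj_map R \<rho> \<delta>) = conj_pair \<beta> (val \<delta>)" if d: "\<delta> \<in> SD" for \<delta>
  proof
    note dd = SD_D[OF d]
    have c: "conj_map R \<rho> \<delta> a = \<rho> (\<delta> (?s a))" "to_op (\<rho> (\<delta> (?s a))) = twist \<beta> (to_op (\<delta> (?s a)))"
      if "a \<in> carrier R" for a
      using that by (simp_all add: conj_map_def tw dd i)
    have cancel: "twist \<beta> (twist (inverse \<beta>) t) = t" for t
      using b by (simp add: twist_twist twist_one_param)
    \<comment> \<open>Diagonal conjugations commute, so the conjugate is again a skew derivation for
      the same \<sigma>.\<close>
    have comm: "twist \<beta> (twist \<mu> (twist (inverse \<beta>) t)) = twist \<mu> t" for t
    proof -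
      have "\<beta> * (\<mu> * inverse \<beta>) = \<mu>" using b by simp
      then show ?thesis by (simp only: twist_twist)
    qed
    show "conj_map R \<rho> \<delta> \<in> SD"
      by (rule SD_I)
        (simp_all add: c dd i r s_add s_mult s_smult carrier_in twist_arith twist_mult b twist_sc_mult si comm
          cancel tw, simp add: conj_map_def)
    show "val (conj_map R \<rho> \<delta>) = conj_pair \<beta> (val \<delta>)"
      by (simp add: val_def conj_pair_def c carrier_in dd sx sy tw twist_sc_mult b)
  qed
  then show ?thesis using b by blast
qed

lemma conj_stable_pairs:
  assumes "\<And>\<beta> s. \<beta> \<noteq> 0 \<Longrightarrow> s \<in> V \<Longrightarrow> conj_pair \<beta> s \<in> V"
  shows "conj_stable R {\<delta> \<in> SD. val \<delta> \<in> V}"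
  unfolding conj_stable_def
proof (intro ballI)
  fix \<rho> \<delta> assume "\<rho> \<in> alg_aut R" and d: "\<delta> \<in> {\<delta> \<in> SD. val \<delta> \<in> V}"
  then obtain \<beta> where "\<beta> \<noteq> 0" "conj_map R \<rho> \<delta> \<in> SD" "val (conj_map R \<rho> \<delta>) = conj_pair \<beta> (val \<delta>)"
    using conj_val by blast
  then show "conj_map R \<rho> \<delta> \<in> {\<delta> \<in> SD. val \<delta> \<in> V}" using assms d by simp
qed

theorem skew_der_direct_sum:
  "(\<forall>\<delta> \<in> SD. \<exists>!(\<iota>, \<eta>, \<xi>). \<iota> \<in> Inn R \<sigma> \<and> \<eta> \<in> H_space q \<mu> \<sigma> \<and> \<xi> \<in> P_space q \<mu> \<sigma> \<and>
              \<delta> = \<iota> \<oplus>\<^bsub>D\<^esub> \<eta> \<oplus>\<^bsub>D\<^esub> \<xi>)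
    \<and> internal_direct_sum3 D (Inn R \<sigma>) (H_space q \<mu> \<sigma>) (P_space q \<mu> \<sigma>)
    \<and> conj_stable R (Inn R \<sigma>) \<and> conj_stable R (H_space q \<mu> \<sigma>) \<and> conj_stable R (P_space q \<mu> \<sigma>)"
proof (intro conjI ballI)
  fix \<delta> assume "\<delta> \<in> SD"
  then obtain \<iota> \<eta> \<xi> where d: "\<iota> \<in> Inn R \<sigma>" "\<eta> \<in> H_space q \<mu> \<sigma>" "\<xi> \<in> P_space q \<mu> \<sigma>" "\<delta> = \<iota> \<oplus>\<^bsub>D\<^esub> \<eta> \<oplus>\<^bsub>D\<^esub> \<xi>"
    using decomposition by blast
  show "\<exists>!(\<iota>, \<eta>, \<xi>). \<iota> \<in> Inn R \<sigma> \<and> \<eta> \<in> H_space q \<mu> \<sigma> \<and> \<xi> \<in> P_space q \<mu> \<sigma> \<and> \<delta> = \<iota> \<oplus>\<^bsub>D\<^esub> \<eta> \<oplus>\<^bsub>D\<^esub> \<xi>"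
  proof (rule ex1I[of _ "(\<iota>, \<eta>, \<xi>)"])
    show "case (\<iota>, \<eta>, \<xi>) of (\<iota>, \<eta>, \<xi>) \<Rightarrow> \<iota> \<in> Inn R \<sigma> \<and> \<eta> \<in> H_space q \<mu> \<sigma> \<and> \<xi> \<in> P_space q \<mu> \<sigma> \<and> \<delta> = \<iota> \<oplus>\<^bsub>D\<^esub> \<eta> \<oplus>\<^bsub>D\<^esub> \<xi>"
      using d by simp
  next
    fix t assume "case t of (\<iota>, \<eta>, \<xi>) \<Rightarrow> \<iota> \<in> Inn R \<sigma> \<and> \<eta> \<in> H_space q \<mu> \<sigma> \<and> \<xi> \<in> P_space q \<mu> \<sigma> \<and> \<delta> = \<iota> \<oplus>\<^bsub>D\<^esub> \<eta> \<oplus>\<^bsub>D\<^esub> \<xi>"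
    then obtain \<iota>' \<eta>' \<xi>' where t: "t = (\<iota>', \<eta>', \<xi>')" "\<iota>' \<in> Inn R \<sigma>" "\<eta>' \<in> H_space q \<mu> \<sigma>" "\<xi>' \<in> P_space q \<mu> \<sigma>"
      "\<delta> = \<iota>' \<oplus>\<^bsub>D\<^esub> \<eta>' \<oplus>\<^bsub>D\<^esub> \<xi>'" by (cases t) auto
    have "\<iota>' = \<iota> \<and> \<eta>' = \<eta> \<and> \<xi>' = \<xi>"
      by (rule decomposition_inj[OF t(2,3,4) d(1,2,3)]) (simp only: t(5)[symmetric] d(4)[symmetric])
    then show "t = (\<iota>, \<eta>, \<xi>)" by (simp add: t(1))
  qed
next
  show "internal_direct_sum3 D (Inn R \<sigma>) (H_space q \<mu> \<sigma>) (P_space q \<mu> \<sigma>)"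
    unfolding internal_direct_sum3_def
  proof (intro conjI ballI impI)
    show "submodule (Inn R \<sigma>) type_ring D" "submodule (H_space q \<mu> \<sigma>) type_ring D" "submodule (P_space q \<mu> \<sigma>) type_ring D"
      unfolding Inn_eq H_space_eq P_space_eq
      by (intro submodule_pairs pair_space_inner pair_space_H pair_space_P)+
    show "carrier D = Inn R \<sigma> <+>\<^bsub>D\<^esub> H_space q \<mu> \<sigma> <+>\<^bsub>D\<^esub> P_space q \<mu> \<sigma>"
    proof (intro equalityI subsetI)
      fix \<delta> assume "\<delta> \<in> carrier D"
      then show "\<delta> \<in> Inn R \<sigma> <+>\<^bsub>D\<^esub> H_space q \<mu> \<sigma> <+>\<^bsub>D\<^esub> P_space q \<mu> \<sigma>"
        using decomposition[of \<delta>] by (auto simp: set_add_def' D_simps)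
    qed (auto simp: set_add_def' D_simps D_add Inn_eq H_space_eq P_space_eq)
    fix a b c
    assume abc: "a \<in> Inn R \<sigma>" "b \<in> H_space q \<mu> \<sigma>" "c \<in> P_space q \<mu> \<sigma>" "a \<oplus>\<^bsub>D\<^esub> b \<oplus>\<^bsub>D\<^esub> c = \<zero>\<^bsub>D\<^esub>"
    \<comment> \<open>Independence is uniqueness applied to the decomposition 0 = 0 + 0 + 0.\<close>
    have z: "\<zero>\<^bsub>D\<^esub> \<in> Inn R \<sigma>" "\<zero>\<^bsub>D\<^esub> \<in> H_space q \<mu> \<sigma>" "\<zero>\<^bsub>D\<^esub> \<in> P_space q \<mu> \<sigma>"
      using pair_space_inner[of q \<mu>] pair_space_H[of \<mu>] pair_space_P[of q \<mu>]
      by (simp_all add: Inn_eq H_space_eq P_space_eq D_zero pair_space_def)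
    have "\<zero>\<^bsub>D\<^esub> \<oplus>\<^bsub>D\<^esub> \<zero>\<^bsub>D\<^esub> \<oplus>\<^bsub>D\<^esub> \<zero>\<^bsub>D\<^esub> = \<zero>\<^bsub>D\<^esub>"
      by (rule val_inj) (simp_all add: D_add D_zero)
    then have "a = \<zero>\<^bsub>D\<^esub> \<and> b = \<zero>\<^bsub>D\<^esub> \<and> c = \<zero>\<^bsub>D\<^esub>"
      using abc z by (intro decomposition_inj) auto
    then show "a = \<zero>\<^bsub>D\<^esub>" "b = \<zero>\<^bsub>D\<^esub>" "c = \<zero>\<^bsub>D\<^esub>" by auto
  qed
qed (unfold Inn_eq H_space_eq P_space_eq,
  (rule conj_stable_pairs; rule conj_pair_inner conj_pair_H conj_pair_P; assumption)+)

end

theorem proposition12: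
  fixes q \<mu> :: "'k::{alg_closed_field, field_char_0}"
    and \<sigma> :: "'k free_alg set \<Rightarrow> 'k free_alg set"
  assumes "q \<noteq> 0"
    and "\<forall>n::nat. n > 0 \<longrightarrow> q ^ n \<noteq> 1"
    and "\<mu> \<noteq> 0"
    and "\<sigma> \<in> alg_aut (qweyl q)"
    and "\<sigma> (qweyl_x q) = inverse \<mu> \<odot>\<^bsub>qweyl q\<^esub> qweyl_x q"
    and "\<sigma> (qweyl_y q) = \<mu> \<odot>\<^bsub>qweyl q\<^esub> qweyl_y q"
  shows "(\<forall>\<delta> \<in> skew_der (qweyl q) \<sigma>.
            \<exists>!(\<iota>, \<eta>, \<xi>). \<iota> \<in> Inn (qweyl q) \<sigma> \<and> \<eta> \<in> H_space q \<mu> \<sigma> \<and> \<xi> \<in> P_space q \<mu> \<sigma> \<and>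
              \<delta> = \<iota> \<oplus>\<^bsub>Der (qweyl q) \<sigma>\<^esub> \<eta> \<oplus>\<^bsub>Der (qweyl q) \<sigma>\<^esub> \<xi>)
    \<and> internal_direct_sum3 (Der (qweyl q) \<sigma>)
        (Inn (qweyl q) \<sigma>) (H_space q \<mu> \<sigma>) (P_space q \<mu> \<sigma>)
    \<and> conj_stable (qweyl q) (Inn (qweyl q) \<sigma>)
    \<and> conj_stable (qweyl q) (H_space q \<mu> \<sigma>)
    \<and> conj_stable (qweyl q) (P_space q \<mu> \<sigma>)"
proof -
  interpret qskew q \<mu> \<sigma>
    by unfold_locales (use assms in auto)
  show ?thesis by (rule skew_der_direct_sum)
qed

end
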